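(* Consider a purely kinetic Chaplygin system with symmetry group $G$. Given $\varphi\in C^\infty(Q/G)$, the following statements are equivalent: (i) $\varphi$ satisfies the $\varphi$-simplicity property $R^d_{ab}=-\frac{\partial\varphi}{\partial q^a}\delta^d_b+\frac{\partial\varphi}{\partial q^b}\delta^d_a$ (equivalently $d\varphi\wedge\theta_l=\Xi^G$); (ii) the function $f=\varphi$ satisfies $$(A')^G\quad G_{bk}R^k_{ac}+G_{ak}R^k_{bc}+g_{bc}\frac{\partial f}{\partial q^a}+g_{ac}\frac{\partial f}{\partial q^b}-2g_{ab}\frac{\partial f}{\partial q^c}=0\quad\text{for all }a,b,c$$ (equivalently $d\varphi\wedge\theta_l=\gamma^G$), and $$\sum_{cycl:\tilde X,\tilde Y,\tilde Z}g^{red}(\tilde X,\mathcal T(\tilde Y,\tilde Z))=0\quad\text{for all vector fields }\tilde X,\tilde Y,\tilde Z\text{ on }Q/G.$$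
   Context: Setting: $Q$ is an $n$-dimensional manifold with Riemannian metric $g$, $\mathcal D\subset TQ$ is a distribution of rank $m$, $L(v)=\frac12g(v,v)$. The system $(L,\mathcal D)$ is a (purely kinetic) Chaplygin system: a Lie group $G$ acts freely and properly on $Q$, $\pi:Q\to Q/G$ is the principal bundle, $g$ and $\mathcal D$ are $G$-invariant, and $\mathcal D$ is the horizontal distribution of a principal connection on $\pi$ (so $TQ=\mathcal D\oplus V\pi$, with $V\pi=\ker T\pi$, and $\dim Q/G=m$). Indices $a,b,c,d=1,\dots,m$; $i,j,k=1,\dots,n-m$. Summation convention is used. Frames: $V_i$ are the infinitesimal generators of a basis of the Lie algebra of $G$; $X_a$ are the horizontal lifts of the coordinate fields $\partial/\partial q^a$ on $Q/G$. Set $G_{ab}=g(X_a,X_b)$ (inverse $G^{ab}$), $G_{ai}=g(X_a,V_i)$, $K^b_i=-G^{ab}G_{ai}$, $X_i=V_i+K^b_iX_b$ (so $\{X_i\}$ spans the $g$-orthogonal complement of $\mathcal D$). Write $[X_a,X_b]=R^c_{ab}X_c+R^k_{ab}X_k$ and $g_{ab}=G_{ab}$. The functions $g_{ab}$, $R^c_{ab}$ and $G_{ak}R^k_{bc}$ are $G$-invariant and are regarded as functions on $Q/G$; one has $g_{ad}R^d_{bc}=G_{ak}R^k_{bc}$. The reduced metric $g^{red}$ on $Q/G$ has components $g_{ab}$. The gyroscopic tensor $\mathcal T$ is the $(1,2)$-tensor field on $Q/G$ with $\mathcal T(\partial/\partial q^a,\partial/\partial q^b)=R^d_{ab}\,\partial/\partial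 q^d$. Forms on $T(Q/G)$ with coordinates $(q^a,\dot q^a)$: $\theta_l=g_{ab}\dot q^adq^b$, $\Xi^G=-\frac12 G_{ak}R^k_{bc}\,\dot q^a\,dq^b\wedge dq^c$ and $\gamma^G=\frac16\left(-G_{bk}R^k_{ac}+G_{ck}R^k_{ab}-2G_{ak}R^k_{bc}\right)\dot q^a\,dq^b\wedge dq^c$. $\sum_{cycl}$ denotes the sum over cyclic permutations of the three arguments. *)

theory Defs
  imports "HOL-Analysis.Analysis" "HOL-Algebra.Group_Action"
begin

section \<open>Smooth functions between normed spaces\<close>

text \<open>Only used on open subsets of finite-dimensional spaces, where the existence and continuity of
  all iterated directional derivatives (together with differentiability) is the usual notion.\<close>

fun Ck_on :: "nat \<Rightarrow> ('e::real_normed_vector \<Rightarrow> 'f::real_normed_vector) \<Rightarrow> 'e set \<Rightarrow> bool" where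
  "Ck_on 0 f S \<longleftrightarrow> continuous_on S f"
| "Ck_on (Suc k) f S \<longleftrightarrow>
     (\<forall>x\<in>S. f differentiable (at x)) \<and> (\<forall>h. Ck_on k (\<lambda>x. frechet_derivative f (at x) h) S)"

definition smooth_on :: "('e::real_normed_vector \<Rightarrow> 'f::real_normed_vector) \<Rightarrow> 'e set \<Rightarrow> bool" where
  "smooth_on f S \<longleftrightarrow> (\<forall>k. Ck_on k f S)"


section \<open>Smooth manifolds\<close>

type_synonym ('a, 'e) chart = "'a set \<times> ('a \<Rightarrow> 'e)"

record ('a, 'e) mfd =
  mtop :: "'a topology"
  atlas :: "('a, 'e) chart set"

abbreviation points :: "('a, 'e) mfd \<Rightarrow> 'a set" where
  "points M \<equiv> topspace (mtop M)"

abbreviation cdom :: "('a, 'e) chart \<Rightarrow> 'a set" where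
  "cdom c \<equiv> fst c"

abbreviation coord :: "('a, 'e) chart \<Rightarrow> 'a \<Rightarrow> 'e" where
  "coord c \<equiv> snd c"

definition param :: "('a, 'e) chart \<Rightarrow> 'e \<Rightarrow> 'a" where
  "param c = inv_into (cdom c) (coord c)"

text \<open>The last conjunct says that the model space has dimension \<open>n\<close>.  The model space is a normed
  space rather than a Euclidean space so that \<open>n = 0\<close> is not excluded.\<close>

definition smooth_manifold :: "nat \<Rightarrow> ('a, 'e::real_normed_vector) mfd \<Rightarrow> bool" where
  "smooth_manifold n M \<longleftrightarrow>
     Hausdorff_space (mtop M) \<and> second_countable (mtop M) \<and>
     (\<Union>c\<in>atlas M. cdom c) = points M \<and>
     (\<forall>c\<in>atlas M. openin (mtop M) (cdom c) \<and> open (coord c ` cdom c) \<and>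
        homeomorphic_map (subtopology (mtop M) (cdom c)) (top_of_set (coord c ` cdom c)) (coord c)) \<and>
     (\<forall>c\<in>atlas M. \<forall>d\<in>atlas M.
        smooth_on (coord d \<circ> param c) (coord c ` (cdom c \<inter> cdom d))) \<and>
     (\<exists>E::'e set. finite E \<and> independent E \<and> span E = UNIV \<and> card E = n)"

definition open_submfd :: "('a, 'e) mfd \<Rightarrow> 'a set \<Rightarrow> ('a, 'e) mfd" where
  "open_submfd M W =
     \<lparr>mtop = subtopology (mtop M) W, atlas = (\<lambda>c. (cdom c \<inter> W, coord c)) ` atlas M\<rparr>"

definition prod_mfd :: "('a, 'e) mfd \<Rightarrow> ('b, 'f) mfd \<Rightarrow> ('a \<times> 'b, 'e \<times> 'f) mfd" where
  "prod_mfd M N =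
     \<lparr>mtop = prod_topology (mtop M) (mtop N),
      atlas = (\<lambda>(c, d). (cdom c \<times> cdom d, map_prod (coord c) (coord d))) ` (atlas M \<times> atlas N)\<rparr>"

definition smooth_map ::
  "('a, 'e::real_normed_vector) mfd \<Rightarrow> ('b, 'f::real_normed_vector) mfd \<Rightarrow> ('a \<Rightarrow> 'b) \<Rightarrow> bool" where
  "smooth_map M N F \<longleftrightarrow>
     continuous_map (mtop M) (mtop N) F \<and>
     (\<forall>c\<in>atlas M. \<forall>d\<in>atlas N.
        smooth_on (coord d \<circ> F \<circ> param c) (coord c ` {x \<in> cdom c. F x \<in> cdom d}))"

definition diffeomorphism ::
  "('a, 'e::real_normed_vector) mfd \<Rightarrow> ('b, 'f::real_normed_vector) mfd \<Rightarrow> ('a \<Rightarrow> 'b) \<Rightarrow> bool" where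
  "diffeomorphism M N F \<longleftrightarrow>
     smooth_map M N F \<and>
     (\<exists>F'. smooth_map N M F' \<and> (\<forall>x\<in>points M. F' (F x) = x) \<and> (\<forall>y\<in>points N. F (F' y) = y))"

definition smooth_fun_on :: "('a, 'e::real_normed_vector) mfd \<Rightarrow> 'a set \<Rightarrow> ('a \<Rightarrow> real) \<Rightarrow> bool" where
  "smooth_fun_on M U f \<longleftrightarrow> (\<forall>c\<in>atlas M. smooth_on (f \<circ> param c) (coord c ` (cdom c \<inter> U)))"

definition smooth_near :: "('a, 'e::real_normed_vector) mfd \<Rightarrow> 'a \<Rightarrow> ('a \<Rightarrow> real) \<Rightarrow> bool" where
  "smooth_near M p f \<longleftrightarrow> (\<exists>U. openin (mtop M) U \<and> p \<in> U \<and> smooth_fun_on M U f)"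


section \<open>Tangent vectors, vector fields and tensor fields\<close>

text \<open>Tangent vectors at \<open>p\<close> are the directional derivative operators on functions that are smooth
  near \<open>p\<close>; the value on all other functions is fixed to be 0, so that tangent vectors are equal as
  soon as they agree on the functions that matter.\<close>

type_synonym 'a tvec = "('a \<Rightarrow> real) \<Rightarrow> real"

definition chart_vec ::
  "('a, 'e::real_normed_vector) mfd \<Rightarrow> ('a, 'e) chart \<Rightarrow> 'a \<Rightarrow> 'e \<Rightarrow> 'a tvec" where
  "chart_vec M c p h =
     (\<lambda>f. if smooth_near M p f then frechet_derivative (f \<circ> param c) (at (coord c p)) h else 0)"

definition tangent_space :: "('a, 'e::real_normed_vector) mfd \<Rightarrow> 'a \<Rightarrow> 'a tvec set" where
  "tangent_space M p = {chart_vec M c p h | c h. c \<in> atlas M \<and> p \<in> cdom c}"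

definition lincomb :: "'i set \<Rightarrow> ('i \<Rightarrow> real) \<Rightarrow> ('i \<Rightarrow> 'a tvec) \<Rightarrow> 'a tvec" where
  "lincomb I r v = (\<lambda>f. \<Sum>i\<in>I. r i * v i f)"

definition basis_of :: "'i set \<Rightarrow> ('i \<Rightarrow> 'a tvec) \<Rightarrow> 'a tvec set \<Rightarrow> bool" where
  "basis_of I v W \<longleftrightarrow>
     W = {lincomb I r v | r. True} \<and>
     (\<forall>r. lincomb I r v = (\<lambda>f. 0) \<longrightarrow> (\<forall>i\<in>I. r i = 0))"

definition push_forward ::
  "('a, 'e::real_normed_vector) mfd \<Rightarrow> ('b, 'f::real_normed_vector) mfd \<Rightarrow> ('a \<Rightarrow> 'b) \<Rightarrow> 'a
     \<Rightarrow> 'a tvec \<Rightarrow> 'b tvec" where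
  "push_forward M N F p v = (\<lambda>f. if smooth_near N (F p) f then v (f \<circ> F) else 0)"

definition vector_field_on ::
  "('a, 'e::real_normed_vector) mfd \<Rightarrow> 'a set \<Rightarrow> ('a \<Rightarrow> 'a tvec) \<Rightarrow> bool" where
  "vector_field_on M U X \<longleftrightarrow>
     (\<forall>p\<in>U. X p \<in> tangent_space M p) \<and>
     (\<forall>W f. openin (mtop M) W \<and> W \<subseteq> U \<and> smooth_fun_on M W f \<longrightarrow>
        smooth_fun_on M W (\<lambda>p. X p f))"

definition lie_bracket ::
  "('a, 'e::real_normed_vector) mfd \<Rightarrow> ('a \<Rightarrow> 'a tvec) \<Rightarrow> ('a \<Rightarrow> 'a tvec) \<Rightarrow> 'a \<Rightarrow> 'a tvec" where
  "lie_bracket M X Y p =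
     (\<lambda>f. if smooth_near M p f then X p (\<lambda>q. Y q f) - Y p (\<lambda>q. X q f) else 0)"

definition riemannian_metric ::
  "('a, 'e::real_normed_vector) mfd \<Rightarrow> ('a \<Rightarrow> 'a tvec \<Rightarrow> 'a tvec \<Rightarrow> real) \<Rightarrow> bool" where
  "riemannian_metric M g \<longleftrightarrow>
     (\<forall>p\<in>points M. \<forall>u\<in>tangent_space M p. \<forall>v\<in>tangent_space M p. \<forall>w\<in>tangent_space M p. \<forall>r s.
        g p (\<lambda>f. r * u f + s * v f) w = r * g p u w + s * g p v w) \<and>
     (\<forall>p\<in>points M. \<forall>v\<in>tangent_space M p. \<forall>w\<in>tangent_space M p. g p v w = g p w v) \<and>
     (\<forall>p\<in>points M. \<forall>v\<in>tangent_space M p. v \<noteq> (\<lambda>f. 0) \<longrightarrow> g p v v > 0) \<and>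
     (\<forall>U X Y. openin (mtop M) U \<and> vector_field_on M U X \<and> vector_field_on M U Y \<longrightarrow>
        smooth_fun_on M U (\<lambda>p. g p (X p) (Y p)))"

definition tensor_field_12 ::
  "('a, 'e::real_normed_vector) mfd \<Rightarrow> ('a \<Rightarrow> 'a tvec \<Rightarrow> 'a tvec \<Rightarrow> 'a tvec) \<Rightarrow> bool" where
  "tensor_field_12 M T \<longleftrightarrow>
     (\<forall>p\<in>points M. \<forall>v\<in>tangent_space M p. \<forall>w\<in>tangent_space M p. T p v w \<in> tangent_space M p) \<and>
     (\<forall>p\<in>points M. \<forall>u\<in>tangent_space M p. \<forall>v\<in>tangent_space M p. \<forall>w\<in>tangent_space M p. \<forall>r s.
        T p (\<lambda>f. r * u f + s * v f) w = (\<lambda>f. r * T p u w f + s * T p v w f) \<and>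
        T p w (\<lambda>f. r * u f + s * v f) = (\<lambda>f. r * T p w u f + s * T p w v f)) \<and>
     (\<forall>U X Y. openin (mtop M) U \<and> vector_field_on M U X \<and> vector_field_on M U Y \<longrightarrow>
        vector_field_on M U (\<lambda>p. T p (X p) (Y p)))"

definition distribution ::
  "nat \<Rightarrow> ('a, 'e::real_normed_vector) mfd \<Rightarrow> ('a \<Rightarrow> 'a tvec set) \<Rightarrow> bool" where
  "distribution r M D \<longleftrightarrow>
     (\<forall>p\<in>points M. \<exists>U X. openin (mtop M) U \<and> p \<in> U \<and>
        (\<forall>i<r. vector_field_on M U (X i)) \<and>
        (\<forall>q\<in>U. basis_of {..<r} (\<lambda>i. X i q) (D q)))"


section \<open>Lie groups and principal bundles\<close>

definition lie_group :: "nat \<Rightarrow> 'g monoid \<Rightarrow> ('g, 'h::real_normed_vector) mfd \<Rightarrow> bool" where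
  "lie_group k G M \<longleftrightarrow>
     group G \<and> smooth_manifold k M \<and> points M = carrier G \<and>
     smooth_map (prod_mfd M M) M (\<lambda>(x, y). x \<otimes>\<^bsub>G\<^esub> y) \<and>
     smooth_map M M (\<lambda>x. m_inv G x)"

definition free_proper_action ::
  "'g monoid \<Rightarrow> ('g, 'h::real_normed_vector) mfd \<Rightarrow> ('q, 'e::real_normed_vector) mfd
     \<Rightarrow> ('g \<Rightarrow> 'q \<Rightarrow> 'q) \<Rightarrow> bool" where
  "free_proper_action G MG Q act \<longleftrightarrow>
     group_action G (points Q) act \<and>
     smooth_map (prod_mfd MG Q) Q (\<lambda>(h, q). act h q) \<and>
     (\<forall>q\<in>points Q. stabilizer G act q = {\<one>\<^bsub>G\<^esub>}) \<and>
     proper_map (prod_topology (mtop MG) (mtop Q)) (prod_topology (mtop Q) (mtop Q))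
       (\<lambda>(h, q). (act h q, q))"

text \<open>\<open>B\<close> is the quotient of \<open>Q\<close> by the action: its points are the orbits, its topology is the
  quotient topology, and its smooth structure is the one for which the orbit map is locally
  trivial.\<close>

definition principal_bundle ::
  "'g monoid \<Rightarrow> ('g, 'h::real_normed_vector) mfd \<Rightarrow> ('q, 'e::real_normed_vector) mfd
     \<Rightarrow> ('g \<Rightarrow> 'q \<Rightarrow> 'q) \<Rightarrow> ('q set, 'f::real_normed_vector) mfd \<Rightarrow> bool" where
  "principal_bundle G MG Q act B \<longleftrightarrow>
     points B = orbits G (points Q) act \<and>
     quotient_map (mtop Q) (mtop B) (orbit G act) \<and>
     smooth_map Q B (orbit G act) \<and>
     (\<forall>b\<in>points B. \<exists>W \<psi>. openin (mtop B) W \<and> b \<in> W \<and>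
        diffeomorphism (open_submfd Q {q \<in> points Q. orbit G act q \<in> W})
          (prod_mfd (open_submfd B W) MG) (\<lambda>q. (orbit G act q, \<psi> q)) \<and>
        (\<forall>q\<in>points Q. \<forall>h\<in>carrier G. orbit G act q \<in> W \<longrightarrow> \<psi> (act h q) = h \<otimes>\<^bsub>G\<^esub> \<psi> q))"


section \<open>Purely kinetic Chaplygin systems\<close>

text \<open>\<open>lie_basis\<close> is the chosen basis of the Lie algebra (the tangent space at the identity), with
  indices \<open>0, \<dots>, n - m - 1\<close>.  Here \<open>n = DIM('e)\<close> and \<open>m = CARD('m)\<close>.\<close>

record ('q, 'e, 'g, 'h, 'm) chaplygin =
  Qspace :: "('q, 'e) mfd"
  base :: "('q set, real^'m) mfd"
  grp :: "'g monoid"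
  grp_mfd :: "('g, 'h) mfd"
  action :: "'g \<Rightarrow> 'q \<Rightarrow> 'q"
  riem :: "'q \<Rightarrow> 'q tvec \<Rightarrow> 'q tvec \<Rightarrow> real"
  distr :: "'q \<Rightarrow> 'q tvec set"
  lie_basis :: "nat \<Rightarrow> 'g tvec"

type_synonym 'm covec = "(real^'m) \<times> (real^'m) \<Rightarrow> real"

definition proj ::
  "('q, 'e::euclidean_space, 'g, 'h::real_normed_vector, 'm::finite) chaplygin \<Rightarrow> 'q \<Rightarrow> 'q set" where
  "proj S = orbit (grp S) (action S)"

definition fibre_dim ::
  "('q, 'e::euclidean_space, 'g, 'h::real_normed_vector, 'm::finite) chaplygin \<Rightarrow> nat" where
  "fibre_dim S = DIM('e) - CARD('m)"

definition vertical ::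
  "('q, 'e::euclidean_space, 'g, 'h::real_normed_vector, 'm::finite) chaplygin \<Rightarrow> 'q \<Rightarrow> 'q tvec set" where
  "vertical S q =
     {v \<in> tangent_space (Qspace S) q. push_forward (Qspace S) (base S) (proj S) q v = (\<lambda>f. 0)}"

definition chaplygin_system ::
  "('q, 'e::euclidean_space, 'g, 'h::real_normed_vector, 'm::finite) chaplygin \<Rightarrow> bool" where
  "chaplygin_system S \<longleftrightarrow>
     smooth_manifold DIM('e) (Qspace S) \<and>
     smooth_manifold CARD('m) (base S) \<and>
     lie_group (fibre_dim S) (grp S) (grp_mfd S) \<and>
     free_proper_action (grp S) (grp_mfd S) (Qspace S) (action S) \<and>
     principal_bundle (grp S) (grp_mfd S) (Qspace S) (action S) (base S) \<and>
     riemannian_metric (Qspace S) (riem S) \<and>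
     (\<forall>h\<in>carrier (grp S). \<forall>q\<in>points (Qspace S).
        \<forall>v\<in>tangent_space (Qspace S) q. \<forall>w\<in>tangent_space (Qspace S) q.
          riem S (action S h q)
            (push_forward (Qspace S) (Qspace S) (action S h) q v)
            (push_forward (Qspace S) (Qspace S) (action S h) q w) = riem S q v w) \<and>
     distribution CARD('m) (Qspace S) (distr S) \<and>
     (\<forall>h\<in>carrier (grp S). \<forall>q\<in>points (Qspace S).
        distr S (action S h q) =
          push_forward (Qspace S) (Qspace S) (action S h) q ` distr S q) \<and>
     (\<forall>q\<in>points (Qspace S).
        tangent_space (Qspace S) q = {(\<lambda>f. u f + v f) | u v. u \<in> distr S q \<and> v \<in> vertical S q} \<and>
        distr S q \<inter> vertical S q = {\<lambda>f. 0}) \<and>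
     basis_of {..<fibre_dim S} (lie_basis S) (tangent_space (grp_mfd S) \<one>\<^bsub>grp S\<^esub>)"


subsection \<open>Frames\<close>

text \<open>Throughout, \<open>c\<close> is a chart of the base giving the coordinates \<open>q\<^sup>a\<close>, and quantities
  on the base are evaluated along the projection of a point \<open>q\<close> of the total space.\<close>

definition coord_field ::
  "('q, 'e::euclidean_space, 'g, 'h::real_normed_vector, 'm::finite) chaplygin
     \<Rightarrow> ('q set, real^'m) chart \<Rightarrow> 'm \<Rightarrow> 'q set \<Rightarrow> 'q set tvec" where
  "coord_field S c a b = chart_vec (base S) c b (axis a 1)"

definition hor_lift ::
  "('q, 'e::euclidean_space, 'g, 'h::real_normed_vector, 'm::finite) chaplygin
     \<Rightarrow> 'q \<Rightarrow> 'q set tvec \<Rightarrow> 'q tvec" where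
  "hor_lift S q w =
     (THE u. u \<in> distr S q \<and> push_forward (Qspace S) (base S) (proj S) q u = w)"

definition Xa ::
  "('q, 'e::euclidean_space, 'g, 'h::real_normed_vector, 'm::finite) chaplygin
     \<Rightarrow> ('q set, real^'m) chart \<Rightarrow> 'm \<Rightarrow> 'q \<Rightarrow> 'q tvec" where
  "Xa S c a q = hor_lift S q (coord_field S c a (proj S q))"

text \<open>The infinitesimal generator of \<open>\<xi>\<close> at \<open>q\<close> is the image of \<open>\<xi>\<close> under the tangent map of
  \<open>h \<mapsto> h q\<close> at the identity.\<close>

definition Vi ::
  "('q, 'e::euclidean_space, 'g, 'h::real_normed_vector, 'm::finite) chaplygin
     \<Rightarrow> nat \<Rightarrow> 'q \<Rightarrow> 'q tvec" where
  "Vi S i q = push_forward (grp_mfd S) (Qspace S) (\<lambda>h. action S h q) \<one>\<^bsub>grp S\<^esub> (lie_basis S i)"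

definition Gab ::
  "('q, 'e::euclidean_space, 'g, 'h::real_normed_vector, 'm::finite) chaplygin
     \<Rightarrow> ('q set, real^'m) chart \<Rightarrow> 'm \<Rightarrow> 'm \<Rightarrow> 'q \<Rightarrow> real" where
  "Gab S c a b q = riem S q (Xa S c a q) (Xa S c b q)"

definition Gai ::
  "('q, 'e::euclidean_space, 'g, 'h::real_normed_vector, 'm::finite) chaplygin
     \<Rightarrow> ('q set, real^'m) chart \<Rightarrow> 'm \<Rightarrow> nat \<Rightarrow> 'q \<Rightarrow> real" where
  "Gai S c a i q = riem S q (Xa S c a q) (Vi S i q)"

definition Kbi ::
  "('q, 'e::euclidean_space, 'g, 'h::real_normed_vector, 'm::finite) chaplygin
     \<Rightarrow> ('q set, real^'m) chart \<Rightarrow> 'm \<Rightarrow> nat \<Rightarrow> 'q \<Rightarrow> real" where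
  "Kbi S c b i q = - (\<Sum>a\<in>UNIV. matrix_inv (\<chi> a b. Gab S c a b q) $ a $ b * Gai S c a i q)"

definition Xi ::
  "('q, 'e::euclidean_space, 'g, 'h::real_normed_vector, 'm::finite) chaplygin
     \<Rightarrow> ('q set, real^'m) chart \<Rightarrow> nat \<Rightarrow> 'q \<Rightarrow> 'q tvec" where
  "Xi S c i q = (\<lambda>f. Vi S i q f + (\<Sum>b\<in>UNIV. Kbi S c b i q * Xa S c b q f))"

text \<open>\<open>R c a b d\<close> and \<open>R' c a b k\<close> are the horizontal components \<open>R\<^sup>d\<^sub>a\<^sub>b\<close> and the remaining components
  \<open>R\<^sup>k\<^sub>a\<^sub>b\<close> of \<open>[X\<^sub>a, X\<^sub>b]\<close> in the frame formed by the \<open>X\<^sub>d\<close> and the \<open>X\<^sub>k\<close>.\<close>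

definition bracket_components ::
  "('q, 'e::euclidean_space, 'g, 'h::real_normed_vector, 'm::finite) chaplygin
     \<Rightarrow> (('q set, real^'m) chart \<Rightarrow> 'm \<Rightarrow> 'm \<Rightarrow> 'm \<Rightarrow> 'q \<Rightarrow> real)
     \<Rightarrow> (('q set, real^'m) chart \<Rightarrow> 'm \<Rightarrow> 'm \<Rightarrow> nat \<Rightarrow> 'q \<Rightarrow> real) \<Rightarrow> bool" where
  "bracket_components S R R' \<longleftrightarrow>
     (\<forall>c\<in>atlas (base S). \<forall>q\<in>points (Qspace S). proj S q \<in> cdom c \<longrightarrow> (\<forall>a b.
        lie_bracket (Qspace S) (Xa S c a) (Xa S c b) q =
          (\<lambda>f. (\<Sum>d\<in>UNIV. R c a b d q * Xa S c d q f)
             + (\<Sum>k<fibre_dim S. R' c a b k q * Xi S c k q f))))"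


subsection \<open>Reduced metric and gyroscopic tensor\<close>

text \<open>The choice of the representative \<open>q\<close> of the orbit \<open>b\<close> is immaterial because the metric and
  the distribution are invariant; the components of \<open>g_red\<close> are the \<open>Gab\<close>.\<close>

definition g_red ::
  "('q, 'e::euclidean_space, 'g, 'h::real_normed_vector, 'm::finite) chaplygin
     \<Rightarrow> 'q set \<Rightarrow> 'q set tvec \<Rightarrow> 'q set tvec \<Rightarrow> real" where
  "g_red S b v w = (let q = (SOME q. q \<in> b) in riem S q (hor_lift S q v) (hor_lift S q w))"

definition gyroscopic_tensor ::
  "('q, 'e::euclidean_space, 'g, 'h::real_normed_vector, 'm::finite) chaplygin
     \<Rightarrow> (('q set, real^'m) chart \<Rightarrow> 'm \<Rightarrow> 'm \<Rightarrow> 'm \<Rightarrow> 'q \<Rightarrow> real)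
     \<Rightarrow> ('q set \<Rightarrow> 'q set tvec \<Rightarrow> 'q set tvec \<Rightarrow> 'q set tvec) \<Rightarrow> bool" where
  "gyroscopic_tensor S R T \<longleftrightarrow>
     tensor_field_12 (base S) T \<and>
     (\<forall>c\<in>atlas (base S). \<forall>q\<in>points (Qspace S). proj S q \<in> cdom c \<longrightarrow> (\<forall>a b.
        T (proj S q) (coord_field S c a (proj S q)) (coord_field S c b (proj S q)) =
          (\<lambda>f. \<Sum>d\<in>UNIV. R c a b d q * coord_field S c d (proj S q) f)))"


subsection \<open>The conditions\<close>

definition pd ::
  "('q, 'e::euclidean_space, 'g, 'h::real_normed_vector, 'm::finite) chaplygin
     \<Rightarrow> ('q set, real^'m) chart \<Rightarrow> ('q set \<Rightarrow> real) \<Rightarrow> 'm \<Rightarrow> 'q \<Rightarrow> real" where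
  "pd S c \<phi> a q = coord_field S c a (proj S q) \<phi>"

definition GR ::
  "('q, 'e::euclidean_space, 'g, 'h::real_normed_vector, 'm::finite) chaplygin
     \<Rightarrow> (('q set, real^'m) chart \<Rightarrow> 'm \<Rightarrow> 'm \<Rightarrow> nat \<Rightarrow> 'q \<Rightarrow> real)
     \<Rightarrow> ('q set, real^'m) chart \<Rightarrow> 'm \<Rightarrow> 'm \<Rightarrow> 'm \<Rightarrow> 'q \<Rightarrow> real" where
  "GR S R' c a b d q = (\<Sum>k<fibre_dim S. Gai S c a k q * R' c b d k q)"

definition phi_simple ::
  "('q, 'e::euclidean_space, 'g, 'h::real_normed_vector, 'm::finite) chaplygin
     \<Rightarrow> (('q set, real^'m) chart \<Rightarrow> 'm \<Rightarrow> 'm \<Rightarrow> 'm \<Rightarrow> 'q \<Rightarrow> real) \<Rightarrow> ('q set \<Rightarrow> real) \<Rightarrow> bool" where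
  "phi_simple S R \<phi> \<longleftrightarrow>
     (\<forall>c\<in>atlas (base S). \<forall>q\<in>points (Qspace S). proj S q \<in> cdom c \<longrightarrow> (\<forall>a b d.
        R c a b d q = - pd S c \<phi> a q * (if d = b then 1 else 0)
                      + pd S c \<phi> b q * (if d = a then 1 else 0)))"

definition condition_A ::
  "('q, 'e::euclidean_space, 'g, 'h::real_normed_vector, 'm::finite) chaplygin
     \<Rightarrow> (('q set, real^'m) chart \<Rightarrow> 'm \<Rightarrow> 'm \<Rightarrow> nat \<Rightarrow> 'q \<Rightarrow> real) \<Rightarrow> ('q set \<Rightarrow> real) \<Rightarrow> bool" where
  "condition_A S R' f \<longleftrightarrow>
     (\<forall>c\<in>atlas (base S). \<forall>q\<in>points (Qspace S). proj S q \<in> cdom c \<longrightarrow> (\<forall>a b d.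
        GR S R' c b a d q + GR S R' c a b d q
          + Gab S c b d q * pd S c f a q + Gab S c a d q * pd S c f b q
          - 2 * Gab S c a b q * pd S c f d q = 0))"

definition cyclic_condition ::
  "('q, 'e::euclidean_space, 'g, 'h::real_normed_vector, 'm::finite) chaplygin
     \<Rightarrow> ('q set \<Rightarrow> 'q set tvec \<Rightarrow> 'q set tvec \<Rightarrow> 'q set tvec) \<Rightarrow> bool" where
  "cyclic_condition S T \<longleftrightarrow>
     (\<forall>X Y Z. vector_field_on (base S) (points (base S)) X \<and>
        vector_field_on (base S) (points (base S)) Y \<and>
        vector_field_on (base S) (points (base S)) Z \<longrightarrow>
        (\<forall>b\<in>points (base S).
           g_red S b (X b) (T b (Y b) (Z b)) + g_red S b (Y b) (T b (Z b) (X b))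
             + g_red S b (Z b) (T b (X b) (Y b)) = 0))"


subsection \<open>Forms on the tangent bundle of the base\<close>

text \<open>Forms are expressed in the natural coordinates \<open>(q\<^sup>a, v\<^sup>a)\<close> induced by a chart \<open>c\<close> of the base:
  at the point with base point \<open>proj S q\<close> and velocity \<open>v\<close>, a tangent vector of the tangent bundle is
  a pair of its components along \<open>\<partial>/\<partial>q\<^sup>a\<close> and along \<open>\<partial>/\<partial>v\<^sup>a\<close>.\<close>

definition dq :: "'m \<Rightarrow> ('m::finite) covec" where
  "dq a = (\<lambda>u. fst u $ a)"

definition wedge :: "('m::finite) covec \<Rightarrow> 'm covec
     \<Rightarrow> (real^'m) \<times> (real^'m) \<Rightarrow> (real^'m) \<times> (real^'m) \<Rightarrow> real" (infixr "\<and>\<^sub>w" 70) where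
  "(\<alpha> \<and>\<^sub>w \<beta>) = (\<lambda>u w. \<alpha> u * \<beta> w - \<alpha> w * \<beta> u)"

definition d_phi ::
  "('q, 'e::euclidean_space, 'g, 'h::real_normed_vector, 'm::finite) chaplygin
     \<Rightarrow> ('q set, real^'m) chart \<Rightarrow> ('q set \<Rightarrow> real) \<Rightarrow> 'q \<Rightarrow> 'm covec" where
  "d_phi S c \<phi> q = (\<lambda>u. \<Sum>a\<in>UNIV. pd S c \<phi> a q * dq a u)"

definition theta_l ::
  "('q, 'e::euclidean_space, 'g, 'h::real_normed_vector, 'm::finite) chaplygin
     \<Rightarrow> ('q set, real^'m) chart \<Rightarrow> 'q \<Rightarrow> real^'m \<Rightarrow> 'm covec" where
  "theta_l S c q v = (\<lambda>u. \<Sum>a\<in>UNIV. \<Sum>b\<in>UNIV. Gab S c a b q * v $ a * dq b u)"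

definition Xi_G ::
  "('q, 'e::euclidean_space, 'g, 'h::real_normed_vector, 'm::finite) chaplygin
     \<Rightarrow> (('q set, real^'m) chart \<Rightarrow> 'm \<Rightarrow> 'm \<Rightarrow> nat \<Rightarrow> 'q \<Rightarrow> real)
     \<Rightarrow> ('q set, real^'m) chart \<Rightarrow> 'q \<Rightarrow> real^'m
     \<Rightarrow> (real^'m) \<times> (real^'m) \<Rightarrow> (real^'m) \<times> (real^'m) \<Rightarrow> real" where
  "Xi_G S R' c q v = (\<lambda>u w. - (1/2) * (\<Sum>a\<in>UNIV. \<Sum>b\<in>UNIV. \<Sum>d\<in>UNIV.
     GR S R' c a b d q * v $ a * (dq b \<and>\<^sub>w dq d) u w))"

definition gamma_G ::
  "('q, 'e::euclidean_space, 'g, 'h::real_normed_vector, 'm::finite) chaplygin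
     \<Rightarrow> (('q set, real^'m) chart \<Rightarrow> 'm \<Rightarrow> 'm \<Rightarrow> nat \<Rightarrow> 'q \<Rightarrow> real)
     \<Rightarrow> ('q set, real^'m) chart \<Rightarrow> 'q \<Rightarrow> real^'m
     \<Rightarrow> (real^'m) \<times> (real^'m) \<Rightarrow> (real^'m) \<times> (real^'m) \<Rightarrow> real" where
  "gamma_G S R' c q v = (\<lambda>u w. 1/6 * (\<Sum>a\<in>UNIV. \<Sum>b\<in>UNIV. \<Sum>d\<in>UNIV.
     (- GR S R' c b a d q + GR S R' c d a b q - 2 * GR S R' c a b d q)
       * v $ a * (dq b \<and>\<^sub>w dq d) u w))"

definition form_condition ::
  "('q, 'e::euclidean_space, 'g, 'h::real_normed_vector, 'm::finite) chaplygin \<Rightarrow> ('q set \<Rightarrow> real)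
     \<Rightarrow> (('q set, real^'m) chart \<Rightarrow> 'q \<Rightarrow> real^'m
           \<Rightarrow> (real^'m) \<times> (real^'m) \<Rightarrow> (real^'m) \<times> (real^'m) \<Rightarrow> real) \<Rightarrow> bool" where
  "form_condition S \<phi> \<omega> \<longleftrightarrow>
     (\<forall>c\<in>atlas (base S). \<forall>q\<in>points (Qspace S). proj S q \<in> cdom c \<longrightarrow> (\<forall>v.
        d_phi S c \<phi> q \<and>\<^sub>w theta_l S c q v = \<omega> c q v))"

end

theory Submission
  imports Defs
begin

text \<open>Both sides are conditions on the trilinear array \<open>B\<^sub>a\<^sub>b\<^sub>c = G\<^sub>a\<^sub>k R\<^sup>k\<^sub>b\<^sub>c\<close>, antisymmetric in
  its last two indices.  The geometric input is \<open>g\<^sub>a\<^sub>d R\<^sup>d\<^sub>b\<^sub>c = B\<^sub>a\<^sub>b\<^sub>c\<close>: the \<open>X\<^sub>a\<close> project to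
  coordinate fields, so that \<open>[X\<^sub>b, X\<^sub>c]\<close> is vertical and its components satisfy
  \<open>R\<^sup>d\<^sub>b\<^sub>c = - K\<^sup>d\<^sub>k R\<^sup>k\<^sub>b\<^sub>c\<close>.  Writing \<open>D\<close> for the difference of \<open>B\<close> and its value in the
  \<open>\<phi>\<close>-simple case, condition (A) says that \<open>D\<close> is antisymmetric in its first two indices, hence
  totally antisymmetric; its cyclic sum is then three times \<open>D\<close>, and it equals the cyclic sum of
  \<open>B\<close>.  The cyclic condition on global vector fields is as strong as the one on components because
  tangent vectors of the base extend to global fields by bump functions.\<close>

subsection \<open>Functions with continuous iterated derivatives\<close>

text \<open>A tangent vector is a functional on all functions that returns 0 on those not smooth
  near the point. Evaluating it therefore requires a proof that the argument is smooth there, which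
  accounts for most of the length. Brackets are tested on pulled-back functions: there
  \<open>Xa\<close> acts as a coordinate field, and this already ties \<open>R\<close> to
  \<open>R'\<close>. \<open>R\<close> and \<open>R'\<close> are arbitrary functions satisfying the
  bracket expansion, so antisymmetry and constancy along orbits must be derived. Antisymmetry is
  obtained for the contraction \<open>GR\<close>. Constancy of \<open>R\<close> is read off from
  \<open>T\<close>, whose value depends only on the base point; it matters because simplicity is a
  condition at every point of the total space, while the cyclic condition sees only the
  representative chosen in \<open>g_red\<close>. The model space of the group is merely a normed
  space, since its dimension may be 0. The chain rule that expands in a Euclidean basis does not
  reach maps out of products with the group, so slices are handled by composition with an affine
  map.\<close>

lemma frechet_derivative_eq_on_open:
  assumes "open S" "x \<in> S" "\<And>y. y \<in> S \<Longrightarrow> f y = g y"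
  shows "frechet_derivative f (at x) = frechet_derivative g (at x)"
proof -
  have "(f has_derivative F) (at x) \<longleftrightarrow> (g has_derivative F) (at x)" for F
    using has_derivative_transform_within_open[OF _ assms(1,2), of f F UNIV g]
      has_derivative_transform_within_open[OF _ assms(1,2), of g F UNIV f] assms(3) by auto
  then show ?thesis by (simp add: frechet_derivative_def)
qed

lemma differentiable_eq_on_open:
  assumes "open S" "x \<in> S" "\<And>y. y \<in> S \<Longrightarrow> f y = g y"
  shows "f differentiable (at x) \<longleftrightarrow> g differentiable (at x)"
  unfolding differentiable_def
  using has_derivative_transform_within_open[OF _ assms(1,2), of f _ UNIV g]
    has_derivative_transform_within_open[OF _ assms(1,2), of g _ UNIV f] assms(3) by auto

lemma Ck_on_cong:
  assumes "open S" "\<And>y. y \<in> S \<Longrightarrow> f y = g y"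
  shows "Ck_on k f S \<longleftrightarrow> Ck_on k g S"
  using assms(2)
proof (induction k arbitrary: f g)
  case 0
  then show ?case by (simp cong: continuous_on_cong)
next
  case (Suc k)
  have "f differentiable (at x) \<longleftrightarrow> g differentiable (at x)" if "x \<in> S" for x
    using assms(1) that Suc.prems by (rule differentiable_eq_on_open)
  moreover have "Ck_on k (\<lambda>x. frechet_derivative f (at x) h) S \<longleftrightarrow>
      Ck_on k (\<lambda>x. frechet_derivative g (at x) h) S" for h
    by (rule Suc.IH) (metis assms(1) Suc.prems frechet_derivative_eq_on_open)
  ultimately show ?case by simp
qed

text \<open>Differentiability is tested with the unrestricted filter \<open>at x\<close> and
  continuity is local, so each point may be treated in a neighbourhood of its own. \<open>T\<close>
  may stick out of \<open>S\<close>.\<close>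

lemma Ck_on_local:
  assumes "\<And>x. x \<in> S \<Longrightarrow> \<exists>T. open T \<and> x \<in> T \<and> Ck_on k f T"
  shows "Ck_on k f S"
  using assms
proof (induction k arbitrary: f)
  case 0
  have "continuous (at x within S) f" if "x \<in> S" for x
    using 0[OF that] by (metis Ck_on.simps(1) continuous_at_imp_continuous_at_within continuous_on_eq_continuous_at)
  then show ?case by (simp add: continuous_on_eq_continuous_within)
next
  case (Suc k)
  then show ?case by (metis Ck_on.simps(2))
qed

lemma Ck_on_subset: "open S \<Longrightarrow> Ck_on k f S \<Longrightarrow> T \<subseteq> S \<Longrightarrow> Ck_on k f T"
  by (rule Ck_on_local) auto

lemma Ck_on_SucD: "Ck_on (Suc k) f S \<Longrightarrow> Ck_on k f S"
proof (induction k arbitrary: f)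
  case 0
  then show ?case
    by (auto intro!: continuous_at_imp_continuous_on differentiable_imp_continuous_within)
next
  case (Suc k)
  then show ?case by (metis Ck_on.simps(2))
qed

lemma Ck_on_const: "Ck_on k (\<lambda>x. c) S"
  by (induction k arbitrary: c) auto

lemma Ck_on_bounded_linear:
  assumes "bounded_linear A"
  shows "Ck_on k A S"
proof (cases k)
  case 0
  then show ?thesis using assms by (simp add: linear_continuous_on)
next
  case (Suc k)
  from assms have "(A has_derivative A) (at x)" for x
    by (rule bounded_linear_imp_has_derivative)
  then have "A differentiable (at x)" "frechet_derivative A (at x) = A" for x
    by (auto simp: differentiable_def frechet_derivative_at[symmetric])
  then show ?thesis by (simp add: Suc Ck_on_const)
qed

lemma frechet_derivative_bounded_linear_compose:
  assumes "bounded_linear A" "f differentiable (at x)"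
  shows "(\<lambda>x. A (f x)) differentiable (at x)"
    and "frechet_derivative (\<lambda>x. A (f x)) (at x) h = A (frechet_derivative f (at x) h)"
proof -
  have "((\<lambda>x. A (f x)) has_derivative (\<lambda>h. A (frechet_derivative f (at x) h))) (at x)"
    using assms(2) unfolding frechet_derivative_works by (rule bounded_linear.has_derivative[OF assms(1)])
  then show "(\<lambda>x. A (f x)) differentiable (at x)"
    "frechet_derivative (\<lambda>x. A (f x)) (at x) h = A (frechet_derivative f (at x) h)"
    by (auto simp: differentiable_def frechet_derivative_at[symmetric])
qed

lemma Ck_on_bounded_linear_compose:
  assumes "bounded_linear A" "open S" "Ck_on k f S"
  shows "Ck_on k (\<lambda>x. A (f x)) S"
  using assms(3)
proof (induction k arbitrary: f)
  case 0
  then show ?case using bounded_linear.continuous_on[OF assms(1), of S f] by simp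
next
  case (Suc k)
  note D = frechet_derivative_bounded_linear_compose[OF assms(1)]
  have "Ck_on k (\<lambda>x. A (frechet_derivative f (at x) h)) S" for h
    using Suc by simp
  moreover have "frechet_derivative (\<lambda>x. A (f x)) (at x) h = A (frechet_derivative f (at x) h)"
    if "x \<in> S" for x h
    using Suc.prems that by (intro D) simp
  ultimately have "Ck_on k (\<lambda>x. frechet_derivative (\<lambda>x. A (f x)) (at x) h) S" for h
    using Ck_on_cong[OF assms(2), of "\<lambda>x. frechet_derivative (\<lambda>x. A (f x)) (at x) h"
        "\<lambda>x. A (frechet_derivative f (at x) h)"] by simp
  then show ?case
    using Suc.prems D(1) by auto
qed

lemma Ck_on_add:
  assumes "open S" "Ck_on k f S" "Ck_on k g S"
  shows "Ck_on k (\<lambda>x. f x + g x) S"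
  using assms(2,3)
proof (induction k arbitrary: f g)
  case 0
  then show ?case by (auto intro: continuous_intros)
next
  case (Suc k)
  have D: "((\<lambda>x. f x + g x) has_derivative
      (\<lambda>h. frechet_derivative f (at x) h + frechet_derivative g (at x) h)) (at x)" if "x \<in> S" for x
    using Suc.prems that by (intro has_derivative_add) (simp_all add: frechet_derivative_works[symmetric])
  have "Ck_on k (\<lambda>x. frechet_derivative f (at x) h + frechet_derivative g (at x) h) S" for h
    using Suc by auto
  moreover have "frechet_derivative (\<lambda>x. f x + g x) (at x) =
      (\<lambda>h. frechet_derivative f (at x) h + frechet_derivative g (at x) h)" if "x \<in> S" for x
    using frechet_derivative_at[OF D[OF that]] by simp
  ultimately have "Ck_on k (\<lambda>x. frechet_derivative (\<lambda>x. f x + g x) (at x) h) S" for h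
    using Ck_on_cong[OF assms(1), of "\<lambda>x. frechet_derivative (\<lambda>x. f x + g x) (at x) h"] by auto
  then show ?case using D by (auto simp: differentiable_def)
qed

lemma Ck_on_scaleR:
  fixes r :: "'e::real_normed_vector \<Rightarrow> real"
  assumes "open S" "Ck_on k r S" "Ck_on k f S"
  shows "Ck_on k (\<lambda>x. r x *\<^sub>R f x) S"
  using assms(2,3)
proof (induction k arbitrary: r f)
  case 0
  then show ?case by (auto intro: continuous_intros)
next
  case (Suc k)
  have D: "((\<lambda>x. r x *\<^sub>R f x) has_derivative
      (\<lambda>h. r x *\<^sub>R frechet_derivative f (at x) h + frechet_derivative r (at x) h *\<^sub>R f x)) (at x)"
    if "x \<in> S" for x
    using Suc.prems that by (intro has_derivative_scaleR) (simp_all add: frechet_derivative_works[symmetric])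
  have "Ck_on k (\<lambda>x. r x *\<^sub>R frechet_derivative f (at x) h + frechet_derivative r (at x) h *\<^sub>R f x) S" for h
    using Suc.prems Suc.prems[THEN Ck_on_SucD] by (intro Ck_on_add[OF assms(1)] Suc.IH) auto
  moreover have "frechet_derivative (\<lambda>x. r x *\<^sub>R f x) (at x) =
      (\<lambda>h. r x *\<^sub>R frechet_derivative f (at x) h + frechet_derivative r (at x) h *\<^sub>R f x)"
    if "x \<in> S" for x
    using frechet_derivative_at[OF D[OF that]] by simp
  ultimately have "Ck_on k (\<lambda>x. frechet_derivative (\<lambda>x. r x *\<^sub>R f x) (at x) h) S" for h
    using Ck_on_cong[OF assms(1), of "\<lambda>x. frechet_derivative (\<lambda>x. r x *\<^sub>R f x) (at x) h"] by auto
  then show ?case using D by (auto simp: differentiable_def)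
qed

lemma Ck_on_sum:
  assumes "open S" "finite I" "\<And>i. i \<in> I \<Longrightarrow> Ck_on k (f i) S"
  shows "Ck_on k (\<lambda>x. \<Sum>i\<in>I. f i x) S"
  using assms(2,3) by (induction I rule: finite_induct) (auto simp: Ck_on_const Ck_on_add[OF assms(1)])

text \<open>\<open>Ck_on\<close> controls derivatives in directions that stay fixed as the point
  moves, whereas the chain rule differentiates \<open>f\<close> in the moving direction
  \<open>g'(x) h\<close>. Expanding that direction in \<open>Basis\<close> leaves fixed directions
  with scalar coefficients.\<close>

lemma frechet_derivative_euclidean_chain:
  fixes g :: "'e::real_normed_vector \<Rightarrow> 'f::euclidean_space" and f :: "'f \<Rightarrow> 'k::real_normed_vector"
  assumes "g differentiable (at x)" "f differentiable (at (g x))"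
  shows "frechet_derivative (\<lambda>x. f (g x)) (at x) h =
    (\<Sum>i\<in>Basis. (frechet_derivative g (at x) h \<bullet> i) *\<^sub>R frechet_derivative f (at (g x)) i)"
proof -
  have "frechet_derivative (\<lambda>x. f (g x)) (at x) h =
      frechet_derivative f (at (g x)) (frechet_derivative g (at x) h)"
    using frechet_derivative_compose[OF assms] by (simp add: o_def)
  also have "\<dots> = (\<Sum>i\<in>Basis. (frechet_derivative g (at x) h \<bullet> i) *\<^sub>R frechet_derivative f (at (g x)) i)"
  proof -
    let ?v = "frechet_derivative g (at x) h"
    have "linear (frechet_derivative f (at (g x)))"
      using assms(2) by (rule linear_frechet_derivative)
    then have "frechet_derivative f (at (g x)) (\<Sum>i\<in>Basis. (?v \<bullet> i) *\<^sub>R i) =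
        (\<Sum>i\<in>Basis. (?v \<bullet> i) *\<^sub>R frechet_derivative f (at (g x)) i)"
      by (simp add: linear_sum linear_scale)
    then show ?thesis by (simp add: euclidean_representation)
  qed
  finally show ?thesis .
qed

lemma Ck_on_compose:
  fixes g :: "'e::real_normed_vector \<Rightarrow> 'f::euclidean_space" and f :: "'f \<Rightarrow> 'k::real_normed_vector"
  assumes "open S" "Ck_on k g S" "Ck_on k f T" "g ` S \<subseteq> T"
  shows "Ck_on k (\<lambda>x. f (g x)) S"
  using assms(2,3)
proof (induction k arbitrary: f)
  case 0
  then show ?case using assms(4) by (auto intro: continuous_on_compose2)
next
  case (Suc k)
  have d: "g differentiable (at x)" "f differentiable (at (g x))" if "x \<in> S" for x
    using Suc.prems assms(4) that by auto
  have "Ck_on k (\<lambda>x. (frechet_derivative g (at x) h \<bullet> i) *\<^sub>R frechet_derivative f (at (g x)) i) S" for h i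
  proof (rule Ck_on_scaleR[OF assms(1)])
    show "Ck_on k (\<lambda>x. frechet_derivative g (at x) h \<bullet> i) S"
      using Suc.prems by (intro Ck_on_bounded_linear_compose[OF bounded_linear_inner_left] assms(1)) auto
    \<comment> \<open>The induction hypothesis is applied to a directional derivative of
      \<open>f\<close>; \<open>g\<close> stays the same and is weakened from order
      \<open>Suc k\<close> to \<open>k\<close>.\<close>
    show "Ck_on k (\<lambda>x. frechet_derivative f (at (g x)) i) S"
      using Suc.prems(2) Ck_on_SucD[OF Suc.prems(1)]
      by (intro Suc.IH[where f = "\<lambda>y. frechet_derivative f (at y) i"]) auto
  qed
  then have "Ck_on k (\<lambda>x. \<Sum>i\<in>Basis. (frechet_derivative g (at x) h \<bullet> i) *\<^sub>R frechet_derivative f (at (g x)) i) S" for h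
    by (intro Ck_on_sum assms(1)) auto
  then have "Ck_on k (\<lambda>x. frechet_derivative (\<lambda>x. f (g x)) (at x) h) S" for h
    using Ck_on_cong[OF assms(1), of "\<lambda>x. frechet_derivative (\<lambda>x. f (g x)) (at x) h"]
      frechet_derivative_euclidean_chain[OF d] by auto
  moreover have "(\<lambda>x. f (g x)) differentiable (at x)" if "x \<in> S" for x
    using differentiable_chain_at[OF d[OF that]] by (simp add: o_def)
  ultimately show ?case by simp
qed

text \<open>The inner map has the constant derivative \<open>A\<close>, so the direction
  \<open>A h\<close> in which \<open>f\<close> is differentiated does not move. Hence no basis of
  the middle space enters, and that space may be any normed space.\<close>

lemma Ck_on_affine:
  assumes "bounded_linear A" "open S" "Ck_on k f T" "\<And>x. x \<in> S \<Longrightarrow> a + A x \<in> T"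
  shows "Ck_on k (\<lambda>x. f (a + A x)) S"
  using assms(3)
proof (induction k arbitrary: f)
  case 0
  have "continuous_on S (\<lambda>x. a + A x)"
    using assms(1) by (intro continuous_intros linear_continuous_on)
  with 0 show ?case using assms(4) by (auto intro: continuous_on_compose2)
next
  case (Suc k)
  have D: "((\<lambda>x. f (a + A x)) has_derivative (\<lambda>h. frechet_derivative f (at (a + A x)) (A h))) (at x)"
    if "x \<in> S" for x
  proof -
    have "((\<lambda>x. a + A x) has_derivative A) (at x)"
      using has_derivative_add[OF has_derivative_const bounded_linear_imp_has_derivative[OF assms(1)]] by simp
    moreover have "(f has_derivative frechet_derivative f (at (a + A x))) (at (a + A x))"
      using Suc.prems assms(4)[OF that] by (simp_all add: frechet_derivative_works[symmetric])
    ultimately show ?thesis using diff_chain_at[of "\<lambda>x. a + A x" A x f] by (simp add: o_def)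
  qed
  have "Ck_on k (\<lambda>x. frechet_derivative f (at (a + A x)) (A h)) S" for h
    using Suc by auto
  then have "Ck_on k (\<lambda>x. frechet_derivative (\<lambda>x. f (a + A x)) (at x) h) S" for h
    using Ck_on_cong[OF assms(2), of "\<lambda>x. frechet_derivative (\<lambda>x. f (a + A x)) (at x) h"]
      frechet_derivative_at[OF D, symmetric] by auto
  then show ?case using D by (auto simp: differentiable_def)
qed

section \<open>Closure properties of smoothness of all orders\<close>

lemma smooth_on_cong:
  "open S \<Longrightarrow> (\<And>y. y \<in> S \<Longrightarrow> f y = g y) \<Longrightarrow> smooth_on f S \<longleftrightarrow> smooth_on g S"
  using Ck_on_cong unfolding smooth_on_def by blast

lemma smooth_on_local:
  "(\<And>x. x \<in> S \<Longrightarrow> \<exists>T. open T \<and> x \<in> T \<and> smooth_on f T) \<Longrightarrow> smooth_on f S"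
  unfolding smooth_on_def by (meson Ck_on_local)

lemma smooth_on_subset: "open S \<Longrightarrow> smooth_on f S \<Longrightarrow> T \<subseteq> S \<Longrightarrow> smooth_on f T"
  unfolding smooth_on_def using Ck_on_subset by blast

lemma smooth_on_compose:
  fixes g :: "'e::real_normed_vector \<Rightarrow> 'f::euclidean_space" and f :: "'f \<Rightarrow> 'k::real_normed_vector"
  assumes "open S" "smooth_on g S" "smooth_on f T" "g ` S \<subseteq> T"
  shows "smooth_on (\<lambda>x. f (g x)) S"
  using assms Ck_on_compose unfolding smooth_on_def by blast

lemma smooth_on_derivative:
  "smooth_on f S \<Longrightarrow> smooth_on (\<lambda>x. frechet_derivative f (at x) h) S"
  unfolding smooth_on_def by (metis Ck_on.simps(2))

lemma smooth_on_imp_differentiable: "smooth_on f S \<Longrightarrow> x \<in> S \<Longrightarrow> f differentiable (at x)"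
  unfolding smooth_on_def by (metis Ck_on.simps(2))

lemma smooth_on_scaleR:
  fixes r :: "'e::real_normed_vector \<Rightarrow> real"
  shows "open S \<Longrightarrow> smooth_on r S \<Longrightarrow> smooth_on f S \<Longrightarrow> smooth_on (\<lambda>x. r x *\<^sub>R f x) S"
  unfolding smooth_on_def using Ck_on_scaleR by blast

subsection \<open>Symmetry of second derivatives\<close>

text \<open>The second difference of \<open>f\<close> over a parallelogram, by the mean value
  theorem first along \<open>u\<close> and then along \<open>w\<close>.\<close>

lemma second_difference_mvt:
  fixes f :: "'e::real_normed_vector \<Rightarrow> real"
  assumes "r > 0"
    and S: "\<And>\<sigma> \<tau>. 0 \<le> \<sigma> \<Longrightarrow> \<sigma> \<le> r \<Longrightarrow> 0 \<le> \<tau> \<Longrightarrow> \<tau> \<le> r \<Longrightarrow> x + \<sigma> *\<^sub>R u + \<tau> *\<^sub>R w \<in> S"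
    and C: "Ck_on 2 f S"
  shows "\<exists>\<sigma> \<tau>. 0 \<le> \<sigma> \<and> \<sigma> \<le> r \<and> 0 \<le> \<tau> \<and> \<tau> \<le> r \<and>
    f (x + r *\<^sub>R u + r *\<^sub>R w) - f (x + r *\<^sub>R u) - f (x + r *\<^sub>R w) + f x =
    r * r * frechet_derivative (\<lambda>y. frechet_derivative f (at y) u) (at (x + \<sigma> *\<^sub>R u + \<tau> *\<^sub>R w)) w"
proof -
  define f1 where "f1 y = frechet_derivative f (at y) u" for y
  have C1: "Ck_on (Suc 0) f1 S" and C0: "\<And>y. y \<in> S \<Longrightarrow> f differentiable (at y)"
    using C by (simp_all add: f1_def[abs_def] numeral_2_eq_2)
  have line: "((\<lambda>s. F (a + s *\<^sub>R v)) has_real_derivative frechet_derivative F (at (a + s *\<^sub>R v)) v) (at s)"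
    if "F differentiable (at (a + s *\<^sub>R v))" for F :: "'e \<Rightarrow> real" and a v s
  proof -
    have "((\<lambda>s. a + s *\<^sub>R v) has_derivative (\<lambda>t. t *\<^sub>R v)) (at s)"
      by (auto intro!: derivative_eq_intros)
    from diff_chain_at[OF this, of F] that
    have "((\<lambda>s. F (a + s *\<^sub>R v)) has_derivative (\<lambda>t. frechet_derivative F (at (a + s *\<^sub>R v)) (t *\<^sub>R v))) (at s)"
      by (simp add: o_def frechet_derivative_works[symmetric])
    moreover have "frechet_derivative F (at (a + s *\<^sub>R v)) (t *\<^sub>R v)
        = t * frechet_derivative F (at (a + s *\<^sub>R v)) v" for t
      using linear_scale[OF linear_frechet_derivative[OF that]] by simp
    ultimately show ?thesis by (simp add: has_field_derivative_def mult_commute_abs)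
  qed
  \<comment> \<open>The increment of \<open>f\<close> in direction \<open>r w\<close>, as a function
    of the parameter along \<open>u\<close>. Then \<open>\<phi> r - \<phi> 0\<close> is the second
    difference.\<close>
  define \<phi> where "\<phi> s = f ((x + r *\<^sub>R w) + s *\<^sub>R u) - f (x + s *\<^sub>R u)" for s
  have "\<exists>\<sigma>. 0 < \<sigma> \<and> \<sigma> < r \<and> \<phi> r - \<phi> 0 = (r - 0) * (f1 ((x + r *\<^sub>R w) + \<sigma> *\<^sub>R u) - f1 (x + \<sigma> *\<^sub>R u))"
  proof (rule MVT2[OF \<open>r > 0\<close>])
    fix s :: real assume s: "0 \<le> s" "s \<le> r"
    have "x + s *\<^sub>R u + 0 *\<^sub>R w \<in> S" "x + s *\<^sub>R u + r *\<^sub>R w \<in> S"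
      using S[of s 0] S[of s r] s \<open>r > 0\<close> by simp_all
    then have "x + s *\<^sub>R u \<in> S" "x + r *\<^sub>R w + s *\<^sub>R u \<in> S"
      by (auto simp: algebra_simps)
    then show "(\<phi> has_real_derivative f1 ((x + r *\<^sub>R w) + s *\<^sub>R u) - f1 (x + s *\<^sub>R u)) (at s)"
      unfolding \<phi>_def f1_def by (intro DERIV_diff line C0)
  qed
  then obtain \<sigma> where \<sigma>: "0 < \<sigma>" "\<sigma> < r"
    "\<phi> r - \<phi> 0 = r * (f1 ((x + r *\<^sub>R w) + \<sigma> *\<^sub>R u) - f1 (x + \<sigma> *\<^sub>R u))" by auto
  have "\<exists>\<tau>. 0 < \<tau> \<and> \<tau> < r \<and> f1 ((x + \<sigma> *\<^sub>R u) + r *\<^sub>R w) - f1 ((x + \<sigma> *\<^sub>R u) + 0 *\<^sub>R w) =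
      (r - 0) * frechet_derivative f1 (at ((x + \<sigma> *\<^sub>R u) + \<tau> *\<^sub>R w)) w"
  proof (rule MVT2[OF \<open>r > 0\<close>])
    fix t :: real assume "0 \<le> t" "t \<le> r"
    then show "((\<lambda>t. f1 ((x + \<sigma> *\<^sub>R u) + t *\<^sub>R w)) has_real_derivative
        frechet_derivative f1 (at ((x + \<sigma> *\<^sub>R u) + t *\<^sub>R w)) w) (at t)"
      using C1 S \<sigma> by (intro line) auto
  qed
  then obtain \<tau> where \<tau>: "0 < \<tau>" "\<tau> < r" "f1 ((x + \<sigma> *\<^sub>R u) + r *\<^sub>R w) - f1 (x + \<sigma> *\<^sub>R u) =
      r * frechet_derivative f1 (at ((x + \<sigma> *\<^sub>R u) + \<tau> *\<^sub>R w)) w" by auto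
  have "\<phi> r - \<phi> 0 = r * (r * frechet_derivative f1 (at ((x + \<sigma> *\<^sub>R u) + \<tau> *\<^sub>R w)) w)"
    using \<sigma>(3) \<tau>(3) by (simp add: algebra_simps)
  then have "f (x + r *\<^sub>R u + r *\<^sub>R w) - f (x + r *\<^sub>R u) - f (x + r *\<^sub>R w) + f x =
    r * r * frechet_derivative f1 (at (x + \<sigma> *\<^sub>R u + \<tau> *\<^sub>R w)) w"
    by (simp add: \<phi>_def algebra_simps)
  moreover have "f1 = (\<lambda>y. frechet_derivative f (at y) u)"
    by (simp add: f1_def fun_eq_iff)
  ultimately show ?thesis using \<sigma>(1,2) \<tau>(1,2) by (metis less_imp_le)
qed

text \<open>The second difference is symmetric in \<open>u\<close> and \<open>w\<close>, so the two
  mixed derivatives take a common value at two points of an arbitrarily small parallelogram. If they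
  differed at \<open>x\<close>, continuity with tolerance half the gap would be
  contradicted.\<close>

lemma Ck_on_symmetric_second_derivative:
  fixes f :: "'e::real_normed_vector \<Rightarrow> real"
  assumes "open S" "x \<in> S" and C: "Ck_on 2 f S"
  shows "frechet_derivative (\<lambda>y. frechet_derivative f (at y) u) (at x) w =
    frechet_derivative (\<lambda>y. frechet_derivative f (at y) w) (at x) u"
proof (rule ccontr)
  define D where "D u w y = frechet_derivative (\<lambda>y. frechet_derivative f (at y) u) (at y) w" for u w y
  assume "\<not> ?thesis"
  then have neq: "dist (D u w x) (D w u x) > 0" by (simp add: D_def)
  define e where "e = dist (D u w x) (D w u x) / 2"
  have "e > 0" using neq by (simp add: e_def)
  have "continuous_on S (D u w)" "continuous_on S (D w u)"
    using C by (simp_all add: D_def numeral_2_eq_2)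
  then have "isCont (D u w) x" "isCont (D w u) x"
    using assms(1,2) continuous_on_eq_continuous_at by blast+
  then have "\<forall>\<^sub>F y in nhds x. dist (D u w y) (D u w x) < e \<and> dist (D w u y) (D w u x) < e \<and> y \<in> S"
    using \<open>e > 0\<close> assms(1,2)
    by (intro eventually_conj tendstoD eventually_nhds_in_open) (auto simp: isCont_def continuous_at tendsto_at_iff_tendsto_nhds[symmetric])
  then obtain d where d: "d > 0"
    "\<And>y. dist y x < d \<Longrightarrow> dist (D u w y) (D u w x) < e \<and> dist (D w u y) (D w u x) < e \<and> y \<in> S"
    unfolding eventually_nhds_metric by blast
  \<comment> \<open>Small enough for the parallelogram with sides \<open>r u\<close> and
    \<open>r w\<close> to stay within distance \<open>d\<close> of \<open>x\<close>. The summand 1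
    keeps the denominator positive when both vectors vanish.\<close>
  define r where "r = d / (2 * (norm u + norm w + 1))"
  have pos: "norm u + norm w + 1 > 0" by (smt (verit) norm_ge_zero)
  have "r > 0" using d(1) pos by (simp add: r_def)
  have near: "dist (x + \<sigma> *\<^sub>R a + \<tau> *\<^sub>R b) x < d"
    if "0 \<le> \<sigma>" "\<sigma> \<le> r" "0 \<le> \<tau>" "\<tau> \<le> r" "norm a + norm b = norm u + norm w" for \<sigma> \<tau> a b
  proof -
    have "dist (x + \<sigma> *\<^sub>R a + \<tau> *\<^sub>R b) x = norm (\<sigma> *\<^sub>R a + \<tau> *\<^sub>R b)"
      by (simp add: dist_norm algebra_simps)
    also have "\<dots> \<le> \<sigma> * norm a + \<tau> * norm b"
      using norm_triangle_ineq[of "\<sigma> *\<^sub>R a" "\<tau> *\<^sub>R b"] that(1,3) by simp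
    also have "\<dots> \<le> r * norm a + r * norm b"
      using that(1-4) by (intro add_mono mult_right_mono) auto
    also have "\<dots> = r * (norm u + norm w)" using that(5) by (metis distrib_left)
    also have "\<dots> < r * (2 * (norm u + norm w + 1))"
      using \<open>r > 0\<close> pos by (intro mult_strict_left_mono) (auto simp: add_pos_nonneg intro: add_nonneg_pos)
    also have "\<dots> = d" using pos by (simp add: r_def)
    finally show ?thesis .
  qed
  have in_S: "x + \<sigma> *\<^sub>R u + \<tau> *\<^sub>R w \<in> S" "x + \<sigma> *\<^sub>R w + \<tau> *\<^sub>R u \<in> S"
    if "0 \<le> \<sigma>" "\<sigma> \<le> r" "0 \<le> \<tau>" "\<tau> \<le> r" for \<sigma> \<tau>
    using d(2)[OF near[OF that]] by (simp_all add: add.commute)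
  obtain \<sigma> \<tau> where 1: "0 \<le> \<sigma>" "\<sigma> \<le> r" "0 \<le> \<tau>" "\<tau> \<le> r"
    "f (x + r *\<^sub>R u + r *\<^sub>R w) - f (x + r *\<^sub>R u) - f (x + r *\<^sub>R w) + f x = r * r * D u w (x + \<sigma> *\<^sub>R u + \<tau> *\<^sub>R w)"
    using second_difference_mvt[OF \<open>r > 0\<close> in_S(1) C] unfolding D_def by blast
  obtain \<sigma>' \<tau>' where 2: "0 \<le> \<sigma>'" "\<sigma>' \<le> r" "0 \<le> \<tau>'" "\<tau>' \<le> r"
    "f (x + r *\<^sub>R w + r *\<^sub>R u) - f (x + r *\<^sub>R w) - f (x + r *\<^sub>R u) + f x = r * r * D w u (x + \<sigma>' *\<^sub>R w + \<tau>' *\<^sub>R u)"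
    using second_difference_mvt[OF \<open>r > 0\<close> in_S(2) C] unfolding D_def by blast
  have "r * r * D u w (x + \<sigma> *\<^sub>R u + \<tau> *\<^sub>R w) = r * r * D w u (x + \<sigma>' *\<^sub>R w + \<tau>' *\<^sub>R u)"
    unfolding 1(5)[symmetric] 2(5)[symmetric] by (simp add: algebra_simps)
  then have eq: "D u w (x + \<sigma> *\<^sub>R u + \<tau> *\<^sub>R w) = D w u (x + \<sigma>' *\<^sub>R w + \<tau>' *\<^sub>R u)"
    using \<open>r > 0\<close> by simp
  have "dist (D u w (x + \<sigma> *\<^sub>R u + \<tau> *\<^sub>R w)) (D u w x) < e"
    using d(2) near 1 by blast
  moreover have "dist (D w u (x + \<sigma>' *\<^sub>R w + \<tau>' *\<^sub>R u)) (D w u x) < e"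
    using d(2) near[of \<sigma>' \<tau>' w u] 2 by (simp add: add.commute)
  ultimately show False
    using eq dist_triangle[of "D u w x" "D w u x" "D u w (x + \<sigma> *\<^sub>R u + \<tau> *\<^sub>R w)"]
    by (simp add: e_def dist_commute)
qed

subsection \<open>A bump function\<close>

text \<open>All derivatives of \<^term>\<open>\<lambda>x::real. exp (- (1 / x))\<close>, continued by 0, belong to this family.\<close>

definition flat_fun :: "real poly \<Rightarrow> real \<Rightarrow> real" where
  "flat_fun p x = (if x > 0 then poly p (1 / x) * exp (- (1 / x)) else 0)"

text \<open>Substituting y = 1/x reduces this to the exponential outgrowing every power at
  infinity.\<close>

lemma flat_fun_tendsto_0: "(flat_fun p \<longlongrightarrow> 0) (at_right 0)"
proof -
  have "((\<lambda>y. \<Sum>i\<le>degree p. coeff p i * (y ^ i / exp y)) \<longlongrightarrow> (\<Sum>i\<le>degree p. coeff p i * 0)) at_top"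
    by (intro tendsto_sum tendsto_mult tendsto_const tendsto_power_div_exp_0)
  then have "((\<lambda>y. poly p y * exp (- y)) \<longlongrightarrow> 0) at_top"
    by (simp add: poly_altdef sum_distrib_right exp_minus divide_inverse mult.assoc)
  from filterlim_compose[OF this filterlim_inverse_at_top_right]
  have "((\<lambda>x. poly p (1 / x) * exp (- (1 / x))) \<longlongrightarrow> 0) (at_right (0::real))"
    by (simp add: inverse_eq_divide)
  then show ?thesis
    by (rule Lim_transform_eventually) (auto simp: flat_fun_def eventually_at_filter)
qed

text \<open>With y = 1/x one has dy/dx = -y^2, and d/dy of p(y) exp(-y) is (p'(y) - p(y)) exp(-y).
  This explains the polynomial y^2 (p - p').\<close>

lemma flat_fun_derivative:
  "(flat_fun p has_real_derivative flat_fun ([:0, 0, 1:] * (p - pderiv p)) x) (at x)"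
proof (cases x "0::real" rule: linorder_cases)
  case less
  have "((\<lambda>x. 0) has_real_derivative 0) (at x)" by simp
  then have "(flat_fun p has_real_derivative 0) (at x)"
    by (rule has_field_derivative_transform_within_open[where S = "{..<0}"]) (use less in \<open>auto simp: flat_fun_def\<close>)
  then show ?thesis using less by (simp add: flat_fun_def)
next
  case greater
  have "((\<lambda>x. poly p (1 / x) * exp (- (1 / x))) has_real_derivative
      flat_fun ([:0, 0, 1:] * (p - pderiv p)) x) (at x)"
    using greater
    by (auto intro!: derivative_eq_intros simp: flat_fun_def field_simps power2_eq_square)
  then show ?thesis
    by (rule has_field_derivative_transform_within_open[where S = "{0<..}"]) (use greater in \<open>auto simp: flat_fun_def\<close>)
next
  case equal
  have "((\<lambda>h. flat_fun p h / h) \<longlongrightarrow> 0) (at (0::real))"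
  proof (rule filterlim_split_at)
    have "eventually (\<lambda>h. flat_fun p h / h = 0) (at_left (0::real))"
      by (auto simp: flat_fun_def eventually_at_filter)
    then show "((\<lambda>h. flat_fun p h / h) \<longlongrightarrow> 0) (at_left 0)"
      by (rule tendsto_eventually)
    show "((\<lambda>h. flat_fun p h / h) \<longlongrightarrow> 0) (at_right 0)"
    proof (rule Lim_transform_eventually[OF flat_fun_tendsto_0[of "[:0, 1:] * p"]])
      \<comment> \<open>Dividing by \<open>h\<close> multiplies the polynomial by y = 1/h, so the
        difference quotient at 0 belongs to the same family and tends to 0.\<close>
      have "flat_fun ([:0, 1:] * p) h = flat_fun p h / h" for h
        by (simp add: flat_fun_def)
      then show "\<forall>\<^sub>F h in at_right 0. flat_fun ([:0, 1:] * p) h = flat_fun p h / h"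
        by simp
    qed
  qed
  then show ?thesis using equal by (simp add: DERIV_def flat_fun_def)
qed

lemma Ck_on_flat_fun: "Ck_on k (flat_fun p) UNIV"
proof (induction k arbitrary: p)
  case 0
  show ?case
    using flat_fun_derivative by (auto intro!: continuous_at_imp_continuous_on DERIV_isCont)
next
  case (Suc k)
  have D: "(flat_fun p has_derivative (\<lambda>h. flat_fun ([:0, 0, 1:] * (p - pderiv p)) x * h)) (at x)" for x
    using flat_fun_derivative by (simp add: has_field_derivative_def)
  then have "frechet_derivative (flat_fun p) (at x) h = h * flat_fun ([:0, 0, 1:] * (p - pderiv p)) x" for x h
    by (simp add: frechet_derivative_at[OF D, symmetric])
  then show ?case
    using D Ck_on_bounded_linear_compose[OF bounded_linear_mult_right open_UNIV Suc] by (auto simp: differentiable_def)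
qed

text \<open>The squared distance is used because it is a polynomial in the coordinates, while the
  norm is not differentiable at the centre. For \<open>r > 0\<close> the argument of
  \<open>flat_fun\<close> is positive exactly on the open ball.\<close>

definition bump :: "'e::euclidean_space \<Rightarrow> real \<Rightarrow> 'e \<Rightarrow> real" where
  "bump a r x = flat_fun 1 (r\<^sup>2 - (x - a) \<bullet> (x - a))"

lemma bump_center: "r > 0 \<Longrightarrow> bump a r a > 0"
  by (simp add: bump_def flat_fun_def)

lemma bump_eq_0: "0 \<le> r \<Longrightarrow> x \<notin> ball a r \<Longrightarrow> bump a r x = 0"
  using power_mono[of r "norm (a - x)" 2]
  by (simp add: bump_def flat_fun_def dist_norm norm_minus_commute[of x a] power2_norm_eq_inner[symmetric] not_less)

lemma smooth_on_bump: "open S \<Longrightarrow> smooth_on (bump a r) S"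
proof -
  have "Ck_on k (bump a r) UNIV" for k
  proof -
    have lin: "Ck_on k (\<lambda>x::'a. (x - a) \<bullet> i) UNIV" for i
      using Ck_on_add[OF open_UNIV Ck_on_bounded_linear[OF bounded_linear_inner_left] Ck_on_const, of k i "- (a \<bullet> i)"]
      by (simp add: inner_diff_left)
    \<comment> \<open>The squared norm written as a sum of products of coordinates, the form to
      which the closure lemmas for sums and scalar multiples apply.\<close>
    have "Ck_on k (\<lambda>x. r\<^sup>2 + (\<Sum>i\<in>Basis. (- 1) *\<^sub>R (((x - a) \<bullet> i) *\<^sub>R ((x - a) \<bullet> i)))) UNIV"
      by (intro Ck_on_add Ck_on_const Ck_on_sum Ck_on_scaleR lin open_UNIV finite_Basis)
    then have "Ck_on k (\<lambda>x. r\<^sup>2 - (x - a) \<bullet> (x - a)) UNIV"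
      by (simp add: euclidean_inner[of "x - a" "x - a" for x] sum_negf)
    from Ck_on_compose[OF open_UNIV this Ck_on_flat_fun] show ?thesis
      by (simp add: bump_def[abs_def])
  qed
  then show "open S \<Longrightarrow> smooth_on (bump a r) S"
    unfolding smooth_on_def by (meson Ck_on_subset open_UNIV subset_UNIV)
qed

section \<open>Manifolds: charts, tangent vectors, smooth maps and vector fields\<close>

subsection \<open>Charts and smooth functions\<close>

lemma smooth_manifold_cover: "smooth_manifold n M \<Longrightarrow> p \<in> points M \<Longrightarrow> \<exists>c\<in>atlas M. p \<in> cdom c"
  unfolding smooth_manifold_def by blast

lemma chart_openin: "smooth_manifold n M \<Longrightarrow> c \<in> atlas M \<Longrightarrow> openin (mtop M) (cdom c)"
  unfolding smooth_manifold_def by blast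

lemma chart_subset: "smooth_manifold n M \<Longrightarrow> c \<in> atlas M \<Longrightarrow> cdom c \<subseteq> points M"
  using chart_openin openin_subset by blast

lemma chart_homeomorphic_map:
  "smooth_manifold n M \<Longrightarrow> c \<in> atlas M \<Longrightarrow>
    homeomorphic_map (subtopology (mtop M) (cdom c)) (top_of_set (coord c ` cdom c)) (coord c)"
  unfolding smooth_manifold_def by blast

lemma chart_transition:
  "smooth_manifold n M \<Longrightarrow> c \<in> atlas M \<Longrightarrow> d \<in> atlas M \<Longrightarrow>
    smooth_on (coord d \<circ> param c) (coord c ` (cdom c \<inter> cdom d))"
  unfolding smooth_manifold_def by blast

lemma chart_inj_on:
  assumes "smooth_manifold n M" "c \<in> atlas M"
  shows "inj_on (coord c) (cdom c)"
  using homeomorphic_imp_injective_map[OF chart_homeomorphic_map[OF assms]] chart_subset[OF assms]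
  by (simp add: Int_absorb1)

lemma param_coord:
  "smooth_manifold n M \<Longrightarrow> c \<in> atlas M \<Longrightarrow> p \<in> cdom c \<Longrightarrow> param c (coord c p) = p"
  unfolding param_def by (simp add: chart_inj_on)

lemma param_image:
  assumes "smooth_manifold n M" "c \<in> atlas M" "A \<subseteq> cdom c" "x \<in> coord c ` A"
  shows "param c x \<in> A" "coord c (param c x) = x"
  using assms param_coord by fastforce+

lemma chart_image_open:
  assumes M: "smooth_manifold n M" "c \<in> atlas M" and U: "openin (mtop M) U"
  shows "open (coord c ` (cdom c \<inter> U))"
proof -
  have "openin (subtopology (mtop M) (cdom c)) (cdom c \<inter> U)"
    using U by (metis inf_commute openin_subtopology)
  then have "openin (top_of_set (coord c ` cdom c)) (coord c ` (cdom c \<inter> U))"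
    using homeomorphic_map_openness_eq[OF chart_homeomorphic_map[OF M]] by blast
  moreover have "open (coord c ` cdom c)"
    using M unfolding smooth_manifold_def by blast
  ultimately show ?thesis by (simp add: openin_open_eq)
qed

lemma chart_preimage_openin:
  assumes M: "smooth_manifold n M" "c \<in> atlas M" and V: "open V"
  shows "openin (mtop M) {p \<in> cdom c. coord c p \<in> V}"
proof -
  have "openin (subtopology (mtop M) (cdom c))
      {p \<in> topspace (subtopology (mtop M) (cdom c)). coord c p \<in> V \<inter> coord c ` cdom c}"
    using homeomorphic_imp_continuous_map[OF chart_homeomorphic_map[OF M]]
      openin_open_Int[OF V, of "coord c ` cdom c"]
    by (intro openin_continuous_map_preimage) (simp_all add: Int_commute)
  moreover have "{p \<in> topspace (subtopology (mtop M) (cdom c)). coord c p \<in> V \<inter> coord c ` cdom c}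
      = {p \<in> cdom c. coord c p \<in> V}"
    using chart_subset[OF M] by auto
  ultimately show ?thesis
    using openin_trans_full[OF _ chart_openin[OF M]] by metis
qed

lemma smooth_fun_on_subset:
  assumes "smooth_manifold n M" "openin (mtop M) U" "smooth_fun_on M U f" "W \<subseteq> U"
  shows "smooth_fun_on M W f"
  unfolding smooth_fun_on_def
proof
  fix c assume "c \<in> atlas M"
  then show "smooth_on (f \<circ> param c) (coord c ` (cdom c \<inter> W))"
    using assms chart_image_open smooth_on_subset[of "coord c ` (cdom c \<inter> U)"]
    unfolding smooth_fun_on_def by (metis Int_mono image_mono order_refl)
qed

lemma smooth_fun_on_cong:
  assumes M: "smooth_manifold n M" and U: "openin (mtop M) U" and eq: "\<And>x. x \<in> U \<Longrightarrow> f x = g x"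
  shows "smooth_fun_on M U f \<longleftrightarrow> smooth_fun_on M U g"
proof -
  have "smooth_on (f \<circ> param c) (coord c ` (cdom c \<inter> U)) \<longleftrightarrow>
      smooth_on (g \<circ> param c) (coord c ` (cdom c \<inter> U))" if c: "c \<in> atlas M" for c
  proof (rule smooth_on_cong[OF chart_image_open[OF M c U]])
    fix y assume "y \<in> coord c ` (cdom c \<inter> U)"
    then have "param c y \<in> U" using param_image(1)[OF M c] by blast
    then show "(f \<circ> param c) y = (g \<circ> param c) y" using eq by simp
  qed
  then show ?thesis unfolding smooth_fun_on_def by blast
qed

lemma smooth_near_cong:
  assumes M: "smooth_manifold n M" and U: "openin (mtop M) U" "p \<in> U"
    and eq: "\<And>x. x \<in> U \<Longrightarrow> f x = g x"
  shows "smooth_near M p f \<longleftrightarrow> smooth_near M p g"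
proof -
  have "smooth_near M p g" if "smooth_near M p f" "\<And>x. x \<in> U \<Longrightarrow> f x = g x" for f g
  proof -
    from that(1) obtain W where W: "openin (mtop M) W" "p \<in> W" "smooth_fun_on M W f"
      unfolding smooth_near_def by blast
    have "smooth_fun_on M (W \<inter> U) f"
      using smooth_fun_on_subset[OF M W(1,3)] by blast
    then have "smooth_fun_on M (W \<inter> U) g"
      using smooth_fun_on_cong[OF M openin_Int[OF W(1) U(1)]] that(2) by blast
    then show ?thesis
      unfolding smooth_near_def using W U openin_Int by blast
  qed
  then show ?thesis using eq by metis
qed

lemma smooth_nearD:
  assumes M: "smooth_manifold n M" "c \<in> atlas M" and "p \<in> cdom c" "smooth_near M p f"
  obtains V where "open V" "coord c p \<in> V" "V \<subseteq> coord c ` cdom c" "smooth_on (f \<circ> param c) V"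
proof -
  from assms(4) obtain U where U: "openin (mtop M) U" "p \<in> U" "smooth_fun_on M U f"
    unfolding smooth_near_def by blast
  show thesis
  proof (rule that)
    show "open (coord c ` (cdom c \<inter> U))" by (rule chart_image_open[OF M U(1)])
    show "smooth_on (f \<circ> param c) (coord c ` (cdom c \<inter> U))"
      using U(3) M(2) unfolding smooth_fun_on_def by blast
  qed (use U(2) assms(3) in auto)
qed

lemma smooth_near_differentiable:
  assumes "smooth_manifold n M" "c \<in> atlas M" "p \<in> cdom c" "smooth_near M p f"
  shows "(f \<circ> param c) differentiable (at (coord c p))"
  using smooth_nearD[OF assms] smooth_on_imp_differentiable by metis

text \<open>Smoothness demands every chart of the atlas; since transition maps are smooth, one chart
  suffices.\<close>

lemma smooth_nearI:
  fixes M :: "('a, 'e::euclidean_space) mfd"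
  assumes M: "smooth_manifold n M" and c: "c \<in> atlas M" and p: "p \<in> cdom c"
    and V: "open V" "coord c p \<in> V" "V \<subseteq> coord c ` cdom c" and f: "smooth_on (f \<circ> param c) V"
  shows "smooth_near M p f"
proof -
  define U where "U = {q \<in> cdom c. coord c q \<in> V}"
  have U: "openin (mtop M) U"
    unfolding U_def by (rule chart_preimage_openin[OF M c V(1)])
  have "smooth_on (f \<circ> param d) (coord d ` (cdom d \<inter> U))" if d: "d \<in> atlas M" for d
  proof -
    let ?S = "coord d ` (cdom d \<inter> U)"
    have S: "open ?S" by (rule chart_image_open[OF M d U])
    have pU: "param d x \<in> U" if "x \<in> ?S" for x
      using param_image(1)[OF M d _ that] by blast
    have "smooth_on (coord c \<circ> param d) ?S"
    proof (rule smooth_on_subset)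
      show "open (coord d ` (cdom d \<inter> cdom c))"
        by (rule chart_image_open[OF M d chart_openin[OF M c]])
      show "smooth_on (coord c \<circ> param d) (coord d ` (cdom d \<inter> cdom c))"
        by (rule chart_transition[OF M d c])
    qed (auto simp: U_def)
    from smooth_on_compose[OF S this f]
    have "smooth_on (\<lambda>x. (f \<circ> param c) ((coord c \<circ> param d) x)) ?S"
      using pU by (auto simp: U_def)
    then show ?thesis
    proof (rule iffD1[OF smooth_on_cong[OF S], rotated])
      fix x assume "x \<in> ?S"
      then have "param d x \<in> cdom c" using pU U_def by blast
      then show "(f \<circ> param c) ((coord c \<circ> param d) x) = (f \<circ> param d) x"
        by (simp add: param_coord[OF M c])
    qed
  qed
  then have "smooth_fun_on M U f" unfolding smooth_fun_on_def by blast
  then show ?thesis unfolding smooth_near_def using U p V(2) by (auto simp: U_def)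
qed

lemma smooth_fun_on_iff_smooth_near:
  assumes M: "smooth_manifold n M" and U: "openin (mtop M) U"
  shows "smooth_fun_on M U f \<longleftrightarrow> (\<forall>p\<in>U. smooth_near M p f)"
proof
  assume "smooth_fun_on M U f"
  then show "\<forall>p\<in>U. smooth_near M p f"
    unfolding smooth_near_def using U by blast
next
  assume near: "\<forall>p\<in>U. smooth_near M p f"
  show "smooth_fun_on M U f"
    unfolding smooth_fun_on_def
  proof (intro ballI smooth_on_local)
    fix c x assume c: "c \<in> atlas M" and "x \<in> coord c ` (cdom c \<inter> U)"
    then obtain p where "p \<in> cdom c" "p \<in> U" "x = coord c p" by blast
    then show "\<exists>T. open T \<and> x \<in> T \<and> smooth_on (f \<circ> param c) T"
      using smooth_nearD[OF M c] near by metis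
  qed
qed

lemma smooth_near_const:
  "smooth_manifold n M \<Longrightarrow> p \<in> points M \<Longrightarrow> smooth_near M p (\<lambda>_. r)"
  unfolding smooth_near_def smooth_fun_on_def smooth_on_def o_def
  using Ck_on_const by blast

subsection \<open>Tangent vectors\<close>

lemma chart_vec_cong:
  assumes M: "smooth_manifold n M" "c \<in> atlas M" and U: "p \<in> cdom c" "openin (mtop M) U" "p \<in> U"
    and eq: "\<And>x. x \<in> U \<Longrightarrow> f x = g x"
  shows "chart_vec M c p h f = chart_vec M c p h g"
proof -
  have "frechet_derivative (f \<circ> param c) (at (coord c p)) = frechet_derivative (g \<circ> param c) (at (coord c p))"
  proof (rule frechet_derivative_eq_on_open[OF chart_image_open[OF M U(2)]])
    fix y assume "y \<in> coord c ` (cdom c \<inter> U)"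
    then have "param c y \<in> U" using param_image(1)[OF M] by blast
    then show "(f \<circ> param c) y = (g \<circ> param c) y" using eq by simp
  qed (use U in auto)
  then show ?thesis
    unfolding chart_vec_def using smooth_near_cong[OF M(1) U(2,3) eq] by simp
qed

lemma tangent_vector_cong:
  assumes "smooth_manifold n M" "v \<in> tangent_space M p" "openin (mtop M) U" "p \<in> U"
    and "\<And>x. x \<in> U \<Longrightarrow> f x = g x"
  shows "v f = v g"
proof -
  obtain c h where "c \<in> atlas M" "p \<in> cdom c" "v = chart_vec M c p h"
    using assms(2) unfolding tangent_space_def by blast
  then show ?thesis using chart_vec_cong assms by metis
qed

lemma tangent_vector_not_smooth:
  "v \<in> tangent_space M p \<Longrightarrow> \<not> smooth_near M p f \<Longrightarrow> v f = 0"
  unfolding tangent_space_def chart_vec_def by auto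

lemma tangent_vector_locally_const:
  assumes "smooth_manifold n M" "v \<in> tangent_space M p" "openin (mtop M) U" "p \<in> U"
    and "\<And>x. x \<in> U \<Longrightarrow> f x = r"
  shows "v f = 0"
proof -
  obtain c h where "v = chart_vec M c p h"
    using assms(2) unfolding tangent_space_def by blast
  then have "v (\<lambda>_. r) = 0" by (simp add: chart_vec_def o_def)
  then show ?thesis using tangent_vector_cong[OF assms(1-4), of f "\<lambda>_. r"] assms(5) by simp
qed

lemma chart_vec_linear:
  assumes "smooth_manifold n M" "c \<in> atlas M" "p \<in> cdom c"
  shows "chart_vec M c p (r *\<^sub>R h + s *\<^sub>R k) = (\<lambda>f. r * chart_vec M c p h f + s * chart_vec M c p k f)"
proof
  fix f
  show "chart_vec M c p (r *\<^sub>R h + s *\<^sub>R k) f = r * chart_vec M c p h f + s * chart_vec M c p k f"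
  proof (cases "smooth_near M p f")
    case True
    then have "linear (frechet_derivative (f \<circ> param c) (at (coord c p)))"
      using linear_frechet_derivative smooth_near_differentiable[OF assms] by blast
    then show ?thesis
      using True by (simp add: chart_vec_def linear_add linear_scale)
  qed (simp add: chart_vec_def)
qed

lemma chart_vec_zero:
  assumes "smooth_manifold n M" "c \<in> atlas M" "p \<in> cdom c"
  shows "chart_vec M c p 0 = (\<lambda>f. 0)"
  using chart_vec_linear[OF assms, of 0 0 0 0] by simp

lemma chart_vec_tangent: "c \<in> atlas M \<Longrightarrow> p \<in> cdom c \<Longrightarrow> chart_vec M c p h \<in> tangent_space M p"
  unfolding tangent_space_def by blast

subsection \<open>Smooth maps on open sets\<close>

text \<open>Local sections live only on open sets. Keeping \<open>M\<close> and \<open>N\<close> as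
  the ambient manifolds, instead of passing to \<open>open_submfd\<close>, means that their
  push-forwards act on the same functions as all other tangent vectors.\<close>

definition smooth_map_on ::
  "('a, 'e::real_normed_vector) mfd \<Rightarrow> ('b, 'f::real_normed_vector) mfd \<Rightarrow> ('a \<Rightarrow> 'b) \<Rightarrow> 'a set \<Rightarrow> bool" where
  "smooth_map_on M N F U \<longleftrightarrow>
     openin (mtop M) U \<and> continuous_map (subtopology (mtop M) U) (mtop N) F \<and>
     (\<forall>c\<in>atlas M. \<forall>d\<in>atlas N.
        smooth_on (coord d \<circ> F \<circ> param c) (coord c ` {x \<in> cdom c \<inter> U. F x \<in> cdom d}))"

lemma smooth_map_imp_smooth_map_on:
  assumes M: "smooth_manifold n M" and F: "smooth_map M N F"
  shows "smooth_map_on M N F (points M)"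
proof -
  have "cdom c \<inter> points M = cdom c" if "c \<in> atlas M" for c
    using chart_subset[OF M that] by blast
  then show ?thesis using F unfolding smooth_map_def smooth_map_on_def by simp
qed

lemma smooth_map_on_preimage:
  assumes "smooth_map_on M N F U" "openin (mtop N) W"
  shows "openin (mtop M) {x \<in> U. F x \<in> W}"
proof -
  have U: "openin (mtop M) U" using assms(1) unfolding smooth_map_on_def by blast
  have "openin (subtopology (mtop M) U) {x \<in> topspace (subtopology (mtop M) U). F x \<in> W}"
    using assms unfolding smooth_map_on_def by (blast intro: openin_continuous_map_preimage)
  moreover have "{x \<in> topspace (subtopology (mtop M) U). F x \<in> W} = {x \<in> U. F x \<in> W}"
    using openin_subset[OF U] by auto
  ultimately show ?thesis using openin_trans_full[OF _ U] by simp
qed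

lemma smooth_map_on_points: "smooth_map_on M N F U \<Longrightarrow> x \<in> U \<Longrightarrow> F x \<in> points N"
  unfolding smooth_map_on_def continuous_map_def
  using openin_subset by fastforce

lemma smooth_map_on_ident:
  assumes M: "smooth_manifold n M"
  shows "smooth_map_on M M (\<lambda>x. x) (points M)"
proof -
  have "smooth_on (coord d \<circ> (\<lambda>x. x) \<circ> param c) (coord c ` {x \<in> cdom c \<inter> points M. x \<in> cdom d})"
    if "c \<in> atlas M" "d \<in> atlas M" for c d
  proof -
    have "{x \<in> cdom c \<inter> points M. x \<in> cdom d} = cdom c \<inter> cdom d"
      using chart_subset[OF M that(1)] by blast
    then show ?thesis using chart_transition[OF M that] by (simp add: o_def)
  qed
  then show ?thesis unfolding smooth_map_on_def by simp
qed

text \<open>Inserting \<open>param d\<close> after \<open>coord d\<close> is harmless only where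
  \<open>F\<close> lands in \<open>cdom d\<close>. The set \<open>T\<close> is the chart image of
  the open set where this holds and where \<open>f\<close> read in the chart \<open>d\<close> is
  known to be smooth.\<close>

lemma chart_expression_compose:
  fixes N :: "('b, 'f::euclidean_space) mfd"
  assumes M: "smooth_manifold m M" and N: "smooth_manifold n N" and F: "smooth_map_on M N F U"
    and c: "c \<in> atlas M" and d: "d \<in> atlas N" and p: "p \<in> cdom c" "p \<in> U" "F p \<in> cdom d"
    and f: "smooth_near N (F p) f"
  obtains T where "open T" "coord c p \<in> T"
    "\<And>x. x \<in> T \<Longrightarrow> (f \<circ> F \<circ> param c) x = (f \<circ> param d) ((coord d \<circ> F \<circ> param c) x)"
    "smooth_on (coord d \<circ> F \<circ> param c) T" "smooth_on (f \<circ> F \<circ> param c) T"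
proof -
  obtain V where V: "open V" "coord d (F p) \<in> V" "V \<subseteq> coord d ` cdom d" "smooth_on (f \<circ> param d) V"
    using smooth_nearD[OF N d p(3) f] .
  define W where "W = {y \<in> cdom d. coord d y \<in> V}"
  have W: "openin (mtop N) W" unfolding W_def by (rule chart_preimage_openin[OF N d V(1)])
  define T where "T = coord c ` (cdom c \<inter> {x \<in> U. F x \<in> W})"
  have T: "open T"
    unfolding T_def by (rule chart_image_open[OF M c smooth_map_on_preimage[OF F W]])
  have TW: "param c x \<in> cdom c" "param c x \<in> U" "F (param c x) \<in> W" if "x \<in> T" for x
    using param_image(1)[OF M c _ that[unfolded T_def]] by auto
  have eq: "(f \<circ> F \<circ> param c) x = (f \<circ> param d) ((coord d \<circ> F \<circ> param c) x)" if "x \<in> T" for x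
    using TW(3)[OF that] by (simp add: W_def param_coord[OF N d])
  have sm: "smooth_on (coord d \<circ> F \<circ> param c) T"
  proof (rule smooth_on_subset)
    have "{x \<in> cdom c \<inter> U. F x \<in> cdom d} = cdom c \<inter> {x \<in> U. F x \<in> cdom d}" by blast
    then show "open (coord c ` {x \<in> cdom c \<inter> U. F x \<in> cdom d})"
      using chart_image_open[OF M c smooth_map_on_preimage[OF F chart_openin[OF N d]]] by simp
    show "smooth_on (coord d \<circ> F \<circ> param c) (coord c ` {x \<in> cdom c \<inter> U. F x \<in> cdom d})"
      using F c d unfolding smooth_map_on_def by blast
    show "T \<subseteq> coord c ` {x \<in> cdom c \<inter> U. F x \<in> cdom d}"
      by (auto simp: T_def W_def)
  qed
  have smd: "smooth_on (\<lambda>x. (f \<circ> param d) ((coord d \<circ> F \<circ> param c) x)) T"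
    using TW(3) by (intro smooth_on_compose[OF T sm V(4)]) (auto simp: W_def)
  have "smooth_on (f \<circ> F \<circ> param c) T"
    by (rule iffD2[OF smooth_on_cong[OF T eq] smd])
  moreover have "coord c p \<in> T"
    using p V(2) by (auto simp: T_def W_def)
  ultimately show thesis using that T eq sm by blast
qed

lemma smooth_near_compose:
  fixes N :: "('b, 'f::euclidean_space) mfd"
  assumes M: "smooth_manifold m M" and N: "smooth_manifold n N" and F: "smooth_map_on M N F U"
    and p: "p \<in> U" and f: "smooth_near N (F p) f"
  shows "smooth_near M p (f \<circ> F)"
proof -
  obtain W where W: "openin (mtop N) W" "F p \<in> W" "smooth_fun_on N W f"
    using f unfolding smooth_near_def by blast
  let ?O = "{x \<in> U. F x \<in> W}"
  have O: "openin (mtop M) ?O" by (rule smooth_map_on_preimage[OF F W(1)])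
  have "smooth_fun_on M ?O (f \<circ> F)"
    unfolding smooth_fun_on_def
  proof (intro ballI smooth_on_local)
    fix c x assume c: "c \<in> atlas M" and "x \<in> coord c ` (cdom c \<inter> ?O)"
    then obtain y where y: "y \<in> cdom c" "y \<in> U" "F y \<in> W" "x = coord c y" by blast
    have "F y \<in> points N" using smooth_map_on_points[OF F y(2)] .
    then obtain d where d: "d \<in> atlas N" "F y \<in> cdom d"
      using smooth_manifold_cover[OF N] by blast
    have "smooth_near N (F y) f"
      using W y(3) unfolding smooth_near_def by blast
    then show "\<exists>T. open T \<and> x \<in> T \<and> smooth_on (f \<circ> F \<circ> param c) T"
      using chart_expression_compose[OF M N F c d(1) y(1,2) d(2)] y(4) by metis
  qed
  then show ?thesis unfolding smooth_near_def using O p W(2) by blast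
qed

lemma push_forward_chart_vec:
  fixes N :: "('b, 'f::euclidean_space) mfd"
  assumes M: "smooth_manifold m M" and N: "smooth_manifold n N" and F: "smooth_map_on M N F U"
    and c: "c \<in> atlas M" and d: "d \<in> atlas N" and p: "p \<in> cdom c" "p \<in> U" "F p \<in> cdom d"
  shows "push_forward M N F p (chart_vec M c p h) =
    chart_vec N d (F p) (frechet_derivative (coord d \<circ> F \<circ> param c) (at (coord c p)) h)"
proof
  fix f
  show "push_forward M N F p (chart_vec M c p h) f =
    chart_vec N d (F p) (frechet_derivative (coord d \<circ> F \<circ> param c) (at (coord c p)) h) f"
  proof (cases "smooth_near N (F p) f")
    case True
    obtain T where T: "open T" "coord c p \<in> T"
      "\<And>x. x \<in> T \<Longrightarrow> (f \<circ> F \<circ> param c) x = ((f \<circ> param d) \<circ> (coord d \<circ> F \<circ> param c)) x"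
      "smooth_on (coord d \<circ> F \<circ> param c) T"
      using chart_expression_compose[OF M N F c d p True] by (metis comp_apply)
    have at: "(coord d \<circ> F \<circ> param c) (coord c p) = coord d (F p)"
      using p(1) by (simp add: param_coord[OF M c])
    have "frechet_derivative (f \<circ> F \<circ> param c) (at (coord c p)) =
        frechet_derivative ((f \<circ> param d) \<circ> (coord d \<circ> F \<circ> param c)) (at (coord c p))"
      using frechet_derivative_eq_on_open[OF T(1,2,3)] .
    also have "\<dots> = frechet_derivative (f \<circ> param d) (at (coord d (F p))) \<circ>
        frechet_derivative (coord d \<circ> F \<circ> param c) (at (coord c p))"
      using frechet_derivative_compose[OF smooth_on_imp_differentiable[OF T(4,2)], of "f \<circ> param d"]
        smooth_near_differentiable[OF N d p(3) True] at by metis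
    finally show ?thesis
      using True smooth_near_compose[OF M N F p(2) True]
      by (simp add: push_forward_def chart_vec_def)
  qed (simp add: push_forward_def chart_vec_def)
qed

lemma push_forward_tangent:
  fixes N :: "('b, 'f::euclidean_space) mfd"
  assumes M: "smooth_manifold m M" and N: "smooth_manifold n N" and F: "smooth_map_on M N F U"
    and p: "p \<in> U" and v: "v \<in> tangent_space M p"
  shows "push_forward M N F p v \<in> tangent_space N (F p)"
proof -
  obtain c h where c: "c \<in> atlas M" "p \<in> cdom c" "v = chart_vec M c p h"
    using v unfolding tangent_space_def by blast
  obtain d where d: "d \<in> atlas N" "F p \<in> cdom d"
    using smooth_manifold_cover[OF N smooth_map_on_points[OF F p]] by blast
  show ?thesis
    using push_forward_chart_vec[OF M N F c(1) d(1) c(2) p d(2)] d chart_vec_tangent c(3) by metis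
qed

lemma push_forward_ident:
  assumes "v \<in> tangent_space M p"
  shows "push_forward M M (\<lambda>x. x) p v = v"
  using tangent_vector_not_smooth[OF assms] by (auto simp: push_forward_def o_def)

text \<open>A change of chart is the push-forward along the identity map: the derivative of the
  transition map carries a representative in any chart to one in \<open>c\<close>.\<close>

lemma tangent_space_chart:
  fixes M :: "('a, 'e::euclidean_space) mfd"
  assumes M: "smooth_manifold n M" and c: "c \<in> atlas M" "p \<in> cdom c"
  shows "tangent_space M p = range (chart_vec M c p)"
proof
  show "range (chart_vec M c p) \<subseteq> tangent_space M p"
    using chart_vec_tangent[OF c] by blast
  show "tangent_space M p \<subseteq> range (chart_vec M c p)"
  proof
    fix v assume v: "v \<in> tangent_space M p"
    then obtain d h where d: "d \<in> atlas M" "p \<in> cdom d" "v = chart_vec M d p h"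
      unfolding tangent_space_def by blast
    have "p \<in> points M" using chart_subset[OF M c(1)] c(2) by blast
    from push_forward_chart_vec[OF M M smooth_map_on_ident[OF M] d(1) c(1) d(2) this c(2)]
    show "v \<in> range (chart_vec M c p)"
      using push_forward_ident[OF v] unfolding d(3) by (metis rangeI)
  qed
qed

lemma tangent_space_linear:
  fixes M :: "('a, 'e::euclidean_space) mfd"
  assumes M: "smooth_manifold n M" and p: "p \<in> points M"
    and u: "u \<in> tangent_space M p" and v: "v \<in> tangent_space M p"
  shows "(\<lambda>f. r * u f + s * v f) \<in> tangent_space M p"
proof -
  obtain c where c: "c \<in> atlas M" "p \<in> cdom c"
    using smooth_manifold_cover[OF M p] by blast
  obtain h k where "u = chart_vec M c p h" "v = chart_vec M c p k"
    using u v tangent_space_chart[OF M c] by auto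
  then show ?thesis
    using chart_vec_linear[OF M c, of r h s k] chart_vec_tangent[OF c] by metis
qed

subsection \<open>Open submanifolds and slices\<close>

lemma param_open_submfd:
  assumes M: "smooth_manifold n M" "c \<in> atlas M" and x: "x \<in> coord c ` (cdom c \<inter> W)"
  shows "param (cdom c \<inter> W, coord c) x = param c x"
proof -
  obtain y where y: "y \<in> cdom c \<inter> W" "x = coord c y" using x by blast
  have "inj_on (coord c) (cdom c \<inter> W)"
    using chart_inj_on[OF M] inj_on_Int by blast
  then have "param (cdom c \<inter> W, coord c) x = y"
    using y by (simp add: param_def)
  then show ?thesis using y param_coord[OF M] by auto
qed

lemma smooth_manifold_open_submfd:
  assumes M: "smooth_manifold n M" and W: "openin (mtop M) W"
  shows "smooth_manifold n (open_submfd M W)"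
  unfolding smooth_manifold_def
proof (intro conjI ballI)
  show "Hausdorff_space (mtop (open_submfd M W))" "second_countable (mtop (open_submfd M W))"
    using M unfolding smooth_manifold_def open_submfd_def
    by (simp_all add: Hausdorff_space_subtopology second_countable_subtopology)
  show "\<exists>E::'b set. finite E \<and> independent E \<and> span E = UNIV \<and> card E = n"
    using M unfolding smooth_manifold_def by blast
  show "(\<Union>c\<in>atlas (open_submfd M W). cdom c) = points (open_submfd M W)"
    using M unfolding smooth_manifold_def open_submfd_def by auto
next
  fix c' assume "c' \<in> atlas (open_submfd M W)"
  then obtain c where c: "c \<in> atlas M" "c' = (cdom c \<inter> W, coord c)"
    unfolding open_submfd_def by auto
  show "openin (mtop (open_submfd M W)) (cdom c')"
    using openin_Int[OF chart_openin[OF M c(1)] W] W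
    by (simp add: c open_submfd_def openin_open_subtopology)
  show "open (coord c' ` cdom c')"
    using chart_image_open[OF M c(1) W] by (simp add: c)
  have "homeomorphic_map (subtopology (subtopology (mtop M) (cdom c)) W)
      (subtopology (top_of_set (coord c ` cdom c)) (coord c ` (cdom c \<inter> W))) (coord c)"
    using chart_subset[OF M c(1)]
    by (intro homeomorphic_map_subtopologies[OF chart_homeomorphic_map[OF M c(1)]])
      (auto simp: Int_absorb1)
  moreover have "coord c ` cdom c \<inter> coord c ` (cdom c \<inter> W) = coord c ` (cdom c \<inter> W)" by blast
  ultimately show "homeomorphic_map (subtopology (mtop (open_submfd M W)) (cdom c'))
      (top_of_set (coord c' ` cdom c')) (coord c')"
    by (simp add: c open_submfd_def subtopology_subtopology Int_ac)
next
  fix c' d' assume "c' \<in> atlas (open_submfd M W)" "d' \<in> atlas (open_submfd M W)"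
  then obtain c d where c: "c \<in> atlas M" "c' = (cdom c \<inter> W, coord c)"
    and d: "d \<in> atlas M" "d' = (cdom d \<inter> W, coord d)"
    unfolding open_submfd_def by auto
  let ?S = "coord c ` (cdom c \<inter> (cdom d \<inter> W))"
  have S: "open ?S"
    by (rule chart_image_open[OF M c(1) openin_Int[OF chart_openin[OF M d(1)] W]])
  have "smooth_on (coord d \<circ> param c) ?S"
    by (rule smooth_on_subset[OF chart_image_open[OF M c(1) chart_openin[OF M d(1)]]
          chart_transition[OF M c(1) d(1)]]) auto
  moreover have "(coord d \<circ> param c) x = (coord d' \<circ> param c') x" if "x \<in> ?S" for x
    using that param_open_submfd[OF M c(1), of x W] by (auto simp: c d)
  ultimately have "smooth_on (coord d' \<circ> param c') ?S"
    using smooth_on_cong[OF S] by blast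
  moreover have "coord c' ` (cdom c' \<inter> cdom d') = ?S"
    by (auto simp: c d)
  ultimately show "smooth_on (coord d' \<circ> param c') (coord c' ` (cdom c' \<inter> cdom d'))" by simp
qed

text \<open>Local trivialisations are stated for open submanifolds, whose charts are restricted.
  Restricting a chart does not change its inverse on the smaller image, so smoothness carries over
  to the ambient charts.\<close>

lemma smooth_map_open_submfd_imp_smooth_map_on:
  assumes M: "smooth_manifold m M" and N: "smooth_manifold n N"
    and U: "openin (mtop M) U" and W: "openin (mtop N) W"
    and F: "smooth_map (open_submfd M U) (open_submfd N W) F"
  shows "smooth_map_on M N F U"
proof -
  have cont: "continuous_map (subtopology (mtop M) U) (subtopology (mtop N) W) F"
    using F by (simp add: smooth_map_def open_submfd_def)
  then have contN: "continuous_map (subtopology (mtop M) U) (mtop N) F"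
    and FW: "\<And>x. x \<in> U \<Longrightarrow> F x \<in> W"
    using openin_subset[OF U] by (auto simp: continuous_map_in_subtopology)
  have "smooth_on (coord d \<circ> F \<circ> param c) (coord c ` {x \<in> cdom c \<inter> U. F x \<in> cdom d})"
    if c: "c \<in> atlas M" and d: "d \<in> atlas N" for c d
  proof -
    let ?S = "coord c ` {x \<in> cdom c \<inter> U. F x \<in> cdom d}"
    let ?O = "{x \<in> topspace (subtopology (mtop M) U). F x \<in> cdom d}"
    have "openin (subtopology (mtop M) U) ?O"
      by (rule openin_continuous_map_preimage[OF contN chart_openin[OF N d]])
    then have "openin (mtop M) ?O"
      by (rule openin_trans_full[OF _ U])
    from chart_image_open[OF M c this] have "open (coord c ` (cdom c \<inter> ?O))" .
    moreover have "cdom c \<inter> ?O = {x \<in> cdom c \<inter> U. F x \<in> cdom d}"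
      using openin_subset[OF U] by auto
    ultimately have S: "open ?S" by simp
    have "(cdom c \<inter> U, coord c) \<in> atlas (open_submfd M U)" "(cdom d \<inter> W, coord d) \<in> atlas (open_submfd N W)"
      using c d by (auto simp: open_submfd_def)
    then have "smooth_on (coord d \<circ> F \<circ> param (cdom c \<inter> U, coord c))
        (coord c ` {x \<in> cdom c \<inter> U. F x \<in> cdom d \<inter> W})"
      using F unfolding smooth_map_def by fastforce
    moreover have "{x \<in> cdom c \<inter> U. F x \<in> cdom d \<inter> W} = {x \<in> cdom c \<inter> U. F x \<in> cdom d}"
      using FW by blast
    ultimately have "smooth_on (coord d \<circ> F \<circ> param (cdom c \<inter> U, coord c)) ?S" by simp
    moreover have "(coord d \<circ> F \<circ> param (cdom c \<inter> U, coord c)) x = (coord d \<circ> F \<circ> param c) x"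
      if "x \<in> ?S" for x
    proof -
      have "x \<in> coord c ` (cdom c \<inter> U)" using that by blast
      then show ?thesis using param_open_submfd[OF M c] by simp
    qed
    ultimately show ?thesis using smooth_on_cong[OF S] by blast
  qed
  then show ?thesis using U contN unfolding smooth_map_on_def by blast
qed

text \<open>Freezing the second argument serves twice: fixing the group component of a
  trivialisation gives a local section, and fixing a point in the action gives its orbit
  map.\<close>

lemma smooth_map_slice:
  assumes M: "smooth_manifold m M" and N: "smooth_manifold n N" and P: "smooth_manifold k P"
    and F: "smooth_map (prod_mfd M N) P F" and q: "q \<in> points N"
  shows "smooth_map M P (\<lambda>x. F (x, q))"
proof -
  have "continuous_map (mtop M) (prod_topology (mtop M) (mtop N)) (\<lambda>x. (x, q))"
    using q by (intro continuous_map_pairedI) auto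
  moreover have "continuous_map (prod_topology (mtop M) (mtop N)) (mtop P) F"
    using F by (simp add: smooth_map_def prod_mfd_def)
  ultimately have cont: "continuous_map (mtop M) (mtop P) (\<lambda>x. F (x, q))"
    using continuous_map_compose by (fastforce simp: o_def)
  obtain e where e: "e \<in> atlas N" "q \<in> cdom e" using smooth_manifold_cover[OF N q] by blast
  have "smooth_on (coord d \<circ> (\<lambda>x. F (x, q)) \<circ> param c) (coord c ` {x \<in> cdom c. F (x, q) \<in> cdom d})"
    if c: "c \<in> atlas M" and d: "d \<in> atlas P" for c d
  proof -
    let ?S = "coord c ` {x \<in> cdom c. F (x, q) \<in> cdom d}"
    let ?ce = "(cdom c \<times> cdom e, map_prod (coord c) (coord e))"
    let ?T = "coord ?ce ` {z \<in> cdom ?ce. F z \<in> cdom d}"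
    have "cdom c \<inter> {x \<in> points M. F (x, q) \<in> cdom d} = {x \<in> cdom c. F (x, q) \<in> cdom d}"
      using chart_subset[OF M c] by blast
    then have S: "open ?S"
      using chart_image_open[OF M c openin_continuous_map_preimage[OF cont chart_openin[OF P d]]] by simp
    have "?ce \<in> atlas (prod_mfd M N)"
      using c e by (force simp: prod_mfd_def)
    then have sm: "smooth_on (coord d \<circ> F \<circ> param ?ce) ?T"
      using F d unfolding smooth_map_def by blast
    have A: "bounded_linear (\<lambda>x::'b. (x, 0::'d))"
      by (intro bounded_linear_Pair bounded_linear_ident bounded_linear_zero)
    \<comment> \<open>In coordinates the slice is the affine map sending \<open>x\<close> to
      \<open>(0, coord e q) + (x, 0)\<close>.\<close>
    have "Ck_on j (\<lambda>x. (coord d \<circ> F \<circ> param ?ce) ((0, coord e q) + (x, 0))) ?S" for j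
    proof (rule Ck_on_affine[OF A S])
      show "Ck_on j (coord d \<circ> F \<circ> param ?ce) ?T"
        using sm unfolding smooth_on_def by blast
      show "(0, coord e q) + (x, 0) \<in> ?T" if "x \<in> ?S" for x
        using that e(2) by (auto simp: image_iff)
    qed
    then have sme: "smooth_on (\<lambda>x. (coord d \<circ> F \<circ> param ?ce) (x, coord e q)) ?S"
      by (simp add: smooth_on_def)
    have eq: "(coord d \<circ> F \<circ> param ?ce) (x, coord e q) = (coord d \<circ> (\<lambda>x. F (x, q)) \<circ> param c) x"
      if x: "x \<in> ?S" for x
    proof -
      obtain y where y: "y \<in> cdom c" "x = coord c y" using x by blast
      have "inj_on (map_prod (coord c) (coord e)) (cdom c \<times> cdom e)"
        using chart_inj_on[OF M c] chart_inj_on[OF N e(1)] by (rule map_prod_inj_on)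
      from inv_into_f_f[OF this, of "(y, q)"] have "param ?ce (x, coord e q) = (y, q)"
        using y e(2) by (simp add: param_def)
      then show ?thesis using y by (simp add: param_coord[OF M c])
    qed
    show ?thesis by (rule iffD1[OF smooth_on_cong[OF S eq] sme])
  qed
  then show ?thesis using cont unfolding smooth_map_def by blast
qed

subsection \<open>Extending tangent vectors to vector fields\<close>

text \<open>The constant field \<open>h\<close> of a chart, multiplied by a bump function that
  equals 1 at \<open>p\<close>, is extended by zero.\<close>

lemma extend_tangent_vector:
  fixes M :: "('a, 'e::euclidean_space) mfd"
  assumes M: "smooth_manifold n M" and p: "p \<in> points M" and v: "v \<in> tangent_space M p"
  obtains X where "vector_field_on M (points M) X" "X p = v"
proof -
  obtain c h where c: "c \<in> atlas M" and pc: "p \<in> cdom c" and h: "v = chart_vec M c p h"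
    using v unfolding tangent_space_def by blast
  define a where "a = coord c p"
  have "cdom c \<inter> points M = cdom c" using chart_subset[OF M c] by blast
  then have "open (coord c ` cdom c)"
    using chart_image_open[OF M c openin_topspace] by simp
  \<comment> \<open>A closed ball inside the chart image makes its preimage \<open>K\<close>
    compact, and the Hausdorff property then makes \<open>K\<close> closed in all of
    \<open>M\<close>. Otherwise the extension by zero could fail to be smooth at boundary points of
    the chart domain.\<close>
  then obtain r where r: "r > 0" "cball a r \<subseteq> coord c ` cdom c"
    unfolding open_contains_cball a_def using pc by blast
  define \<beta> where "\<beta> b = bump a r (coord c b) / bump a r a" for b
  define X where "X b = (if b \<in> cdom c then chart_vec M c b (\<beta> b *\<^sub>R h) else (\<lambda>f. 0))" for b
  define K where "K = {b \<in> cdom c. coord c b \<in> cball a r}"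
  have K: "closedin (mtop M) K"
  proof (rule compactin_imp_closedin)
    show "Hausdorff_space (mtop M)" using M unfolding smooth_manifold_def by blast
    have "coord c ` K = cball a r"
      using r(2) by (auto simp: K_def)
    then have "compactin (top_of_set (coord c ` cdom c)) (coord c ` K)"
      using r(2) by (simp add: compactin_subtopology)
    moreover have "K \<subseteq> topspace (subtopology (mtop M) (cdom c))"
      using chart_subset[OF M c] by (auto simp: K_def)
    ultimately have "compactin (subtopology (mtop M) (cdom c)) K"
      using homeomorphic_map_compactness_eq[OF chart_homeomorphic_map[OF M c]] by blast
    then show "compactin (mtop M) K" by (simp add: compactin_subtopology)
  qed
  have zero: "X b = (\<lambda>f. 0)" if "b \<notin> K" for b
  proof (cases "b \<in> cdom c")
    case True
    then have "coord c b \<notin> ball a r" using that by (auto simp: K_def)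
    then have "\<beta> b = 0" using r(1) by (simp add: \<beta>_def bump_eq_0)
    then show ?thesis using chart_vec_zero[OF M c True] by (simp add: X_def)
  qed (simp add: X_def)
  have "vector_field_on M (points M) X"
    unfolding vector_field_on_def
  proof (intro conjI ballI allI impI)
    fix b assume b: "b \<in> points M"
    show "X b \<in> tangent_space M b"
    proof (cases "b \<in> cdom c")
      case True
      then show ?thesis using chart_vec_tangent[OF c] by (simp add: X_def)
    next
      case False
      obtain d where d: "d \<in> atlas M" "b \<in> cdom d"
        using smooth_manifold_cover[OF M b] by blast
      show ?thesis
        using False chart_vec_zero[OF M d] chart_vec_tangent[OF d] by (metis X_def)
    qed
  next
    fix W f assume "openin (mtop M) W \<and> W \<subseteq> points M \<and> smooth_fun_on M W f"
    then have W: "openin (mtop M) W" "smooth_fun_on M W f" by auto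
    have "smooth_near M b (\<lambda>p. X p f)" if b: "b \<in> W" for b
    proof (cases "b \<in> cdom c")
      case True
      let ?V = "coord c ` (cdom c \<inter> W)"
      have V: "open ?V" by (rule chart_image_open[OF M c W(1)])
      have sf: "smooth_on (f \<circ> param c) ?V"
        using W(2) c unfolding smooth_fun_on_def by blast
      have "smooth_on (\<lambda>x. bump a r x *\<^sub>R (1 / bump a r a)) ?V"
        using smooth_on_scaleR[OF V smooth_on_bump[OF V]] Ck_on_const
        unfolding smooth_on_def by blast
      from smooth_on_scaleR[OF V this smooth_on_derivative[OF sf, of h]]
      have sm: "smooth_on (\<lambda>x. (bump a r x *\<^sub>R (1 / bump a r a)) *\<^sub>R frechet_derivative (f \<circ> param c) (at x) h) ?V" .
      have eq: "((\<lambda>p. X p f) \<circ> param c) x =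
          (bump a r x *\<^sub>R (1 / bump a r a)) *\<^sub>R frechet_derivative (f \<circ> param c) (at x) h"
        if x: "x \<in> ?V" for x
      proof -
        have px: "param c x \<in> cdom c" "param c x \<in> W" "coord c (param c x) = x"
          using param_image[OF M c _ x] by auto
        have "smooth_near M (param c x) f"
          using W px(2) unfolding smooth_near_def by blast
        moreover have "linear (frechet_derivative (f \<circ> param c) (at x))"
          using smooth_on_imp_differentiable[OF sf x] by (rule linear_frechet_derivative)
        ultimately show ?thesis
          using px by (simp add: X_def chart_vec_def \<beta>_def linear_scale)
      qed
      have "smooth_on ((\<lambda>p. X p f) \<circ> param c) ?V"
        using iffD2[OF smooth_on_cong[OF V eq] sm] .
      then show ?thesis
        by (rule smooth_nearI[OF M c True V, rotated 2]) (use True b in auto)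
    next
      \<comment> \<open>Outside the chart domain the point lies in the open complement of
        \<open>K\<close>, where the field vanishes identically.\<close>
      case False
      then have "b \<in> points M - K" using openin_subset[OF W(1)] b by (auto simp: K_def)
      moreover have "openin (mtop M) (points M - K)" using K by blast
      ultimately show ?thesis
        using smooth_near_cong[OF M, of "points M - K" b "\<lambda>p. X p f" "\<lambda>_. 0"] zero
          smooth_near_const[OF M] by auto
    qed
    then show "smooth_fun_on M W (\<lambda>p. X p f)"
      using smooth_fun_on_iff_smooth_near[OF M W(1)] by blast
  qed
  moreover have "\<beta> p = 1" using bump_center[OF r(1), of a] by (simp add: \<beta>_def a_def)
  then have "X p = v" using pc h by (simp add: X_def)
  ultimately show thesis using that by blast
qed

subsection \<open>Commuting coordinate fields\<close>

text \<open>Read in the chart, the iterated fields are mixed second derivatives. The smoothness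
  claim is what rules out the default value 0 of \<open>chart_vec\<close> in the outer
  application.\<close>

lemma chart_vec_commute:
  fixes M :: "('a, 'e::euclidean_space) mfd"
  assumes M: "smooth_manifold n M" and c: "c \<in> atlas M" and p: "p \<in> cdom c"
    and W: "openin (mtop M) W" "p \<in> W" and f: "smooth_fun_on M W f"
  shows "smooth_near M p (\<lambda>b. chart_vec M c b h f)"
    and "chart_vec M c p k (\<lambda>b. chart_vec M c b h f) = chart_vec M c p h (\<lambda>b. chart_vec M c b k f)"
proof -
  let ?V = "coord c ` (cdom c \<inter> W)"
  have V: "open ?V" by (rule chart_image_open[OF M c W(1)])
  have pV: "coord c p \<in> ?V" using p W(2) by blast
  have sf: "smooth_on (f \<circ> param c) ?V"
    using f c unfolding smooth_fun_on_def by blast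
  have eq: "((\<lambda>b. chart_vec M c b h f) \<circ> param c) x = frechet_derivative (f \<circ> param c) (at x) h"
    if x: "x \<in> ?V" for x h
  proof -
    have px: "param c x \<in> cdom c" "param c x \<in> W" "coord c (param c x) = x"
      using param_image[OF M c _ x] by auto
    have "smooth_near M (param c x) f"
      using W f px(2) unfolding smooth_near_def by blast
    then show ?thesis using px by (simp add: chart_vec_def)
  qed
  have sm: "smooth_near M p (\<lambda>b. chart_vec M c b h f)" for h
  proof (rule smooth_nearI[OF M c p V pV])
    show "smooth_on ((\<lambda>b. chart_vec M c b h f) \<circ> param c) ?V"
      by (rule iffD2[OF smooth_on_cong[OF V eq] smooth_on_derivative[OF sf]])
  qed auto
  show "smooth_near M p (\<lambda>b. chart_vec M c b h f)" by (rule sm)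
  have D: "chart_vec M c p k (\<lambda>b. chart_vec M c b h f) =
      frechet_derivative (\<lambda>x. frechet_derivative (f \<circ> param c) (at x) h) (at (coord c p)) k" for h k
  proof -
    have "chart_vec M c p k (\<lambda>b. chart_vec M c b h f) =
        frechet_derivative ((\<lambda>b. chart_vec M c b h f) \<circ> param c) (at (coord c p)) k"
      using sm[of h] by (simp add: chart_vec_def[of M c p k])
    also have "frechet_derivative ((\<lambda>b. chart_vec M c b h f) \<circ> param c) (at (coord c p)) =
        frechet_derivative (\<lambda>x. frechet_derivative (f \<circ> param c) (at x) h) (at (coord c p))"
      by (rule frechet_derivative_eq_on_open[OF V pV eq])
    finally show ?thesis .
  qed
  have "Ck_on 2 (f \<circ> param c) ?V"
    using sf unfolding smooth_on_def by blast
  then show "chart_vec M c p k (\<lambda>b. chart_vec M c b h f) = chart_vec M c p h (\<lambda>b. chart_vec M c b k f)"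
    unfolding D using Ck_on_symmetric_second_derivative[OF V pV] by blast
qed

subsection \<open>Linear combinations of tangent vectors\<close>

lemma linear_lincomb:
  assumes closed: "\<And>r s u v. u \<in> W \<Longrightarrow> v \<in> W \<Longrightarrow> (\<lambda>f. r * u f + s * v f) \<in> W"
    and L: "\<And>r s u v. u \<in> W \<Longrightarrow> v \<in> W \<Longrightarrow> L (\<lambda>f. r * u f + s * v f) = r * L u + s * (L v :: real)"
    and "finite I" "\<And>i. i \<in> I \<Longrightarrow> v i \<in> W" "u \<in> W"
  shows "lincomb I r v \<in> W" "L (lincomb I r v) = (\<Sum>i\<in>I. r i * L (v i))"
proof -
  have "lincomb I r v \<in> W \<and> L (lincomb I r v) = (\<Sum>i\<in>I. r i * L (v i))"
    using assms(3,4)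
  proof (induction I rule: finite_induct)
    case empty
    \<comment> \<open>The empty combination is the zero functional; the given element
      \<open>u\<close> of \<open>W\<close> exhibits it as a member of \<open>W\<close>.\<close>
    have "lincomb {} r v = (\<lambda>f. 0 * u f + 0 * u f)" by (simp add: lincomb_def)
    then show ?case using closed[OF assms(5,5), of 0 0] L[OF assms(5,5), of 0 0] by simp
  next
    case (insert i I)
    have "lincomb (insert i I) r v = (\<lambda>f. r i * v i f + 1 * lincomb I r v f)"
      using insert.hyps by (simp add: lincomb_def)
    then show ?case 
      using insert closed[of "v i" "lincomb I r v" "r i" 1] L[of "v i" "lincomb I r v" "r i" 1] by simp
  qed
  then show "lincomb I r v \<in> W" "L (lincomb I r v) = (\<Sum>i\<in>I. r i * L (v i))" by auto
qed

lemma basis_of_linear: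
  assumes "basis_of I v W" "u \<in> W" "w \<in> W"
  shows "(\<lambda>f. r * u f + s * w f) \<in> W"
proof -
  obtain a b where "u = lincomb I a v" "w = lincomb I b v"
    using assms unfolding basis_of_def by blast
  then have "(\<lambda>f. r * u f + s * w f) = lincomb I (\<lambda>i. r * a i + s * b i) v"
    by (simp add: lincomb_def fun_eq_iff sum.distrib sum_distrib_left algebra_simps)
  then show ?thesis using assms(1) unfolding basis_of_def by blast
qed

lemma basis_of_member:
  assumes "basis_of I v W" "finite I" "i \<in> I"
  shows "v i \<in> W"
proof -
  have "v i = lincomb I (\<lambda>j. if j = i then 1 else 0) v"
    using assms(2,3) by (simp add: lincomb_def fun_eq_iff if_distrib[of "\<lambda>x. x * _"] cong: if_cong)
  then show ?thesis using assms(1) unfolding basis_of_def by blast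
qed

lemma push_forward_linear:
  "push_forward M N F p (\<lambda>f. r * u f + s * v f) =
    (\<lambda>f. r * push_forward M N F p u f + s * push_forward M N F p v f)"
  by (auto simp: push_forward_def)

lemma push_forward_lincomb:
  "push_forward M N F p (lincomb I r v) = lincomb I r (\<lambda>i. push_forward M N F p (v i))"
  by (auto simp: push_forward_def lincomb_def)

section \<open>Orbits of a group action\<close>

lemma orbit_action_eq:
  assumes "group_action G E \<phi>" "x \<in> E" "g \<in> carrier G"
  shows "orbit G \<phi> (\<phi> g x) = orbit G \<phi> x"
proof -
  interpret group_action G E \<phi> by fact
  interpret group G using group_hom by (simp add: group_hom_def)
  show ?thesis
  proof (intro equalityI subsetI)
    fix y assume "y \<in> orbit G \<phi> (\<phi> g x)"
    then obtain h where h: "h \<in> carrier G" "y = \<phi> h (\<phi> g x)" unfolding orbit_def by blast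
    then have "y = \<phi> (h \<otimes>\<^bsub>G\<^esub> g) x" using composition_rule[OF assms(2) h(1) assms(3)] by simp
    then show "y \<in> orbit G \<phi> x" unfolding orbit_def using h(1) assms(3) by blast
  next
    fix y assume "y \<in> orbit G \<phi> x"
    then obtain h where h: "h \<in> carrier G" "y = \<phi> h x" unfolding orbit_def by blast
    then have k: "h \<otimes>\<^bsub>G\<^esub> m_inv G g \<in> carrier G" using assms(3) by simp
    have "y = \<phi> (h \<otimes>\<^bsub>G\<^esub> m_inv G g) (\<phi> g x)"
      using composition_rule[OF assms(2) k assms(3)] h assms(3) by (simp add: m_assoc)
    then show "y \<in> orbit G \<phi> (\<phi> g x)" unfolding orbit_def using k by blast
  qed
qed

section \<open>Geometry of the Chaplygin system\<close>

subsection \<open>Horizontal and vertical vectors\<close>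

locale kinetic_chaplygin =
  fixes S :: "('q, 'e::euclidean_space, 'g, 'h::real_normed_vector, 'm::finite) chaplygin"
  assumes sys: "chaplygin_system S"
begin

abbreviation "Q \<equiv> Qspace S"
abbreviation "B \<equiv> base S"
abbreviation "\<pi> \<equiv> proj S"

lemma mfd_Q: "smooth_manifold DIM('e) Q" and mfd_B: "smooth_manifold CARD('m) B"
  and mfd_G: "smooth_manifold (fibre_dim S) (grp_mfd S)" and points_G: "points (grp_mfd S) = carrier (grp S)"
  and group_G: "group (grp S)" and act: "group_action (grp S) (points Q) (action S)"
  and smooth_act: "smooth_map (prod_mfd (grp_mfd S) Q) Q (\<lambda>(h, q). action S h q)"
  and principal: "principal_bundle (grp S) (grp_mfd S) Q (action S) B"
  and riem: "riemannian_metric Q (riem S)"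
  using sys unfolding chaplygin_system_def lie_group_def free_proper_action_def by blast+

lemma tangent_decomposition:
  assumes "q \<in> points Q"
  shows "tangent_space Q q = {(\<lambda>f. u f + v f) | u v. u \<in> distr S q \<and> v \<in> vertical S q}"
    and "distr S q \<inter> vertical S q = {\<lambda>f. 0}"
  using sys assms unfolding chaplygin_system_def by blast+

lemma smooth_proj: "smooth_map_on Q B \<pi> (points Q)"
  using smooth_map_imp_smooth_map_on[OF mfd_Q] principal
  unfolding principal_bundle_def proj_def by blast

lemma proj_in: "q \<in> points Q \<Longrightarrow> \<pi> q \<in> points B"
  using smooth_map_on_points[OF smooth_proj] .

lemma act_one: "q \<in> points Q \<Longrightarrow> action S \<one>\<^bsub>grp S\<^esub> q = q"
  using group_action.id_eq_one[OF act] by (metis restrict_apply')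

lemma proj_act: "q \<in> points Q \<Longrightarrow> h \<in> carrier (grp S) \<Longrightarrow> \<pi> (action S h q) = \<pi> q"
  unfolding proj_def by (rule orbit_action_eq[OF act])

text \<open>A point of the base is itself an orbit, hence a nonempty set of points of
  \<open>Q\<close>, and each of its elements generates the same orbit.\<close>

lemma representative:
  assumes "b \<in> points B"
  shows "(SOME q. q \<in> b) \<in> points Q" "\<pi> (SOME q. q \<in> b) = b"
proof -
  obtain x where x: "x \<in> points Q" "b = \<pi> x"
    using assms principal unfolding principal_bundle_def proj_def orbits_def by blast
  have "x \<in> b"
    using x act_one[OF x(1)] monoid.one_closed[OF group.is_monoid[OF group_G]]
    by (auto simp: proj_def orbit_def intro!: exI[of _ "\<one>\<^bsub>grp S\<^esub>"])
  then have "(SOME q. q \<in> b) \<in> b" by (rule someI)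
  then obtain g where "g \<in> carrier (grp S)" "(SOME q. q \<in> b) = action S g x"
    using x(2) by (auto simp: proj_def orbit_def)
  then show "(SOME q. q \<in> b) \<in> points Q" "\<pi> (SOME q. q \<in> b) = b"
    using x proj_act group_action.element_image[OF act] by metis+
qed

text \<open>A local section through \<open>q\<close> splits the tangent map of the projection.\<close>

lemma proj_surjective_tangent:
  assumes q: "q \<in> points Q" and w: "w \<in> tangent_space B (\<pi> q)"
  obtains v where "v \<in> tangent_space Q q" "push_forward Q B \<pi> q v = w"
proof -
  obtain W \<psi> where W: "openin (mtop B) W" "\<pi> q \<in> W"
    and dif: "diffeomorphism (open_submfd Q {q \<in> points Q. \<pi> q \<in> W})
      (prod_mfd (open_submfd B W) (grp_mfd S)) (\<lambda>q. (\<pi> q, \<psi> q))"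
    using principal proj_in[OF q] unfolding principal_bundle_def proj_def by blast
  let ?P = "{q \<in> points Q. \<pi> q \<in> W}"
  have P: "openin (mtop Q) ?P" by (rule smooth_map_on_preimage[OF smooth_proj W(1)])
  have mB: "smooth_manifold CARD('m) (open_submfd B W)" and mQ: "smooth_manifold DIM('e) (open_submfd Q ?P)"
    using smooth_manifold_open_submfd mfd_B mfd_Q W(1) P by blast+
  have pQ: "points (open_submfd Q ?P) = ?P" by (auto simp: open_submfd_def)
  have pB: "points (open_submfd B W) = W"
    using openin_subset[OF W(1)] by (auto simp: open_submfd_def)
  have pBG: "points (prod_mfd (open_submfd B W) (grp_mfd S)) = W \<times> carrier (grp S)"
    using pB by (simp add: prod_mfd_def points_G)
  obtain F where F: "smooth_map (prod_mfd (open_submfd B W) (grp_mfd S)) (open_submfd Q ?P) F"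
    and F': "\<forall>x\<in>points (open_submfd Q ?P). F (\<pi> x, \<psi> x) = x"
      "\<forall>y\<in>points (prod_mfd (open_submfd B W) (grp_mfd S)). (\<pi> (F y), \<psi> (F y)) = y"
    using dif unfolding diffeomorphism_def by blast
  have F1: "F (\<pi> x, \<psi> x) = x" if "x \<in> ?P" for x
    using F'(1) that unfolding pQ by blast
  have F2: "(\<pi> (F (b, h)), \<psi> (F (b, h))) = (b, h)" if "b \<in> W" "h \<in> carrier (grp S)" for b h
    using F'(2) that unfolding pBG by blast
  have "(\<pi> q, \<psi> q) \<in> points (prod_mfd (open_submfd B W) (grp_mfd S))"
  proof -
    have "continuous_map (mtop (open_submfd Q ?P)) (mtop (prod_mfd (open_submfd B W) (grp_mfd S)))
        (\<lambda>q. (\<pi> q, \<psi> q))"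
      using dif unfolding diffeomorphism_def smooth_map_def by blast
    moreover have "q \<in> points (open_submfd Q ?P)" using q W(2) unfolding pQ by blast
    ultimately show ?thesis
      using continuous_map_image_subset_topspace by fastforce
  qed
  then have \<psi>: "\<psi> q \<in> carrier (grp S)" by (simp add: pBG)
  \<comment> \<open>The section through \<open>q\<close>: the inverse trivialisation with its group
    component frozen at the value \<open>\<psi> q\<close> belonging to \<open>q\<close>.\<close>
  define s where "s b = F (b, \<psi> q)" for b
  have "smooth_map (open_submfd B W) (open_submfd Q ?P) s"
    using smooth_map_slice[OF mB mfd_G mQ F, of "\<psi> q"] \<psi> points_G
    by (simp add: s_def[abs_def])
  then have s: "smooth_map_on B Q s W"
    by (rule smooth_map_open_submfd_imp_smooth_map_on[OF mfd_B mfd_Q W(1) P])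
  have sq: "s (\<pi> q) = q" using F1 q W(2) by (simp add: s_def)
  have ps: "\<pi> (s b) = b" if "b \<in> W" for b using F2[OF that \<psi>] by (simp add: s_def)
  define v where "v = push_forward B Q s (\<pi> q) w"
  have "v \<in> tangent_space Q q"
    using push_forward_tangent[OF mfd_B mfd_Q s W(2) w] by (simp add: v_def sq)
  moreover have "push_forward Q B \<pi> q v = w"
  proof
    fix f
    show "push_forward Q B \<pi> q v f = w f"
    proof (cases "smooth_near B (\<pi> q) f")
      case True
      then have "smooth_near Q q (f \<circ> \<pi>)"
        by (rule smooth_near_compose[OF mfd_Q mfd_B smooth_proj q])
      then have "push_forward Q B \<pi> q v f = w (f \<circ> \<pi> \<circ> s)"
        using True by (simp add: push_forward_def v_def sq)
      \<comment> \<open>The projection inverts the section only on \<open>W\<close>, so the two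
        functions agree merely near the base point; locality of \<open>w\<close> is what is
        used.\<close>
      also have "\<dots> = w f"
        by (rule tangent_vector_cong[OF mfd_B w W]) (simp add: ps)
      finally show ?thesis .
    qed (use tangent_vector_not_smooth[OF w] in \<open>simp add: push_forward_def\<close>)
  qed
  ultimately show thesis using that by blast
qed

lemma distr_linear:
  assumes "q \<in> points Q" "u \<in> distr S q" "v \<in> distr S q"
  shows "(\<lambda>f. r * u f + s * v f) \<in> distr S q"
proof -
  have "distribution CARD('m) Q (distr S)"
    using sys unfolding chaplygin_system_def by blast
  then obtain v where "basis_of {..<CARD('m)} v (distr S q)"
    unfolding distribution_def using assms(1) by blast
  then show ?thesis using basis_of_linear assms(2,3) by blast
qed

lemma distr_subset: "q \<in> points Q \<Longrightarrow> u \<in> distr S q \<Longrightarrow> u \<in> tangent_space Q q"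
proof -
  assume q: "q \<in> points Q" and u: "u \<in> distr S q"
  have "(\<lambda>f. 0) \<in> vertical S q" using tangent_decomposition(2)[OF q] by blast
  then show "u \<in> tangent_space Q q"
    unfolding tangent_decomposition(1)[OF q] using u
    by (intro CollectI exI[of _ u] exI[of _ "\<lambda>f. 0"]) simp
qed

text \<open>The difference of two horizontal vectors with equal projection is both horizontal and
  vertical, hence zero.\<close>

lemma horizontal_unique:
  assumes q: "q \<in> points Q" and u: "u \<in> distr S q" "v \<in> distr S q"
    and eq: "push_forward Q B \<pi> q u = push_forward Q B \<pi> q v"
  shows "u = v"
proof -
  let ?d = "\<lambda>f. 1 * u f + (- 1) * v f"
  have d: "?d \<in> distr S q" by (rule distr_linear[OF q u])
  moreover have "push_forward Q B \<pi> q ?d = (\<lambda>f. 0)"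
    unfolding push_forward_linear by (simp add: eq)
  ultimately have "?d \<in> vertical S q"
    using distr_subset[OF q] unfolding vertical_def by blast
  then have "?d = (\<lambda>f. 0)" using d tangent_decomposition(2)[OF q] by blast
  then show ?thesis by (simp add: fun_eq_iff)
qed

text \<open>Existence comes from removing the vertical part of any lift, uniqueness from the direct
  sum; together they make the \<open>THE\<close> in \<open>hor_lift\<close> meaningful.\<close>

lemma hor_lift:
  assumes q: "q \<in> points Q" and w: "w \<in> tangent_space B (\<pi> q)"
  shows "hor_lift S q w \<in> distr S q" "push_forward Q B \<pi> q (hor_lift S q w) = w"
proof -
  obtain v where v: "v \<in> tangent_space Q q" "push_forward Q B \<pi> q v = w"
    using proj_surjective_tangent[OF q w] .
  obtain u z where u: "u \<in> distr S q" "z \<in> vertical S q" "v = (\<lambda>f. u f + z f)"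
    using v(1) unfolding tangent_decomposition(1)[OF q] by blast
  have "push_forward Q B \<pi> q z = (\<lambda>f. 0)" using u(2) unfolding vertical_def by blast
  then have "push_forward Q B \<pi> q u = w"
    using v(2) push_forward_linear[of Q B \<pi> q 1 u 1 z] by (simp add: u(3))
  then have "\<exists>!u. u \<in> distr S q \<and> push_forward Q B \<pi> q u = w"
    using u(1) horizontal_unique[OF q] by metis
  from theI'[OF this]
  show "hor_lift S q w \<in> distr S q" "push_forward Q B \<pi> q (hor_lift S q w) = w"
    unfolding hor_lift_def by auto
qed

lemma hor_lift_eqI:
  assumes "q \<in> points Q" "w \<in> tangent_space B (\<pi> q)" "u \<in> distr S q" "push_forward Q B \<pi> q u = w"
  shows "hor_lift S q w = u"
  using horizontal_unique[OF assms(1)] hor_lift[OF assms(1,2)] assms(3,4) by metis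

text \<open>A pulled-back function is constant along the orbit map, so the generator annihilates
  it.\<close>

lemma generator_tangent:
  assumes q: "q \<in> points Q" and k: "k < fibre_dim S"
  shows "Vi S k q \<in> tangent_space Q q" and "push_forward Q B \<pi> q (Vi S k q) = (\<lambda>f. 0)"
proof -
  let ?e = "\<one>\<^bsub>grp S\<^esub>" and ?a = "\<lambda>h. action S h q"
  have e: "?e \<in> points (grp_mfd S)"
    using monoid.one_closed[OF group.is_monoid[OF group_G]] by (simp add: points_G)
  have "basis_of {..<fibre_dim S} (lie_basis S) (tangent_space (grp_mfd S) ?e)"
    using sys unfolding chaplygin_system_def by blast
  from basis_of_member[OF this] k have l: "lie_basis S k \<in> tangent_space (grp_mfd S) ?e" by simp
  have "smooth_map (grp_mfd S) Q ?a"
    using smooth_map_slice[OF mfd_G mfd_Q mfd_Q smooth_act q] by simp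
  then have a: "smooth_map_on (grp_mfd S) Q ?a (points (grp_mfd S))"
    by (rule smooth_map_imp_smooth_map_on[OF mfd_G])
  show "Vi S k q \<in> tangent_space Q q"
    using push_forward_tangent[OF mfd_G mfd_Q a e l] by (simp add: Vi_def act_one[OF q])
  show "push_forward Q B \<pi> q (Vi S k q) = (\<lambda>f. 0)"
  proof
    fix f
    have "lie_basis S k ((f \<circ> \<pi>) \<circ> ?a) = 0"
      by (rule tangent_vector_locally_const[OF mfd_G l openin_topspace e, of _ "f (\<pi> q)"])
        (simp add: points_G proj_act[OF q])
    then show "push_forward Q B \<pi> q (Vi S k q) f = 0"
      by (simp add: push_forward_def Vi_def)
  qed
qed

subsection \<open>The frame in a chart of the base\<close>

context
  fixes c :: "('q set, real^'m) chart" and q :: 'q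
  assumes c: "c \<in> atlas B" and q: "q \<in> points Q" and qc: "\<pi> q \<in> cdom c"
begin

lemma coord_field_tangent: "coord_field S c a (\<pi> q) \<in> tangent_space B (\<pi> q)"
  unfolding coord_field_def by (rule chart_vec_tangent[OF c qc])

lemma Xa_distr: "Xa S c a q \<in> distr S q"
  and push_Xa: "push_forward Q B \<pi> q (Xa S c a q) = coord_field S c a (\<pi> q)"
  unfolding Xa_def using hor_lift[OF q coord_field_tangent] by auto

lemma Xa_pullback:
  assumes "smooth_near B (\<pi> q) f"
  shows "Xa S c a q (f \<circ> \<pi>) = coord_field S c a (\<pi> q) f"
  using fun_cong[OF push_Xa[of a], of f] assms by (simp add: push_forward_def)

lemma chart_vec_expand:
  "chart_vec B c (\<pi> q) h = lincomb UNIV (\<lambda>a. h $ a) (\<lambda>a. coord_field S c a (\<pi> q))"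
proof
  fix f
  show "chart_vec B c (\<pi> q) h f = lincomb UNIV (\<lambda>a. h $ a) (\<lambda>a. coord_field S c a (\<pi> q)) f"
  proof (cases "smooth_near B (\<pi> q) f")
    case True
    let ?D = "frechet_derivative (f \<circ> param c) (at (coord c (\<pi> q)))"
    have "linear ?D"
      using linear_frechet_derivative smooth_near_differentiable[OF mfd_B c qc True] by blast
    then have "?D (\<Sum>a\<in>UNIV. h $ a *\<^sub>R axis a 1) = (\<Sum>a\<in>UNIV. h $ a * ?D (axis a 1))"
      by (simp add: linear_sum linear_scale)
    moreover have "(\<Sum>a\<in>UNIV. h $ a *\<^sub>R axis a 1) = h"
      using basis_expansion[of h] by (simp add: scalar_mult_eq_scaleR)
    ultimately have "?D h = (\<Sum>a\<in>UNIV. h $ a * ?D (axis a 1))" by simp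
    then show ?thesis using True by (simp add: coord_field_def chart_vec_def lincomb_def)
  qed (simp add: coord_field_def chart_vec_def lincomb_def)
qed

text \<open>The coordinates are test functions dual to the coordinate fields; evaluating on them
  extracts coefficients and so gives linear independence.\<close>

lemma coordinate_function:
  shows "smooth_near B (\<pi> q) (\<lambda>b. coord c b $ d)"
    and "coord_field S c a (\<pi> q) (\<lambda>b. coord c b $ d) = (if a = d then 1 else 0)"
proof -
  let ?f = "\<lambda>b. coord c b $ d" and ?V = "coord c ` cdom c"
  have "cdom c \<inter> points B = cdom c" using chart_subset[OF mfd_B c] by blast
  then have V: "open ?V"
    using chart_image_open[OF mfd_B c openin_topspace] by simp
  have eq: "(?f \<circ> param c) x = x $ d" if "x \<in> ?V" for x
    using param_image(2)[OF mfd_B c _ that] by simp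
  have smd: "smooth_on (\<lambda>x. x $ d) ?V"
    unfolding smooth_on_def using Ck_on_bounded_linear[OF bounded_linear_vec_nth] by blast
  have sm: "smooth_on (?f \<circ> param c) ?V"
    by (rule iffD2[OF smooth_on_cong[OF V eq] smd])
  show near: "smooth_near B (\<pi> q) ?f"
    by (rule smooth_nearI[OF mfd_B c qc V _ _ sm]) (use qc in auto)
  have "frechet_derivative (?f \<circ> param c) (at (coord c (\<pi> q))) =
      frechet_derivative (\<lambda>x. x $ d) (at (coord c (\<pi> q)))"
    by (rule frechet_derivative_eq_on_open[OF V _ eq]) (use qc in auto)
  also have "\<dots> = (\<lambda>x. x $ d)"
    by (rule frechet_derivative_at[symmetric] bounded_linear_imp_has_derivative bounded_linear_vec_nth)+
  finally show "coord_field S c a (\<pi> q) ?f = (if a = d then 1 else 0)"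
    using near by (simp add: coord_field_def chart_vec_def axis_def)
qed

lemma coord_field_independent:
  assumes "\<And>f. smooth_near B (\<pi> q) f \<Longrightarrow> (\<Sum>a\<in>UNIV. r a * coord_field S c a (\<pi> q) f) = 0"
  shows "r d = 0"
  using assms[OF coordinate_function(1)[of d]]
  by (simp add: coordinate_function(2) if_distrib cong: if_cong)

lemma Xa_lincomb_eq_0:
  assumes "lincomb UNIV r (\<lambda>a. Xa S c a q) = (\<lambda>f. 0)"
  shows "r d = 0"
proof (rule coord_field_independent)
  fix f assume f: "smooth_near B (\<pi> q) f"
  have "(\<Sum>a\<in>UNIV. r a * Xa S c a q (f \<circ> \<pi>)) = 0"
    using fun_cong[OF assms, of "f \<circ> \<pi>"] by (simp add: lincomb_def)
  then show "(\<Sum>a\<in>UNIV. r a * coord_field S c a (\<pi> q) f) = 0"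
    by (simp add: Xa_pullback[OF f])
qed

lemma riem_linear:
  assumes "u \<in> tangent_space Q q" "v \<in> tangent_space Q q" "w \<in> tangent_space Q q"
  shows "riem S q (\<lambda>f. r * u f + s * v f) w = r * riem S q u w + s * riem S q v w"
  using riem[unfolded riemannian_metric_def, THEN conjunct1] q assms by blast

lemma riem_sym:
  "u \<in> tangent_space Q q \<Longrightarrow> v \<in> tangent_space Q q \<Longrightarrow> riem S q u v = riem S q v u"
  using riem[unfolded riemannian_metric_def, THEN conjunct2, THEN conjunct1] q by blast

lemma riem_pos: "u \<in> tangent_space Q q \<Longrightarrow> u \<noteq> (\<lambda>f. 0) \<Longrightarrow> riem S q u u > 0"
  using riem[unfolded riemannian_metric_def, THEN conjunct2, THEN conjunct2, THEN conjunct1] q by blast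

lemma riem_lincomb:
  assumes "finite I" "\<And>i. i \<in> I \<Longrightarrow> v i \<in> tangent_space Q q" "w \<in> tangent_space Q q"
  shows "lincomb I r v \<in> tangent_space Q q"
    and "riem S q (lincomb I r v) w = (\<Sum>i\<in>I. r i * riem S q (v i) w)"
    and "riem S q w (lincomb I r v) = (\<Sum>i\<in>I. r i * riem S q w (v i))"
proof -
  note lin = linear_lincomb[where W = "tangent_space Q q" and L = "\<lambda>u. riem S q u w",
      OF tangent_space_linear[OF mfd_Q q] riem_linear[OF _ _ assms(3)] assms]
  show 1: "lincomb I r v \<in> tangent_space Q q" by (rule lin(1))
  show 2: "riem S q (lincomb I r v) w = (\<Sum>i\<in>I. r i * riem S q (v i) w)" by (rule lin(2))
  show "riem S q w (lincomb I r v) = (\<Sum>i\<in>I. r i * riem S q w (v i))"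
    using 2 riem_sym[OF 1 assms(3)] riem_sym[OF assms(2) assms(3)] by simp
qed

lemma Xa_tangent: "Xa S c a q \<in> tangent_space Q q"
  using distr_subset[OF q Xa_distr] .

lemma Gab_sym: "Gab S c a b q = Gab S c b a q"
  unfolding Gab_def by (rule riem_sym[OF Xa_tangent Xa_tangent])

text \<open>The quadratic form of \<open>Gab\<close> at \<open>r\<close> is the squared length of
  the combination of the \<open>Xa\<close> with coefficients \<open>r\<close>, which vanishes only
  for the zero vector.\<close>

lemma Gab_nondegenerate:
  assumes "\<And>a. (\<Sum>b\<in>UNIV. Gab S c a b q * r b) = 0"
  shows "r d = 0"
proof -
  let ?v = "lincomb UNIV r (\<lambda>a. Xa S c a q)"
  have v: "?v \<in> tangent_space Q q"
    by (rule riem_lincomb(1)[OF finite_class.finite_UNIV Xa_tangent Xa_tangent])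
  have "riem S q ?v ?v = (\<Sum>a\<in>UNIV. r a * (\<Sum>b\<in>UNIV. r b * Gab S c a b q))"
    using riem_lincomb(2)[where I = UNIV and v = "\<lambda>a. Xa S c a q" and w = ?v]
      riem_lincomb(3)[where I = UNIV and v = "\<lambda>a. Xa S c a q"] Xa_tangent v
    by (simp add: Gab_def)
  also have "\<dots> = 0" using assms by (simp add: mult.commute)
  finally have "?v = (\<lambda>f. 0)" using riem_pos[OF v] by force
  then show ?thesis by (rule Xa_lincomb_eq_0)
qed

lemma Gab_matrix_inv:
  "(\<Sum>d\<in>UNIV. Gab S c e d q * matrix_inv (\<chi> a b. Gab S c a b q) $ a $ d) = (if a = e then 1 else 0)"
proof -
  let ?A = "(\<chi> a b. Gab S c a b q) :: real^'m^'m"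
  have "x = 0" if "?A *v x = 0" for x
  proof -
    have "(\<Sum>b\<in>UNIV. Gab S c a b q * x $ b) = 0" for a
      using arg_cong[OF that, of "\<lambda>y. y $ a"] by (simp add: matrix_vector_mult_def)
    then have "x $ d = 0" for d by (rule Gab_nondegenerate)
    then show ?thesis by (simp add: vec_eq_iff)
  qed
  then have "invertible ?A"
    using matrix_left_invertible_ker invertible_left_inverse by metis
  then have "?A ** matrix_inv ?A = mat 1 \<and> matrix_inv ?A ** ?A = mat 1"
    unfolding invertible_def matrix_inv_def by (rule someI_ex)
  \<comment> \<open>The entry of the left inverse identity; symmetry of \<open>Gab\<close> turns it
    into the order of indices in the statement.\<close>
  then have "(matrix_inv ?A ** ?A) $ a $ e = mat 1 $ a $ e"
    by simp
  then show ?thesis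
    by (simp add: matrix_matrix_mult_def mat_def Gab_sym[of e] mult.commute)
qed

end

lemma hor_lift_lincomb:
  assumes c: "c \<in> atlas B" and q: "q \<in> points Q" and qc: "\<pi> q \<in> cdom c"
  shows "hor_lift S q (lincomb UNIV r (\<lambda>a. coord_field S c a (\<pi> q))) = lincomb UNIV r (\<lambda>a. Xa S c a q)"
proof (rule hor_lift_eqI[OF q])
  \<comment> \<open>The zero functional stands in for \<open>L\<close>, because only the membership
    half of \<open>linear_lincomb\<close> is wanted.\<close>
  show "lincomb UNIV r (\<lambda>a. coord_field S c a (\<pi> q)) \<in> tangent_space B (\<pi> q)"
    by (rule linear_lincomb(1)[where L = "\<lambda>_. 0", OF tangent_space_linear[OF mfd_B proj_in[OF q]]])
      (use coord_field_tangent[OF c q qc] in auto)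
  show "lincomb UNIV r (\<lambda>a. Xa S c a q) \<in> distr S q"
    by (rule linear_lincomb(1)[where L = "\<lambda>_. 0", OF distr_linear[OF q]]) (use Xa_distr[OF c q qc] in auto)
  show "push_forward Q B \<pi> q (lincomb UNIV r (\<lambda>a. Xa S c a q)) = lincomb UNIV r (\<lambda>a. coord_field S c a (\<pi> q))"
    by (simp add: push_forward_lincomb push_Xa[OF c q qc])
qed

text \<open>Each \<open>Xa\<close> is related by the projection to a coordinate field, so both
  orders of differentiation give pullbacks of mixed second derivatives of \<open>f\<close>, and
  these agree.\<close>

lemma bracket_vertical:
  assumes c: "c \<in> atlas B" and q: "q \<in> points Q" and qc: "\<pi> q \<in> cdom c"
    and f: "smooth_near B (\<pi> q) f"
  shows "lie_bracket Q (Xa S c a) (Xa S c b) q (f \<circ> \<pi>) = 0"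
proof -
  obtain U where U: "openin (mtop B) U" "\<pi> q \<in> U" "smooth_fun_on B U f"
    using f unfolding smooth_near_def by blast
  let ?O = "{x \<in> points Q. \<pi> x \<in> U \<inter> cdom c}"
  have O: "openin (mtop Q) ?O"
    by (rule smooth_map_on_preimage[OF smooth_proj openin_Int[OF U(1) chart_openin[OF mfd_B c]]])
  have "Xa S c b q (\<lambda>x. Xa S c a x (f \<circ> \<pi>)) =
      chart_vec B c (\<pi> q) (axis b 1) (\<lambda>y. chart_vec B c y (axis a 1) f)" for a b
  proof -
    let ?g = "\<lambda>y. chart_vec B c y (axis a 1) f"
    \<comment> \<open>The inner derivative is the pullback \<open>?g \<circ> \<pi>\<close> only
      where the chart is defined and \<open>f\<close> is smooth, so locality of the outer vector is
      needed.\<close>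
    have "Xa S c b q (\<lambda>x. Xa S c a x (f \<circ> \<pi>)) = Xa S c b q (?g \<circ> \<pi>)"
    proof (rule tangent_vector_cong[OF mfd_Q Xa_tangent[OF c q qc] O])
      show "q \<in> ?O" using q qc U(2) by blast
      fix x assume x: "x \<in> ?O"
      then have "smooth_near B (\<pi> x) f" using U unfolding smooth_near_def by blast
      then show "Xa S c a x (f \<circ> \<pi>) = (?g \<circ> \<pi>) x"
        using Xa_pullback[OF c] x by (simp add: coord_field_def)
    qed
    also have "\<dots> = coord_field S c b (\<pi> q) ?g"
      by (rule Xa_pullback[OF c q qc chart_vec_commute(1)[OF mfd_B c qc U]])
    finally show ?thesis by (simp add: coord_field_def)
  qed
  moreover have "chart_vec B c (\<pi> q) (axis b 1) (\<lambda>y. chart_vec B c y (axis a 1) f) =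
      chart_vec B c (\<pi> q) (axis a 1) (\<lambda>y. chart_vec B c y (axis b 1) f)"
    by (rule chart_vec_commute(2)[OF mfd_B c qc U])
  ultimately show ?thesis by (simp add: lie_bracket_def)
qed

end

section \<open>Coordinate form of the conditions and the algebra of their components\<close>

subsection \<open>Semibasic forms in coordinates\<close>

text \<open>The wedge annihilates the part of the coefficients that is symmetric in the last two
  indices and detects all of the antisymmetric part.\<close>

lemma trilinear_form_eq_0_iff:
  fixes C :: "'m::finite \<Rightarrow> 'm \<Rightarrow> 'm \<Rightarrow> real"
  shows "(\<forall>v u w. (\<Sum>a\<in>UNIV. \<Sum>b\<in>UNIV. \<Sum>d\<in>UNIV. C a b d * v $ a * (dq b \<and>\<^sub>w dq d) u w) = 0) \<longleftrightarrow>
    (\<forall>a b d. C a b d = C a d b)"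
proof (intro iffI allI)
  fix a b d
  assume *: "\<forall>v u w. (\<Sum>a\<in>UNIV. \<Sum>b\<in>UNIV. \<Sum>d\<in>UNIV. C a b d * v $ a * (dq b \<and>\<^sub>w dq d) u w) = 0"
  have delta: "(\<Sum>x\<in>UNIV. f x * axis y 1 $ x) = f y" "(\<Sum>x\<in>UNIV. axis y 1 $ x * f x) = f y"
    for f :: "'m \<Rightarrow> real" and y
    by (simp_all add: axis_def if_distrib[of "\<lambda>z. _ * z"] if_distrib[of "\<lambda>z. z * _"] cong: if_cong)
  \<comment> \<open>Testing on basis vectors: velocity along \<open>a\<close>, and two tangent
    vectors with components only along the base directions \<open>b\<close> and
    \<open>d\<close>.\<close>
  have "(\<Sum>x\<in>UNIV. \<Sum>y\<in>UNIV. \<Sum>z\<in>UNIV. C x y z * axis a 1 $ x * (dq y \<and>\<^sub>w dq z) (axis b 1, 0) (axis d 1, 0)) =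
      (\<Sum>x\<in>UNIV. (\<Sum>y\<in>UNIV. (\<Sum>z\<in>UNIV. C x y z * axis d 1 $ z) * axis b 1 $ y) * axis a 1 $ x) -
      (\<Sum>x\<in>UNIV. (\<Sum>y\<in>UNIV. (\<Sum>z\<in>UNIV. C x y z * axis b 1 $ z) * axis d 1 $ y) * axis a 1 $ x)"
    by (simp add: wedge_def dq_def sum_distrib_left algebra_simps flip: sum_subtractf)
  also have "\<dots> = C a b d - C a d b" unfolding delta ..
  finally show "C a b d = C a d b" using * by simp
next
  fix v :: "real^'m" and u w :: "(real^'m) \<times> (real^'m)"
  assume sym: "\<forall>a b d. C a b d = C a d b"
  have "(\<Sum>b\<in>UNIV. \<Sum>d\<in>UNIV. C a b d * v $ a * (dq b \<and>\<^sub>w dq d) u w) = 0" for a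
  proof -
    let ?s = "\<Sum>b\<in>UNIV. \<Sum>d\<in>UNIV. C a b d * v $ a * (dq b \<and>\<^sub>w dq d) u w"
    have "?s = (\<Sum>b\<in>UNIV. \<Sum>d\<in>UNIV. C a d b * v $ a * (dq d \<and>\<^sub>w dq b) u w)"
      by (rule sum.swap)
    also have "\<dots> = (\<Sum>b\<in>UNIV. \<Sum>d\<in>UNIV. - (C a b d * v $ a * (dq b \<and>\<^sub>w dq d) u w))"
    proof (intro sum.cong refl)
      fix b d
      have "C a d b = C a b d" using sym by blast
      then show "C a d b * v $ a * (dq d \<and>\<^sub>w dq b) u w = - (C a b d * v $ a * (dq b \<and>\<^sub>w dq d) u w)"
        by (simp add: wedge_def algebra_simps)
    qed
    also have "\<dots> = - ?s" by (simp add: sum_negf)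
    finally show ?thesis by simp
  qed
  then show "(\<Sum>a\<in>UNIV. \<Sum>b\<in>UNIV. \<Sum>d\<in>UNIV. C a b d * v $ a * (dq b \<and>\<^sub>w dq d) u w) = 0" by simp
qed

lemma d_phi_wedge_theta_l:
  "(d_phi S c \<phi> q \<and>\<^sub>w theta_l S c q v) u w =
    (\<Sum>a\<in>UNIV. \<Sum>b\<in>UNIV. \<Sum>d\<in>UNIV. (pd S c \<phi> b q * Gab S c a d q) * v $ a * (dq b \<and>\<^sub>w dq d) u w)"
proof -
  have "(\<Sum>b\<in>UNIV. pd S c \<phi> b q * dq b u) * (\<Sum>a\<in>UNIV. \<Sum>d\<in>UNIV. Gab S c a d q * v $ a * dq d w) =
      (\<Sum>a\<in>UNIV. \<Sum>b\<in>UNIV. \<Sum>d\<in>UNIV. (pd S c \<phi> b q * Gab S c a d q) * v $ a * (dq b u * dq d w))" for u w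
    by (subst sum.swap) (simp add: sum_distrib_left sum_distrib_right algebra_simps)
  then show ?thesis
    by (simp add: wedge_def d_phi_def theta_l_def algebra_simps flip: sum_subtractf)
qed

text \<open>Comparison of coefficients: an equation of semibasic 2-forms linear in the velocity
  determines its coefficients only after antisymmetrisation in \<open>b\<close> and
  \<open>d\<close>.\<close>

lemma form_equation_iff:
  fixes K :: "'m::finite \<Rightarrow> 'm \<Rightarrow> 'm \<Rightarrow> real"
    and S :: "('q, 'e::euclidean_space, 'g, 'h::real_normed_vector, 'm) chaplygin"
  shows "(\<forall>v. d_phi S c \<phi> q \<and>\<^sub>w theta_l S c q v =
      (\<lambda>u w. k * (\<Sum>a\<in>UNIV. \<Sum>b\<in>UNIV. \<Sum>d\<in>UNIV. K a b d * v $ a * (dq b \<and>\<^sub>w dq d) u w))) \<longleftrightarrow>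
    (\<forall>a b d. pd S c \<phi> b q * Gab S c a d q - pd S c \<phi> d q * Gab S c a b q = k * (K a b d - K a d b))"
proof -
  let ?C = "\<lambda>a b d. pd S c \<phi> b q * Gab S c a d q - k * K a b d"
  have "(\<forall>v. d_phi S c \<phi> q \<and>\<^sub>w theta_l S c q v =
      (\<lambda>u w. k * (\<Sum>a\<in>UNIV. \<Sum>b\<in>UNIV. \<Sum>d\<in>UNIV. K a b d * v $ a * (dq b \<and>\<^sub>w dq d) u w))) \<longleftrightarrow>
    (\<forall>v u w. (\<Sum>a\<in>UNIV. \<Sum>b\<in>UNIV. \<Sum>d\<in>UNIV. ?C a b d * v $ a * (dq b \<and>\<^sub>w dq d) u w) = 0)"
    unfolding fun_eq_iff d_phi_wedge_theta_l
    by (simp add: sum_distrib_left left_diff_distrib sum_subtractf mult.assoc)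
  also have "\<dots> \<longleftrightarrow> (\<forall>a b d. ?C a b d = ?C a d b)"
    by (rule trilinear_form_eq_0_iff)
  also have "\<dots> \<longleftrightarrow> (\<forall>a b d. pd S c \<phi> b q * Gab S c a d q - pd S c \<phi> d q * Gab S c a b q = k * (K a b d - K a d b))"
    by (simp add: algebra_simps)
  finally show ?thesis .
qed

subsection \<open>The brackets of the horizontal frame\<close>

context kinetic_chaplygin
begin

context
  fixes R and R' and c :: "('q set, real^'m) chart" and q :: 'q
  assumes comps: "bracket_components S R R'"
    and c: "c \<in> atlas B" and q: "q \<in> points Q" and qc: "\<pi> q \<in> cdom c"
begin

lemma bracket_expand:
  "lie_bracket Q (Xa S c a) (Xa S c b) q =
    (\<lambda>f. (\<Sum>d\<in>UNIV. R c a b d q * Xa S c d q f) + (\<Sum>k<fibre_dim S. R' c a b k q * Xi S c k q f))"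
  using comps c q qc unfolding bracket_components_def by blast

text \<open>On a pulled-back function the bracket and the generators \<open>Vi\<close> vanish. What
  remains of the expansion is a combination of coordinate fields, whose coefficients must be
  zero.\<close>

lemma bracket_horizontal_component:
  "R c a b d q = - (\<Sum>k<fibre_dim S. R' c a b k q * Kbi S c d k q)"
proof -
  have "R c a b d q + (\<Sum>k<fibre_dim S. R' c a b k q * Kbi S c d k q) = 0"
  proof (rule coord_field_independent[OF c q qc])
    fix f assume f: "smooth_near B (\<pi> q) f"
    let ?X = "\<lambda>a. coord_field S c a (\<pi> q) f"
    have "Xi S c k q (f \<circ> \<pi>) = (\<Sum>d\<in>UNIV. Kbi S c d k q * ?X d)" if "k < fibre_dim S" for k
      using fun_cong[OF generator_tangent(2)[OF q that], of f] f
      by (simp add: Xi_def push_forward_def Xa_pullback[OF c q qc f])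
    then have "0 = (\<Sum>d\<in>UNIV. R c a b d q * ?X d)
        + (\<Sum>k<fibre_dim S. R' c a b k q * (\<Sum>d\<in>UNIV. Kbi S c d k q * ?X d))"
      using fun_cong[OF bracket_expand[of a b], of "f \<circ> \<pi>"]
      by (simp add: bracket_vertical[OF c q qc f] Xa_pullback[OF c q qc f])
    also have "(\<Sum>k<fibre_dim S. R' c a b k q * (\<Sum>d\<in>UNIV. Kbi S c d k q * ?X d)) =
        (\<Sum>d\<in>UNIV. (\<Sum>k<fibre_dim S. R' c a b k q * Kbi S c d k q) * ?X d)"
      unfolding sum_distrib_left sum_distrib_right by (subst sum.swap) (simp add: mult.assoc)
    finally show "(\<Sum>d\<in>UNIV. (R c a b d q + (\<Sum>k<fibre_dim S. R' c a b k q * Kbi S c d k q)) * ?X d) = 0"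
      by (simp add: distrib_right sum.distrib)
  qed
  then show ?thesis by simp
qed

text \<open>\<open>Kbi\<close> is minus the inverse metric applied to \<open>Gai\<close>. Lowering
  the index cancels the inverse metric, and the two minus signs cancel.\<close>

lemma lowered_bracket: "(\<Sum>d\<in>UNIV. Gab S c e d q * R c a b d q) = GR S R' c e a b q"
proof -
  let ?I = "\<lambda>x d. matrix_inv (\<chi> a b. Gab S c a b q) $ x $ d"
  have "(\<Sum>d\<in>UNIV. Gab S c e d q * R c a b d q) =
      (\<Sum>d\<in>UNIV. \<Sum>k<fibre_dim S. \<Sum>x\<in>UNIV. R' c a b k q * Gai S c x k q * (Gab S c e d q * ?I x d))"
    by (simp add: bracket_horizontal_component Kbi_def sum_distrib_left sum_negf mult_ac)
  also have "\<dots> = (\<Sum>k<fibre_dim S. \<Sum>d\<in>UNIV. \<Sum>x\<in>UNIV. R' c a b k q * Gai S c x k q * (Gab S c e d q * ?I x d))"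
    by (rule sum.swap)
  also have "\<dots> = (\<Sum>k<fibre_dim S. \<Sum>x\<in>UNIV. \<Sum>d\<in>UNIV. R' c a b k q * Gai S c x k q * (Gab S c e d q * ?I x d))"
    by (intro sum.cong refl sum.swap)
  also have "\<dots> = (\<Sum>k<fibre_dim S. \<Sum>x\<in>UNIV. R' c a b k q * Gai S c x k q * (if x = e then 1 else 0))"
    by (simp only: sum_distrib_left[symmetric] Gab_matrix_inv[OF c q qc])
  also have "\<dots> = GR S R' c e a b q"
    by (simp add: GR_def if_distrib mult.commute cong: if_cong)
  finally show ?thesis .
qed

text \<open>The expansions of the two opposite brackets add up to zero. Since \<open>R\<close> is
  expressed through \<open>R'\<close> and \<open>Kbi\<close>, the \<open>Xa\<close> terms cancel
  against the corrections contained in \<open>Xi\<close>, so the symmetrised components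
  \<open>s\<close> combine the generators \<open>Vi\<close> to the zero vector. Pairing with
  \<open>Xa\<close> for the index \<open>e\<close> gives the contraction.\<close>

lemma GR_antisym: "GR S R' c e b a q = - GR S R' c e a b q"
proof -
  define s where "s k = R' c a b k q + R' c b a k q" for k
  have "lincomb {..<fibre_dim S} s (\<lambda>k. Vi S k q) = (\<lambda>f. 0)"
  proof
    fix f
    let ?X = "\<lambda>d. Xa S c d q f"
    have "lie_bracket Q (Xa S c a) (Xa S c b) q f + lie_bracket Q (Xa S c b) (Xa S c a) q f = 0"
      by (simp add: lie_bracket_def)
    then have "(\<Sum>d\<in>UNIV. (R c a b d q + R c b a d q) * ?X d) + (\<Sum>k<fibre_dim S. s k * Xi S c k q f) = 0"
      unfolding bracket_expand by (simp add: s_def distrib_right sum.distrib)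
    moreover have "R c a b d q + R c b a d q = - (\<Sum>k<fibre_dim S. s k * Kbi S c d k q)" for d
      by (simp add: bracket_horizontal_component s_def distrib_right sum.distrib)
    moreover have "(\<Sum>k<fibre_dim S. s k * Xi S c k q f) =
        (\<Sum>k<fibre_dim S. s k * Vi S k q f) + (\<Sum>d\<in>UNIV. (\<Sum>k<fibre_dim S. s k * Kbi S c d k q) * ?X d)"
    proof -
      have "(\<Sum>k<fibre_dim S. s k * (\<Sum>d\<in>UNIV. Kbi S c d k q * ?X d)) =
          (\<Sum>d\<in>UNIV. (\<Sum>k<fibre_dim S. s k * Kbi S c d k q) * ?X d)"
        unfolding sum_distrib_left sum_distrib_right by (subst sum.swap) (simp add: mult.assoc)
      then show ?thesis by (simp add: Xi_def distrib_left sum.distrib)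
    qed
    ultimately show "lincomb {..<fibre_dim S} s (\<lambda>k. Vi S k q) f = 0"
      by (simp add: lincomb_def sum_negf)
  qed
  moreover have "riem S q (Xa S c e q) (lincomb {..<fibre_dim S} s (\<lambda>k. Vi S k q)) =
      (\<Sum>k<fibre_dim S. s k * Gai S c e k q)"
    using riem_lincomb(3)[OF c q qc, where I = "{..<fibre_dim S}" and v = "\<lambda>k. Vi S k q"]
      generator_tangent(1)[OF q] Xa_tangent[OF c q qc] by (simp add: Gai_def)
  \<comment> \<open>The zero vector enters as the empty linear combination.\<close>
  moreover have "riem S q (Xa S c e q) (\<lambda>f. 0) = 0"
    using riem_lincomb(3)[OF c q qc, where I = "{}" and r = "\<lambda>_. 0" and v = "\<lambda>_. Xa S c e q"]
      Xa_tangent[OF c q qc] by (simp add: lincomb_def)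
  ultimately have "(\<Sum>k<fibre_dim S. s k * Gai S c e k q) = 0" by simp
  then show ?thesis
    by (simp add: s_def GR_def distrib_left distrib_right sum.distrib mult.commute)
qed

text \<open>Lowering the index \<open>d\<close> loses nothing because the metric is nondegenerate on
  the horizontal frame.\<close>

lemma phi_simple_lowered:
  "(\<forall>a b d. R c a b d q = - pd S c \<phi> a q * (if d = b then 1 else 0) + pd S c \<phi> b q * (if d = a then 1 else 0))
    \<longleftrightarrow> (\<forall>e a b. GR S R' c e a b q = - pd S c \<phi> a q * Gab S c e b q + pd S c \<phi> b q * Gab S c e a q)"
proof -
  let ?S = "\<lambda>a b d. - pd S c \<phi> a q * (if d = b then 1 else 0) + pd S c \<phi> b q * (if d = a then 1 else 0)"
  have lower: "(\<Sum>d\<in>UNIV. Gab S c e d q * ?S a b d) =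
      - pd S c \<phi> a q * Gab S c e b q + pd S c \<phi> b q * Gab S c e a q" for e a b
  proof -
    have "(\<Sum>d\<in>UNIV. Gab S c e d q * ?S a b d) =
        (\<Sum>d\<in>UNIV. if d = b then - pd S c \<phi> a q * Gab S c e d q else 0) +
        (\<Sum>d\<in>UNIV. if d = a then pd S c \<phi> b q * Gab S c e d q else 0)"
      unfolding sum.distrib[symmetric] by (intro sum.cong refl) (auto simp: algebra_simps)
    then show ?thesis by simp
  qed
  show ?thesis
  proof
    assume "\<forall>a b d. R c a b d q = ?S a b d"
    then show "\<forall>e a b. GR S R' c e a b q = - pd S c \<phi> a q * Gab S c e b q + pd S c \<phi> b q * Gab S c e a q"
      unfolding lowered_bracket[symmetric] lower[symmetric] by simp
  next
    assume *: "\<forall>e a b. GR S R' c e a b q = - pd S c \<phi> a q * Gab S c e b q + pd S c \<phi> b q * Gab S c e a q"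
    show "\<forall>a b d. R c a b d q = ?S a b d"
    proof (intro allI)
      fix a b d
      have "(\<Sum>d\<in>UNIV. Gab S c e d q * (R c a b d q - ?S a b d)) = 0" for e
        using * lowered_bracket[of e a b] lower[of e a b]
        by (simp only: right_diff_distrib sum_subtractf)
      from Gab_nondegenerate[OF c q qc this] show "R c a b d q = ?S a b d" by simp
    qed
  qed
qed

lemma phi_simple_iff_condition_A_cyclic:
  "(\<forall>e a b. GR S R' c e a b q = - pd S c \<phi> a q * Gab S c e b q + pd S c \<phi> b q * Gab S c e a q) \<longleftrightarrow>
   (\<forall>a b d. GR S R' c b a d q + GR S R' c a b d q
      + Gab S c b d q * pd S c \<phi> a q + Gab S c a d q * pd S c \<phi> b q - 2 * Gab S c a b q * pd S c \<phi> d q = 0) \<and>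
   (\<forall>a b d. GR S R' c a b d q + GR S R' c b d a q + GR S R' c d a b q = 0)" (is "?P \<longleftrightarrow> ?A \<and> ?C")
proof (intro iffI conjI allI; (elim conjE)?)
  fix a b d
  assume P: ?P
  note G = Gab_sym[OF c q qc]
  show "GR S R' c b a d q + GR S R' c a b d q
      + Gab S c b d q * pd S c \<phi> a q + Gab S c a d q * pd S c \<phi> b q - 2 * Gab S c a b q * pd S c \<phi> d q = 0"
    using P[rule_format, of b a d] P[rule_format, of a b d] G[of b a] by (simp add: algebra_simps)
  show "GR S R' c a b d q + GR S R' c b d a q + GR S R' c d a b q = 0"
    using P[rule_format, of a b d] P[rule_format, of b d a] P[rule_format, of d a b] G[of b a] G[of d a] G[of d b]
    by (simp add: algebra_simps)
next
  fix e a b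
  assume A: ?A and C: ?C
  note G = Gab_sym[OF c q qc]
  define D where "D e a b = GR S R' c e a b q + pd S c \<phi> a q * Gab S c e b q - pd S c \<phi> b q * Gab S c e a q" for e a b
  have anti: "D e b a = - D e a b" for e a b
    using GR_antisym[of e b a] by (simp add: D_def)
  have "D b a d + D a b d = 0" for a b d
    using A[rule_format, of b a d] G[of b a] by (simp add: D_def algebra_simps)
  then have anti': "D b a d = - D a b d" for a b d
    by (simp add: eq_neg_iff_add_eq_0)
  \<comment> \<open>In the cyclic sum the six terms with derivatives of \<open>\<phi>\<close> cancel
    in pairs by symmetry of \<open>Gab\<close>. The next two lines identify the summands: a cyclic
    shift is a product of two transpositions, hence two sign changes.\<close>
  have "D e a b + D a b e + D b e a = 0"
    using C[rule_format, of e a b] G[of a e] G[of b e] G[of b a] by (simp add: D_def algebra_simps)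
  moreover have "D a b e = D e a b" using anti[of a b e] anti'[of a e b] by simp
  moreover have "D b e a = D e a b" using anti'[of b e a] anti[of e b a] by simp
  ultimately have "D e a b = 0" by simp
  then show "GR S R' c e a b q = - pd S c \<phi> a q * Gab S c e b q + pd S c \<phi> b q * Gab S c e a q"
    by (simp add: D_def)
qed

text \<open>Antisymmetrising \<open>GR\<close> in its last two indices merely doubles it, which the
  factor 1/2 undoes.\<close>

lemma Xi_G_iff:
  "(\<forall>v. d_phi S c \<phi> q \<and>\<^sub>w theta_l S c q v = Xi_G S R' c q v) \<longleftrightarrow>
   (\<forall>e a b. GR S R' c e a b q = - pd S c \<phi> a q * Gab S c e b q + pd S c \<phi> b q * Gab S c e a q)"
proof -
  have "pd S c \<phi> a q * Gab S c e b q - pd S c \<phi> b q * Gab S c e a q =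
      - (1/2) * (GR S R' c e a b q - GR S R' c e b a q) \<longleftrightarrow>
    GR S R' c e a b q = - pd S c \<phi> a q * Gab S c e b q + pd S c \<phi> b q * Gab S c e a q" for e a b
    unfolding GR_antisym[of e b a] by (simp add: field_simps)
  then show ?thesis unfolding Xi_G_def form_equation_iff by simp
qed

text \<open>The form equation is (A) antisymmetrised in its last two indices, divided by 3: there
  the terms in \<open>\<phi>\<close> with \<open>Gab S c b d\<close> cancel and the others acquire a
  factor 3. Conversely, symmetrising the form equation in its first two indices cancels the terms
  \<open>GR S R' c d\<close> by antisymmetry and returns (A). Thus 1/6 is this 1/3 times 1/2 for the
  doubling in the wedge.\<close>

lemma gamma_G_iff:
  "(\<forall>v. d_phi S c \<phi> q \<and>\<^sub>w theta_l S c q v = gamma_G S R' c q v) \<longleftrightarrow>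
   (\<forall>a b d. GR S R' c b a d q + GR S R' c a b d q
      + Gab S c b d q * pd S c \<phi> a q + Gab S c a d q * pd S c \<phi> b q - 2 * Gab S c a b q * pd S c \<phi> d q = 0)"
proof -
  let ?F = "\<lambda>a b d. pd S c \<phi> b q * Gab S c a d q - pd S c \<phi> d q * Gab S c a b q =
    1/6 * ((- GR S R' c b a d q + GR S R' c d a b q - 2 * GR S R' c a b d q)
      - (- GR S R' c d a b q + GR S R' c b a d q - 2 * GR S R' c a d b q))"
  let ?A = "\<lambda>a b d. GR S R' c b a d q + GR S R' c a b d q
      + Gab S c b d q * pd S c \<phi> a q + Gab S c a d q * pd S c \<phi> b q - 2 * Gab S c a b q * pd S c \<phi> d q = 0"
  note G = Gab_sym[OF c q qc]
  have "?A a b d" if "?F a b d" "?F b a d" for a b d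
    using that GR_antisym[of a b d] GR_antisym[of b a d] GR_antisym[of d a b] G[of b a]
    by (simp add: algebra_simps)
  moreover have "?F a b d" if "?A a b d" "?A a d b" for a b d
    using that GR_antisym[of a b d] GR_antisym[of b a d] GR_antisym[of d a b] G[of d b]
    by (simp add: algebra_simps)
  ultimately show ?thesis
    unfolding gamma_G_def form_equation_iff by blast
qed

end

subsection \<open>The gyroscopic tensor\<close>

context
  fixes R and R' and T
  assumes comps: "bracket_components S R R'" and gyro: "gyroscopic_tensor S R T"
begin

lemma gyroscopic_tensor_coord:
  assumes "c \<in> atlas B" "q \<in> points Q" "\<pi> q \<in> cdom c"
  shows "T (\<pi> q) (coord_field S c a (\<pi> q)) (coord_field S c b (\<pi> q)) =
    (\<lambda>f. \<Sum>d\<in>UNIV. R c a b d q * coord_field S c d (\<pi> q) f)"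
  using gyro[unfolded gyroscopic_tensor_def, THEN conjunct2, rule_format, OF assms] .

text \<open>Both values are components, in the same coordinate fields, of the one vector that
  \<open>T\<close> assigns at the common base point.\<close>

lemma bracket_component_basic:
  assumes c: "c \<in> atlas B" and q: "q \<in> points Q" "q' \<in> points Q" and qc: "\<pi> q \<in> cdom c" "\<pi> q' = \<pi> q"
  shows "R c a b d q' = R c a b d q"
proof -
  have qc': "\<pi> q' \<in> cdom c" using qc by simp
  have "R c a b d q' - R c a b d q = 0"
  proof (rule coord_field_independent[OF c q(1) qc(1)])
    fix f
    have "(\<Sum>d\<in>UNIV. R c a b d q' * coord_field S c d (\<pi> q) f) = (\<Sum>d\<in>UNIV. R c a b d q * coord_field S c d (\<pi> q) f)"
      using fun_cong[OF gyroscopic_tensor_coord[OF c q(1) qc(1), of a b], of f]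
        fun_cong[OF gyroscopic_tensor_coord[OF c q(2) qc', of a b], of f] qc(2) by simp
    then show "(\<Sum>d\<in>UNIV. (R c a b d q' - R c a b d q) * coord_field S c d (\<pi> q) f) = 0"
      by (simp add: left_diff_distrib sum_subtractf)
  qed
  then show ?thesis by simp
qed

lemma gyroscopic_tensor_lincomb:
  assumes c: "c \<in> atlas B" and q: "q \<in> points Q" and qc: "\<pi> q \<in> cdom c"
  shows "T (\<pi> q) (lincomb UNIV y (\<lambda>a. coord_field S c a (\<pi> q))) (lincomb UNIV z (\<lambda>a. coord_field S c a (\<pi> q))) =
    lincomb UNIV (\<lambda>d. \<Sum>a\<in>UNIV. \<Sum>b\<in>UNIV. y a * z b * R c a b d q) (\<lambda>a. coord_field S c a (\<pi> q))"
proof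
  fix f
  let ?X = "\<lambda>a. coord_field S c a (\<pi> q)" and ?W = "tangent_space B (\<pi> q)"
  have tensor: "tensor_field_12 B T" using gyro unfolding gyroscopic_tensor_def by blast
  note X = coord_field_tangent[OF c q qc]
  note closed = tangent_space_linear[OF mfd_B proj_in[OF q]]
  have bil: "T (\<pi> q) (\<lambda>f. r * u f + s * v f) w f = r * T (\<pi> q) u w f + s * T (\<pi> q) v w f"
    "T (\<pi> q) w (\<lambda>f. r * u f + s * v f) f = r * T (\<pi> q) w u f + s * T (\<pi> q) w v f"
    if "u \<in> ?W" "v \<in> ?W" "w \<in> ?W" for r s u v w
    using tensor[unfolded tensor_field_12_def, THEN conjunct2, THEN conjunct1, rule_format,
        OF proj_in[OF q] that, of r s] by auto
  have z: "lincomb UNIV z ?X \<in> ?W"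
    by (rule linear_lincomb(1)[where L = "\<lambda>_. 0" and W = ?W, OF closed]) (use X in auto)
  \<comment> \<open>Linearity is used with the test function \<open>f\<close> held fixed, so that
    each slot of \<open>T\<close> becomes a real-valued functional.\<close>
  have 1: "T (\<pi> q) (lincomb UNIV y ?X) (lincomb UNIV z ?X) f =
      (\<Sum>a\<in>UNIV. y a * T (\<pi> q) (?X a) (lincomb UNIV z ?X) f)"
    by (rule linear_lincomb(2)[where W = ?W, OF closed bil(1)]) (use X z in auto)
  have 2: "T (\<pi> q) (?X a) (lincomb UNIV z ?X) f = (\<Sum>b\<in>UNIV. z b * T (\<pi> q) (?X a) (?X b) f)" for a
    by (rule linear_lincomb(2)[where W = ?W, OF closed bil(2)]) (use X in auto)
  have 3: "T (\<pi> q) (?X a) (?X b) f = (\<Sum>d\<in>UNIV. R c a b d q * ?X d f)" for a b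
    using fun_cong[OF gyroscopic_tensor_coord[OF c q qc]] .
  have "T (\<pi> q) (lincomb UNIV y ?X) (lincomb UNIV z ?X) f =
      (\<Sum>a\<in>UNIV. \<Sum>b\<in>UNIV. \<Sum>d\<in>UNIV. y a * z b * R c a b d q * ?X d f)"
    unfolding 1 2 3 by (simp add: sum_distrib_left mult_ac)
  also have "\<dots> = (\<Sum>d\<in>UNIV. \<Sum>a\<in>UNIV. \<Sum>b\<in>UNIV. y a * z b * R c a b d q * ?X d f)"
    by (subst (2) sum.swap, subst sum.swap) (rule refl)
  finally show "T (\<pi> q) (lincomb UNIV y ?X) (lincomb UNIV z ?X) f =
      lincomb UNIV (\<lambda>d. \<Sum>a\<in>UNIV. \<Sum>b\<in>UNIV. y a * z b * R c a b d q) ?X f"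
    by (simp add: lincomb_def sum_distrib_right)
qed

text \<open>With \<open>q\<close> the representative that \<open>g_red\<close> itself chooses, both
  horizontal lifts are combinations of the \<open>Xa\<close> at this same point.
  \<open>lowered_bracket\<close> then turns the components of \<open>T\<close> into
  \<open>GR\<close>.\<close>

lemma g_red_gyroscopic:
  fixes b :: "'q set"
  defines "q \<equiv> SOME q. q \<in> b"
  assumes b: "b \<in> points B" and c: "c \<in> atlas B" and bc: "b \<in> cdom c"
  shows "g_red S b (lincomb UNIV x (\<lambda>a. coord_field S c a b))
      (T b (lincomb UNIV y (\<lambda>a. coord_field S c a b)) (lincomb UNIV z (\<lambda>a. coord_field S c a b))) =
    (\<Sum>a\<in>UNIV. \<Sum>e\<in>UNIV. \<Sum>d\<in>UNIV. x a * y e * z d * GR S R' c a e d q)"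
proof -
  have q: "q \<in> points Q" "\<pi> q = b" using representative[OF b] by (auto simp: q_def)
  have qc: "\<pi> q \<in> cdom c" using q(2) bc by simp
  let ?y = "\<lambda>d. \<Sum>a\<in>UNIV. \<Sum>b\<in>UNIV. y a * z b * R c a b d q"
  have inner: "(\<Sum>d\<in>UNIV. ?y d * Gab S c a d q) = (\<Sum>e\<in>UNIV. \<Sum>f\<in>UNIV. y e * z f * GR S R' c a e f q)" for a
  proof -
    have "(\<Sum>d\<in>UNIV. ?y d * Gab S c a d q) =
        (\<Sum>d\<in>UNIV. \<Sum>e\<in>UNIV. \<Sum>f\<in>UNIV. y e * z f * (Gab S c a d q * R c e f d q))"
      by (simp add: sum_distrib_left mult_ac)
    also have "\<dots> = (\<Sum>e\<in>UNIV. \<Sum>f\<in>UNIV. \<Sum>d\<in>UNIV. y e * z f * (Gab S c a d q * R c e f d q))"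
      by (subst sum.swap, subst (2) sum.swap) (rule refl)
    finally show ?thesis
      by (simp add: sum_distrib_left[symmetric] lowered_bracket[OF comps c q(1) qc])
  qed
  have "g_red S b (lincomb UNIV x (\<lambda>a. coord_field S c a b))
      (T b (lincomb UNIV y (\<lambda>a. coord_field S c a b)) (lincomb UNIV z (\<lambda>a. coord_field S c a b))) =
    riem S q (lincomb UNIV x (\<lambda>a. Xa S c a q)) (lincomb UNIV ?y (\<lambda>a. Xa S c a q))"
    using gyroscopic_tensor_lincomb[OF c q(1) qc] hor_lift_lincomb[OF c q(1) qc]
    by (simp add: g_red_def Let_def q_def[symmetric] q(2))
  also have "\<dots> = (\<Sum>a\<in>UNIV. x a * (\<Sum>d\<in>UNIV. ?y d * Gab S c a d q))"
  proof -
    have v: "lincomb UNIV ?y (\<lambda>a. Xa S c a q) \<in> tangent_space Q q"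
      by (rule riem_lincomb(1)[OF c q(1) qc finite_class.finite_UNIV Xa_tangent Xa_tangent]) (use c q qc in auto)
    show ?thesis
      using riem_lincomb(2)[OF c q(1) qc finite_class.finite_UNIV _ v, where v = "\<lambda>a. Xa S c a q" and r = x]
        riem_lincomb(3)[OF c q(1) qc finite_class.finite_UNIV, where v = "\<lambda>a. Xa S c a q" and r = ?y]
        Xa_tangent[OF c q(1) qc]
      by (simp add: Gab_def)
  qed
  also have "\<dots> = (\<Sum>a\<in>UNIV. x a * (\<Sum>e\<in>UNIV. \<Sum>f\<in>UNIV. y e * z f * GR S R' c a e f q))"
    by (simp only: inner)
  finally show ?thesis by (simp add: sum_distrib_left mult_ac)
qed

text \<open>From left to right each coordinate vector at \<open>b\<close> is extended to a global
  field of its own. From right to left only the values of the fields at \<open>b\<close> enter, and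
  the cyclic sum is trilinear in them.\<close>

lemma cyclic_condition_iff:
  "cyclic_condition S T \<longleftrightarrow>
    (\<forall>b\<in>points B. \<forall>c\<in>atlas B. b \<in> cdom c \<longrightarrow> (\<forall>a e d.
      GR S R' c a e d (SOME q. q \<in> b) + GR S R' c e d a (SOME q. q \<in> b) + GR S R' c d a e (SOME q. q \<in> b) = 0))"
proof (intro iffI ballI impI allI)
  fix b c a e d
  assume cyc: "cyclic_condition S T" and b: "b \<in> points B" and c: "c \<in> atlas B" and bc: "b \<in> cdom c"
  let ?q = "SOME q. q \<in> b" and ?\<delta> = "\<lambda>i j. if j = i then 1 else (0::real)"
  let ?X = "\<lambda>a. coord_field S c a b"
  have "?X a \<in> tangent_space B b" for a
    unfolding coord_field_def by (rule chart_vec_tangent[OF c bc])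
  then have "\<exists>X. vector_field_on B (points B) X \<and> X b = ?X a" for a
    using extend_tangent_vector[OF mfd_B b] by metis
  then obtain Y where Y: "\<And>a. vector_field_on B (points B) (Y a)" "\<And>a. Y a b = ?X a" by metis
  \<comment> \<open>Kronecker coefficients put a single coordinate vector into the form required by
    the formula for \<open>g_red\<close>.\<close>
  have Xl: "?X a = lincomb UNIV (?\<delta> a) ?X" for a
    by (simp add: lincomb_def fun_eq_iff if_distrib[of "\<lambda>x. x * _"] cong: if_cong)
  have red: "g_red S b (?X a) (T b (?X e) (?X d)) = GR S R' c a e d ?q" for a e d
  proof -
    have "g_red S b (?X a) (T b (?X e) (?X d)) =
        (\<Sum>i\<in>UNIV. \<Sum>j\<in>UNIV. \<Sum>k\<in>UNIV. ?\<delta> a i * ?\<delta> e j * ?\<delta> d k * GR S R' c i j k ?q)"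
      using g_red_gyroscopic[OF b c bc, of "?\<delta> a" "?\<delta> e" "?\<delta> d"] by (simp only: Xl[symmetric])
    also have "\<dots> = (\<Sum>i\<in>UNIV. ?\<delta> a i * (\<Sum>j\<in>UNIV. ?\<delta> e j * (\<Sum>k\<in>UNIV. ?\<delta> d k * GR S R' c i j k ?q)))"
      by (simp only: sum_distrib_left mult.assoc)
    also have "\<dots> = GR S R' c a e d ?q"
      by (simp add: if_distrib[of "\<lambda>x. x * _"] cong: if_cong)
    finally show ?thesis .
  qed
  have "g_red S b (Y a b) (T b (Y e b) (Y d b)) + g_red S b (Y e b) (T b (Y d b) (Y a b))
      + g_red S b (Y d b) (T b (Y a b) (Y e b)) = 0"
    using cyc b Y(1) unfolding cyclic_condition_def by blast
  then show "GR S R' c a e d ?q + GR S R' c e d a ?q + GR S R' c d a e ?q = 0"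
    by (simp add: Y(2) red)
next
  assume *: "\<forall>b\<in>points B. \<forall>c\<in>atlas B. b \<in> cdom c \<longrightarrow> (\<forall>a e d.
      GR S R' c a e d (SOME q. q \<in> b) + GR S R' c e d a (SOME q. q \<in> b) + GR S R' c d a e (SOME q. q \<in> b) = 0)"
  show "cyclic_condition S T"
    unfolding cyclic_condition_def
  proof (intro allI impI ballI)
    fix X Y Z b
    assume XYZ: "vector_field_on B (points B) X \<and> vector_field_on B (points B) Y \<and> vector_field_on B (points B) Z"
      and b: "b \<in> points B"
    let ?q = "SOME q. q \<in> b"
    obtain c where c: "c \<in> atlas B" "b \<in> cdom c" using smooth_manifold_cover[OF mfd_B b] by blast
    have q: "?q \<in> points Q" "\<pi> ?q = b" using representative[OF b] by auto
    have "\<exists>r. v = lincomb UNIV r (\<lambda>a. coord_field S c a b)" if "v \<in> tangent_space B b" for v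
      using that tangent_space_chart[OF mfd_B c] chart_vec_expand[OF c(1) q(1)] c(2) q(2) by auto
    moreover have "X b \<in> tangent_space B b" "Y b \<in> tangent_space B b" "Z b \<in> tangent_space B b"
      using XYZ b unfolding vector_field_on_def by blast+
    ultimately obtain x y z where xyz: "X b = lincomb UNIV x (\<lambda>a. coord_field S c a b)"
      "Y b = lincomb UNIV y (\<lambda>a. coord_field S c a b)" "Z b = lincomb UNIV z (\<lambda>a. coord_field S c a b)"
      by metis
    note g = g_red_gyroscopic[OF b c]
    \<comment> \<open>Renaming the summation indices moves the cyclic shift from the coefficients to
      the indices of \<open>GR\<close>, so that the three sums share a common factor.\<close>
    have 1: "(\<Sum>a\<in>UNIV. \<Sum>e\<in>UNIV. \<Sum>d\<in>UNIV. y a * z e * x d * GR S R' c a e d ?q) =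
        (\<Sum>a\<in>UNIV. \<Sum>e\<in>UNIV. \<Sum>d\<in>UNIV. x a * y e * z d * GR S R' c e d a ?q)" for x y z :: "'m \<Rightarrow> real"
      by (subst (2) sum.swap, subst sum.swap) (simp add: mult_ac)
    have "(\<Sum>a\<in>UNIV. \<Sum>e\<in>UNIV. \<Sum>d\<in>UNIV. z a * x e * y d * GR S R' c a e d ?q) =
        (\<Sum>a\<in>UNIV. \<Sum>e\<in>UNIV. \<Sum>d\<in>UNIV. x a * y e * z d * GR S R' c d a e ?q)"
      by (subst sum.swap, subst (2) sum.swap) (simp add: mult_ac)
    then have "g_red S b (X b) (T b (Y b) (Z b)) + g_red S b (Y b) (T b (Z b) (X b)) + g_red S b (Z b) (T b (X b) (Y b)) =
        (\<Sum>a\<in>UNIV. \<Sum>e\<in>UNIV. \<Sum>d\<in>UNIV. x a * y e * z d *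
          (GR S R' c a e d ?q + GR S R' c e d a ?q + GR S R' c d a e ?q))"
      unfolding xyz g by (simp add: 1 distrib_left sum.distrib)
    also have "\<dots> = 0" using * b c by simp
    finally show "g_red S b (X b) (T b (Y b) (Z b)) + g_red S b (Y b) (T b (Z b) (X b))
        + g_red S b (Z b) (T b (X b) (Y b)) = 0" .
  qed
qed

lemma phi_simple_iff:
  "phi_simple S R \<phi> \<longleftrightarrow> (\<forall>c\<in>atlas B. \<forall>q\<in>points Q. \<pi> q \<in> cdom c \<longrightarrow>
    (\<forall>e a b. GR S R' c e a b q = - pd S c \<phi> a q * Gab S c e b q + pd S c \<phi> b q * Gab S c e a q))"
  unfolding phi_simple_def using phi_simple_lowered[OF comps] by simp

lemma phi_simple_iff_condition_A:
  "phi_simple S R \<phi> \<longleftrightarrow> condition_A S R' \<phi> \<and> cyclic_condition S T"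
proof
  assume P: "phi_simple S R \<phi>"
  have "condition_A S R' \<phi>"
    unfolding condition_A_def
    using P[unfolded phi_simple_iff] phi_simple_iff_condition_A_cyclic[OF comps] by blast
  moreover have "cyclic_condition S T"
    unfolding cyclic_condition_iff
  proof (intro ballI impI)
    fix b c assume b: "b \<in> points B" and c: "c \<in> atlas B" "b \<in> cdom c"
    let ?q = "SOME q. q \<in> b"
    have q: "?q \<in> points Q" "\<pi> ?q \<in> cdom c" using representative[OF b] c by auto
    then have "\<forall>e a b. GR S R' c e a b ?q = - pd S c \<phi> a ?q * Gab S c e b ?q + pd S c \<phi> b ?q * Gab S c e a ?q"
      using P[unfolded phi_simple_iff] c(1) by blast
    then show "\<forall>a e d. GR S R' c a e d ?q + GR S R' c e d a ?q + GR S R' c d a e ?q = 0"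
      unfolding phi_simple_iff_condition_A_cyclic[OF comps c(1) q] by blast
  qed
  ultimately show "condition_A S R' \<phi> \<and> cyclic_condition S T" ..
next
  assume *: "condition_A S R' \<phi> \<and> cyclic_condition S T"
  show "phi_simple S R \<phi>"
    unfolding phi_simple_def
  proof (intro ballI impI)
    fix c q assume c: "c \<in> atlas B" and q: "q \<in> points Q" and qc: "\<pi> q \<in> cdom c"
    \<comment> \<open>The cyclic condition speaks only about the representative chosen in
      \<open>g_red\<close>. Simplicity is proved at that point and carried to \<open>q\<close>,
      since \<open>R\<close> and the derivatives of \<open>\<phi>\<close> depend only on the
      projection.\<close>
    define p where "p = (SOME x. x \<in> \<pi> q)"
    have p: "p \<in> points Q" "\<pi> p = \<pi> q"
      using representative[OF proj_in[OF q]] by (auto simp: p_def)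
    have pc: "\<pi> p \<in> cdom c" using p(2) qc by simp
    have "\<forall>a e d. GR S R' c a e d p + GR S R' c e d a p + GR S R' c d a e p = 0"
      using * proj_in[OF q] c qc unfolding cyclic_condition_iff p_def by blast
    moreover have "\<forall>a b d. GR S R' c b a d p + GR S R' c a b d p
        + Gab S c b d p * pd S c \<phi> a p + Gab S c a d p * pd S c \<phi> b p - 2 * Gab S c a b p * pd S c \<phi> d p = 0"
      using * c p(1) pc unfolding condition_A_def by blast
    ultimately have "\<forall>e a b. GR S R' c e a b p = - pd S c \<phi> a p * Gab S c e b p + pd S c \<phi> b p * Gab S c e a p"
      unfolding phi_simple_iff_condition_A_cyclic[OF comps c p(1) pc] by blast
    then have "\<forall>a b d. R c a b d p =
        - pd S c \<phi> a p * (if d = b then 1 else 0) + pd S c \<phi> b p * (if d = a then 1 else 0)"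
      unfolding phi_simple_lowered[OF comps c p(1) pc] .
    moreover have "pd S c \<phi> a p = pd S c \<phi> a q" for a by (simp add: pd_def p(2))
    moreover have "R c a b d p = R c a b d q" for a b d
      by (rule bracket_component_basic[OF c q p(1) qc p(2)])
    ultimately show "\<forall>a b d. R c a b d q =
        - pd S c \<phi> a q * (if d = b then 1 else 0) + pd S c \<phi> b q * (if d = a then 1 else 0)" by simp
  qed
qed

end

end

theorem proposition7:
  fixes S :: "('q, 'e::euclidean_space, 'g, 'h::real_normed_vector, 'm::finite) chaplygin"
    and R :: "('q set, real^'m) chart \<Rightarrow> 'm \<Rightarrow> 'm \<Rightarrow> 'm \<Rightarrow> 'q \<Rightarrow> real"
    and R' :: "('q set, real^'m) chart \<Rightarrow> 'm \<Rightarrow> 'm \<Rightarrow> nat \<Rightarrow> 'q \<Rightarrow> real"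
    and T :: "'q set \<Rightarrow> 'q set tvec \<Rightarrow> 'q set tvec \<Rightarrow> 'q set tvec"
    and \<phi> :: "'q set \<Rightarrow> real"
  assumes "chaplygin_system S"
    and "bracket_components S R R'"
    and "gyroscopic_tensor S R T"
    and "smooth_fun_on (base S) (points (base S)) \<phi>"
  shows "(phi_simple S R \<phi> \<longleftrightarrow> condition_A S R' \<phi> \<and> cyclic_condition S T) \<and>
         (phi_simple S R \<phi> \<longleftrightarrow> form_condition S \<phi> (Xi_G S R')) \<and>
         (condition_A S R' \<phi> \<longleftrightarrow> form_condition S \<phi> (gamma_G S R'))"
proof -
  interpret kinetic_chaplygin S by unfold_locales (rule assms(1))
  show ?thesis
  proof (intro conjI)
    show "phi_simple S R \<phi> \<longleftrightarrow> condition_A S R' \<phi> \<and> cyclic_condition S T"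
      by (rule phi_simple_iff_condition_A[OF assms(2,3)])
    show "phi_simple S R \<phi> \<longleftrightarrow> form_condition S \<phi> (Xi_G S R')"
      unfolding phi_simple_iff[OF assms(2,3)] form_condition_def
      using Xi_G_iff[OF assms(2)] by simp
    show "condition_A S R' \<phi> \<longleftrightarrow> form_condition S \<phi> (gamma_G S R')"
      unfolding condition_A_def form_condition_def
      using gamma_G_iff[OF assms(2)] by simp
  qed
qed

end
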